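(* Fix $p\ge 2$, $\boldsymbol\theta_0\in\mathcal S^{p-1}$ and $\xi>0$. Let $(\delta_n)$ be a bounded positive sequence such that $$\mathbf V_{0n}:=\Big(1-\frac{\delta_n\xi}{p}\Big)\mathbf I_p+\delta_n\xi\,\boldsymbol\theta_0\boldsymbol\theta_0'$$ is positive definite for every $n$. Let $(\nu_n)$ be a positive sequence and $(\boldsymbol\tau_n)$ a bounded sequence in $\mathbb R^p$ with $\boldsymbol\theta_0+\nu_n\boldsymbol\tau_n\in\mathcal S^{p-1}$ for all $n$, and put $$\mathbf V_{1n}:=\Big(1-\frac{\delta_n\xi}{p}\Big)\mathbf I_p+\delta_n\xi(\boldsymbol\theta_0+\nu_n\boldsymbol\tau_n)(\boldsymbol\theta_0+\nu_n\boldsymbol\tau_n)'.$$ Let $\Lambda_n:=\log(d\mathrm P^{(n)}_{\mathbf V_{1n}}/d\mathrm P^{(n)}_{\mathbf V_{0n}})$ and $\gamma_n:=p\delta_n\xi/(p+(p-1)\delta_n\xi)$. Then, as $n\to\infty$, under $\mathrm P^{(n)}_{\mathbf V_{0n}}$: (i) if $\delta_n\equiv1$, then for $\nu_n=1/(\sqrt n\gamma_n)$, $\Lambda_n=\boldsymbol\tau_n'\boldsymbol\Delta^{(i)}-\tfrac12\boldsymbol\tau_n'\boldsymbol\Gamma^{(i)}\boldsymbol\tau_n+o_{\mathrm P}(1)$, where $\boldsymbol\Gamma^{(i)}:=\frac{p(p+(p-1)\xi)}{(p+2)(p-\xi)}(\mathbf I_p-\boldsymbol\theta_0\boldsymbol\theta_0')$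 and $\boldsymbol\Delta^{(i)}:=p\frac{\sqrt{p+(p-1)\xi}}{\sqrt{p-\xi}}(\mathbf I_p-\boldsymbol\theta_0\boldsymbol\theta_0')\sqrt n\big(\mathbf S_n(\mathbf V_{0n})-\tfrac1p\mathbf I_p\big)\boldsymbol\theta_0$ is asymptotically normal with mean zero and covariance matrix $\boldsymbol\Gamma^{(i)}$; (ii) if $\delta_n=o(1)$ with $\sqrt n\delta_n\to\infty$, then for $\nu_n=1/(\sqrt n\gamma_n)$, $\Lambda_n=\boldsymbol\tau_n'\boldsymbol\Delta^{(ii)}-\tfrac12\boldsymbol\tau_n'\boldsymbol\Gamma^{(ii)}\boldsymbol\tau_n+o_{\mathrm P}(1)$, where $\boldsymbol\Gamma^{(ii)}:=\frac{p}{p+2}(\mathbf I_p-\boldsymbol\theta_0\boldsymbol\theta_0')$ and $\boldsymbol\Delta^{(ii)}:=p(\mathbf I_p-\boldsymbol\theta_0\boldsymbol\theta_0')\sqrt n\big(\mathbf S_n(\mathbf V_{0n})-\tfrac1p\mathbf I_p\big)\boldsymbol\theta_0$ is asymptotically normal with mean zero and covariance matrix $\boldsymbol\Gamma^{(ii)}$; (iii) if $\delta_n=1/\sqrt n$, then for $\nu_n=1/(\sqrt n\gamma_n)$, $$\Lambda_n=\boldsymbol\tau_n'\boldsymbol\Upsilon^{(n)}\boldsymbol\theta_0+\frac1{2\xi}\boldsymbol\tau_n'\boldsymbol\Upsilon^{(n)}\boldsymbol\tau_n-\frac{p}{2(p+2)}\Big(\|\boldsymbol\tau_n\|^2-\frac1{4\xi^2}\|\boldsymbol\tau_n\|^4\Big)+o_{\mathrm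 P}(1),$$ where $\boldsymbol\Upsilon^{(n)}:=p\sqrt n\big(\mathbf S_n(\mathbf V_{0n})-\tfrac1p\mathbf I_p\big)$ is such that $\mathrm{vec}(\boldsymbol\Upsilon^{(n)})$ is asymptotically normal with mean zero and covariance matrix $\frac p{p+2}(\mathbf I_{p^2}+\mathbf K_p+\mathbf J_p)-\mathbf J_p$; (iv) if $\sqrt n\delta_n\to0$, then for $\nu_n\equiv 1/\xi$, $\Lambda_n=o_{\mathrm P}(1)$.
   Context: $\mathcal S^{p-1}$ is the unit sphere of $\mathbb R^p$. For a symmetric positive definite $p\times p$ matrix $\mathbf V$ with trace $p$ (a shape matrix), $\mathrm P^{(n)}_{\mathbf V}$ denotes the hypothesis under which $\mathbf U_{n1},\dots,\mathbf U_{nn}$ are i.i.d. with the angular Gaussian density $\mathbf u\mapsto \frac{\Gamma(p/2)}{2\pi^{p/2}(\det\mathbf V)^{1/2}}(\mathbf u'\mathbf V^{-1}\mathbf u)^{-p/2}$ on $\mathcal S^{p-1}$ with respect to surface area measure (the observations form a triangular array). For a shape matrix $\mathbf V$, $\mathbf S_n(\mathbf V):=\frac1n\sum_{i=1}^n\frac{\mathbf V^{-1/2}\mathbf U_{ni}\mathbf U_{ni}'\mathbf V^{-1/2}}{\|\mathbf V^{-1/2}\mathbf U_{ni}\|^2}$. With $\mathbf e_\ell$ the canonical basis vectors of $\mathbb R^p$, $\mathbf K_p:=\sum_{i,j}(\mathbf e_i\mathbf e_j')\otimes(\mathbf e_j\mathbf e_i')$ is the commutation matrix and $\mathbf J_p:=(\mathrm{vec}\,\mathbf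 I_p)(\mathrm{vec}\,\mathbf I_p)'$. *)

theory Defs
  imports "HOL-Probability.Probability"
begin

definition outer :: "real^'n \<Rightarrow> real^'n \<Rightarrow> real^'n^'n" where
  "outer x y = (\<chi> i j. x $ i * y $ j)"

definition posdef :: "real^'n^'n \<Rightarrow> bool" where
  "posdef A \<longleftrightarrow> transpose A = A \<and> (\<forall>x. x \<noteq> 0 \<longrightarrow> x \<bullet> (A *v x) > 0)"

definition inv_sqrt_mat :: "real^'n^'n \<Rightarrow> real^'n^'n" where
  "inv_sqrt_mat V = (THE R. posdef R \<and> R ** R = matrix_inv V)"

text \<open>Kronecker product, with rows/columns of a p^2 x p^2 matrix indexed by pairs
  (outer block index, inner index); vec stacks columns, so vec X at (j,i) is X_ij.\<close>
definition kron :: "real^'n^'n \<Rightarrow> real^'n^'n \<Rightarrow> real^('n\<times>'n)^('n\<times>'n)" where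
  "kron A B = (\<chi> ab cd. A $ fst ab $ fst cd * B $ snd ab $ snd cd)"

definition vecm :: "real^'n^'n \<Rightarrow> real^('n\<times>'n)" where
  "vecm X = (\<chi> ji. X $ snd ji $ fst ji)"

definition commutation_matrix :: "real^('n::finite\<times>'n)^('n\<times>'n)" where
  "commutation_matrix = (\<Sum>i\<in>UNIV. \<Sum>j\<in>UNIV.
      kron (outer (axis i 1) (axis j 1)) (outer (axis j 1) (axis i 1)))"

definition J_matrix :: "real^('n::finite\<times>'n)^('n\<times>'n)" where
  "J_matrix = outer (vecm (mat 1 :: real^'n^'n)) (vecm (mat 1 :: real^'n^'n))"

text \<open>Surface area measure on the unit sphere, realised as the cone measure:
  sigma(A) = p * lambda({x in unit ball : x/|x| in A}).\<close>
definition surface_sphere :: "(real^'n) measure" where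
  "surface_sphere = scale_measure (of_nat CARD('n))
     (distr (restrict_space lborel (ball 0 1)) borel (\<lambda>x. x /\<^sub>R norm x))"

definition ag_density :: "real^'n^'n \<Rightarrow> real^'n \<Rightarrow> real" where
  "ag_density V u = Gamma (real CARD('n) / 2)
      / (2 * pi powr (real CARD('n) / 2) * sqrt (det V))
      * (u \<bullet> (matrix_inv V *v u)) powr (- (real CARD('n) / 2))"

definition angular_gaussian :: "real^'n^'n \<Rightarrow> (real^'n) measure" where
  "angular_gaussian V = density surface_sphere
      (\<lambda>u. ennreal (ag_density V u) * indicator (sphere 0 1) u)"

definition sample_law :: "nat \<Rightarrow> real^'n^'n \<Rightarrow> (nat \<Rightarrow> real^'n) measure" where
  "sample_law n V = PiM {..<n} (\<lambda>_. angular_gaussian V)"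

definition S_stat :: "nat \<Rightarrow> real^'n^'n \<Rightarrow> (nat \<Rightarrow> real^'n) \<Rightarrow> real^'n^'n" where
  "S_stat n V \<omega> = (1 / real n) *\<^sub>R (\<Sum>i<n.
      (1 / (norm (inv_sqrt_mat V *v \<omega> i))\<^sup>2) *\<^sub>R
        outer (inv_sqrt_mat V *v \<omega> i) (inv_sqrt_mat V *v \<omega> i))"

definition log_lr :: "nat \<Rightarrow> real^'n^'n \<Rightarrow> real^'n^'n \<Rightarrow> (nat \<Rightarrow> real^'n) \<Rightarrow> real" where
  "log_lr n V0 V1 \<omega> = ln (enn2real (RN_deriv (sample_law n V0) (sample_law n V1) \<omega>))"

definition spiked_shape :: "real \<Rightarrow> real \<Rightarrow> real^'n \<Rightarrow> real^'n^'n" where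
  "spiked_shape d \<xi> \<theta> = (1 - d * \<xi> / real CARD('n)) *\<^sub>R mat 1 + (d * \<xi>) *\<^sub>R outer \<theta> \<theta>"

definition o_P1 :: "(nat \<Rightarrow> 'a measure) \<Rightarrow> (nat \<Rightarrow> 'a \<Rightarrow> real) \<Rightarrow> bool" where
  "o_P1 P X \<longleftrightarrow> (\<forall>n. X n \<in> borel_measurable (P n)) \<and>
     (\<forall>\<epsilon>>0. (\<lambda>n. measure (P n) {\<omega> \<in> space (P n). \<bar>X n \<omega>\<bar> > \<epsilon>}) \<longlonglongrightarrow> 0)"

text \<open>mu is the centred normal law whose covariance has quadratic form q (t' Sigma t),
  characterised through its characteristic function.\<close>
definition is_centred_normal :: "'b::euclidean_space measure \<Rightarrow> ('b \<Rightarrow> real) \<Rightarrow> bool" where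
  "is_centred_normal \<mu> q \<longleftrightarrow> prob_space \<mu> \<and> sets \<mu> = sets borel \<and>
     (\<forall>t. integral\<^sup>L \<mu> (\<lambda>x. cis (t \<bullet> x)) = complex_of_real (exp (- q t / 2)))"

definition asymp_normal :: "(nat \<Rightarrow> 'a measure) \<Rightarrow> (nat \<Rightarrow> 'a \<Rightarrow> 'b::euclidean_space)
      \<Rightarrow> ('b \<Rightarrow> real) \<Rightarrow> bool" where
  "asymp_normal P X q \<longleftrightarrow> (\<forall>n. X n \<in> borel_measurable (P n)) \<and>
     (\<exists>\<mu>. is_centred_normal \<mu> q \<and>
        (\<forall>f::'b \<Rightarrow> real. continuous_on UNIV f \<and> bounded (range f) \<longrightarrow>
           (\<lambda>n. \<integral>\<omega>. f (X n \<omega>) \<partial>(P n)) \<longlonglongrightarrow> (\<integral>x. f x \<partial>\<mu>)))"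

end

theory Submission imports Defs "HOL-Real_Asymp.Real_Asymp" begin

text \<open>Under the null law, the standardised observation \<open>W = sgn (V\<^sub>0\<^sup>-\<^sup>1\<^sup>/\<^sup>2 U)\<close> is uniform on the sphere,
  and the log-likelihood ratio is a sum of terms \<open>- p / 2 * ln (1 - X\<^sub>n W)\<close>, where \<open>X\<^sub>n\<close> is an
  explicit quadratic polynomial which is uniformly small (of order \<open>1 / sqrt n\<close> for the contiguous
  alternatives). Expanding the logarithm to second order leaves the centred sum of \<open>p / 2 * X\<^sub>n\<close>,
  whose leading part is the stated statistic, and a deterministic drift given by the second and
  fourth moments of the uniform distribution; all other terms are centred sums of bounded
  variables and vanish by Hoeffding's inequality. The statistic itself is a normalised sum of fixed
  functions of uniform variables, so its characteristic function converges; in several dimensions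
  weak convergence follows because trigonometric polynomials approximate bounded continuous
  functions on large boxes.\<close>

section \<open>Linear changes of variables for Lebesgue measure\<close>

text \<open>The obstacle is that the null law itself moves with \<open>n\<close>. Standardising
  removes this exactly, not just in the limit: each row of the triangular array is pushed to the
  same law, so a limit theorem for one fixed bounded function suffices. The regimes share one
  expansion because only the eigenvalues of the null shape enter, \<open>a + b\<close> along
  \<open>\<theta>\<close> and \<open>a\<close> across it. The rate \<open>\<gamma>\<close> equals
  \<open>b / (a + b)\<close>, so the local choice of \<open>\<nu>\<close> gives
  \<open>b * \<nu> = (a + b) / sqrt n\<close>, and the deviation stays of order
  \<open>1 / sqrt n\<close> even when \<open>b\<close> tends to zero. Unit length of
  \<open>\<theta> + \<nu> \<tau>\<close> forces
  \<open>2 (\<theta> \<bullet> \<tau>) + \<nu> |\<tau>|^2 = 0\<close>. The drift contains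
  \<open>|\<tau>|^2 - (\<theta> \<bullet> \<tau>)^2 = |\<tau>|^2 - \<nu>^2 |\<tau>|^4 / 4\<close>;
  the last term survives only if \<open>\<nu>\<close> has a positive limit, and this is the quartic
  term of (iii). The first two moments of the deviation are exact polynomials in one quantity
  \<open>s\<close>, so the drift is \<open>- p / (2 (p + 2))\<close> times \<open>n s\<close>, up to
  a term of order \<open>n s^2\<close>.\<close>

lemma borel_measurable_matrix_vector_mult [measurable]:
  "(*v) (A :: real^'n^'m) \<in> borel_measurable borel"
  by (intro borel_measurable_continuous_onI linear_continuous_on matrix_vector_mul_bounded_linear)

lemma det_shear:
  fixes m n :: "'n::finite"
  assumes "m \<noteq> n"
  shows "det (\<chi> i j. of_bool (i = m \<and> j = n \<or> i = j) :: real^'n^'n) = 1"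
proof -
  have "(\<chi> i j. of_bool (i = m \<and> j = n \<or> i = j) :: real^'n^'n)
     = (\<chi> k. if k = m then row m (mat 1) + 1 *s row n (mat 1) else row k (mat 1))"
    using assms by (auto simp: vec_eq_iff row_def mat_def)
  then show ?thesis
    using det_row_operation[OF assms, of "mat 1 :: real^'n^'n" 1] by simp
qed

text \<open>Once coordinate \<open>m\<close> is split off by Fubini, the shear is a translation by
  the constant \<open>x $ n\<close>, because \<open>n \<noteq> m\<close>; translation invariance in
  one dimension does the rest.\<close>

lemma nn_integral_lborel_shear:
  fixes g :: "real^'n \<Rightarrow> ennreal"
  assumes mn: "m \<noteq> n" and g [measurable]: "g \<in> borel_measurable borel"
  shows "(\<integral>\<^sup>+x. g (x + axis m (x $ n)) \<partial>lborel) = (\<integral>\<^sup>+x. g x \<partial>lborel)"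
proof -
  let ?B = "Basis :: (real^'n) set"
  let ?m = "axis m 1 :: real^'n" and ?n = "axis n 1 :: real^'n"
  have ne: "?m \<noteq> ?n" using mn by (simp add: axis_eq_axis)
  have mB: "?m \<in> ?B" "?n \<in> ?B" by (auto simp: axis_in_Basis_iff)
  have B: "?B = insert ?m (?B - {?m})" using mB by auto
  interpret product_sigma_finite "\<lambda>_ :: real^'n. lborel :: real measure" ..
  define S where "S f = (\<Sum>b\<in>?B. f b *\<^sub>R b)" for f :: "real^'n \<Rightarrow> real"
  have S_meas [measurable]: "S \<in> PiM ?B (\<lambda>_. lborel) \<rightarrow>\<^sub>M borel"
    unfolding S_def by measurable
  have lb: "(lborel :: (real^'n) measure) = distr (PiM ?B (\<lambda>_. lborel)) borel S"
    unfolding S_def by (rule lborel_eq)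
  \<comment> \<open>Coordinate \<open>m\<close> is separated from a base point in which it is zero,
    so that the inner integral runs along a line.\<close>
  have upd: "S (f(?m := y)) = S (f(?m := 0)) + axis m y" for f y
  proof -
    have "S (f(?m := y)) = y *\<^sub>R ?m + (\<Sum>b\<in>?B - {?m}. (f(?m := y)) b *\<^sub>R b)"
      using mB unfolding S_def by (subst sum.remove[of _ ?m]) auto
    also have "(\<Sum>b\<in>?B - {?m}. (f(?m := y)) b *\<^sub>R b) = (\<Sum>b\<in>?B - {?m}. (f(?m := 0)) b *\<^sub>R b)"
      by (intro sum.cong) auto
    also have "\<dots> = S (f(?m := 0))"
      using mB unfolding S_def by (subst (2) sum.remove[of _ ?m]) auto
    also have "y *\<^sub>R ?m = axis m y" by (simp add: axis_def vec_eq_iff)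
    finally show ?thesis by (simp only: add.commute)
  qed
  have Sn: "S f $ n = f ?n" for f
  proof -
    have "S f $ n = S f \<bullet> ?n" by (simp add: inner_axis)
    also have "\<dots> = f ?n" using mB unfolding S_def
      by (simp add: inner_sum_left inner_Basis if_distrib sum.delta cong: if_cong)
    finally show ?thesis .
  qed
  have tr: "(\<integral>\<^sup>+y. h (y + c) \<partial>lborel) = (\<integral>\<^sup>+y. h y \<partial>lborel)"
    if [measurable]: "h \<in> borel_measurable borel" for h :: "real \<Rightarrow> ennreal" and c
    using nn_integral_real_affine[of h 1 c] that by (simp add: add.commute)
  have G_meas [measurable]: "(\<lambda>x. g (x + axis m (x $ n))) \<in> borel_measurable borel"
  proof -
    have "(\<lambda>x :: real^'n. x + axis m (x $ n)) = (\<lambda>x. x + (x \<bullet> axis n 1) *\<^sub>R axis m 1)"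
      by (intro ext) (simp only: inner_axis, auto simp: vec_eq_iff axis_def)
    moreover have "(\<lambda>x :: real^'n. x + (x \<bullet> axis n 1) *\<^sub>R axis m 1) \<in> borel_measurable borel"
      by measurable
    ultimately have [measurable]: "(\<lambda>x :: real^'n. x + axis m (x $ n)) \<in> borel_measurable borel" by simp
    show ?thesis by measurable
  qed
  have "(\<integral>\<^sup>+x. g (x + axis m (x $ n)) \<partial>lborel)
      = (\<integral>\<^sup>+f. g (S f + axis m (S f $ n)) \<partial>PiM (insert ?m (?B - {?m})) (\<lambda>_. lborel))"
    unfolding B[symmetric] by (subst lb, subst nn_integral_distr) auto
  also have "\<dots> = (\<integral>\<^sup>+f. (\<integral>\<^sup>+y. g (S (f(?m := y)) + axis m (S (f(?m := y)) $ n)) \<partial>lborel) \<partial>PiM (?B - {?m}) (\<lambda>_. lborel))"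
    using measurable_compose[OF S_meas G_meas]
    by (intro product_nn_integral_insert) (simp_all add: insert_absorb mB)
  also have "\<dots> = (\<integral>\<^sup>+f. (\<integral>\<^sup>+y. g (S (f(?m := y))) \<partial>lborel) \<partial>PiM (?B - {?m}) (\<lambda>_. lborel))"
  proof (rule nn_integral_cong)
    fix f :: "real^'n \<Rightarrow> real"
    have axm: "(axis m :: real \<Rightarrow> real^'n) = (\<lambda>y. y *\<^sub>R axis m 1)" by (auto simp: axis_def vec_eq_iff)
    have [measurable]: "(axis m :: real \<Rightarrow> real^'n) \<in> borel_measurable borel"
      by (subst axm) measurable
    have ax: "axis m (y + z) = (axis m y + axis m z :: real^'n)" for y z :: real by (simp add: axis_def vec_eq_iff)
    define s where "s = S (f(?m := 0))"
    have Sy: "S (f(?m := y)) = s + axis m y" for y unfolding s_def by (rule upd)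
    have "S (f(?m := y)) $ n = f ?n" for y using ne by (simp add: Sn)
    then have sn: "(s + axis m y) $ n = f ?n" for y by (simp add: Sy)
    have [measurable]: "(\<lambda>y. g (s + axis m y)) \<in> borel_measurable borel"
      by measurable
    have "(\<integral>\<^sup>+y. g (S (f(?m := y)) + axis m (S (f(?m := y)) $ n)) \<partial>lborel)
        = (\<integral>\<^sup>+y. g (s + axis m (y + f ?n)) \<partial>lborel)"
      unfolding Sy sn by (simp add: ax algebra_simps)
    also have "\<dots> = (\<integral>\<^sup>+y. g (S (f(?m := y))) \<partial>lborel)"
      unfolding Sy by (rule tr) measurable
    finally show "(\<integral>\<^sup>+y. g (S (f(?m := y)) + axis m (S (f(?m := y)) $ n)) \<partial>lborel) = (\<integral>\<^sup>+y. g (S (f(?m := y))) \<partial>lborel)" .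
  qed
  also have "\<dots> = (\<integral>\<^sup>+f. g (S f) \<partial>PiM (insert ?m (?B - {?m})) (\<lambda>_. lborel))"
    using measurable_compose[OF S_meas g]
    by (intro product_nn_integral_insert[symmetric]) (simp_all add: insert_absorb mB)
  also have "\<dots> = (\<integral>\<^sup>+x. g x \<partial>lborel)"
    unfolding B[symmetric] by (subst lb, subst nn_integral_distr) auto
  finally show ?thesis .
qed

text \<open>Lebesgue measure is determined by the volumes of boxes, and a permutation of coordinates
  only reorders the factors of such a volume.\<close>

lemma lborel_distr_permute:
  fixes \<pi> :: "'n::finite \<Rightarrow> 'n"
  assumes "bij \<pi>"
  shows "lborel = distr lborel borel (\<lambda>x :: real^'n. \<chi> i. x $ \<pi> i)"
proof (rule lborel_eqI)
  fix l u :: "real^'n" assume lu: "\<And>b. b \<in> Basis \<Longrightarrow> l \<bullet> b \<le> u \<bullet> b"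
  let ?T = "\<lambda>x :: real^'n. \<chi> i. x $ \<pi> i" and ?S = "\<lambda>x :: real^'n. \<chi> i. x $ inv \<pi> i"
  have [measurable]: "?T \<in> borel_measurable borel"
    by (intro borel_measurable_continuous_onI continuous_intros)
  have le: "l $ i \<le> u $ i" for i using lu[of "axis i 1"] by (simp add: inner_axis axis_in_Basis_iff)
  have "?T -` box l u = box (?S l) (?S u)"
    using assms by (auto simp: mem_box_cart) (metis bij_inv_eq_iff)+
  then have "emeasure (distr lborel borel ?T) (box l u) = emeasure lborel (box (?S l) (?S u))"
    by (simp add: emeasure_distr)
  also have "\<dots> = (\<Prod>b\<in>Basis. (?S u - ?S l) \<bullet> b)"
    by (subst emeasure_lborel_box) (use le in \<open>auto simp: Basis_vec_def inner_axis\<close>)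
  also have "(\<Prod>b\<in>(Basis :: (real^'n) set). (?S u - ?S l) \<bullet> b) = (\<Prod>i\<in>UNIV. u $ inv \<pi> i - l $ inv \<pi> i)"
    by (simp add: Basis_vec_def UNION_singleton_eq_range prod.reindex inj_on_def axis_eq_axis inner_axis)
  also have "\<dots> = (\<Prod>i\<in>UNIV. u $ i - l $ i)"
    using assms by (intro prod.reindex_bij_betw bij_imp_bij_inv)
  also have "\<dots> = (\<Prod>b\<in>(Basis :: (real^'n) set). (u - l) \<bullet> b)"
    by (simp add: Basis_vec_def UNION_singleton_eq_range prod.reindex inj_on_def axis_eq_axis inner_axis)
  finally show "emeasure (distr lborel borel ?T) (box l u) = (\<Prod>b\<in>Basis. (u - l) \<bullet> b)" .
qed simp

text \<open>Induction over products of elementary matrices. The predicate \<open>P\<close>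
  quantifies over all \<open>g\<close>, because the product step applies the hypothesis for
  \<open>B\<close> to \<open>g\<close> composed with \<open>A\<close>. Its premise
  \<open>det A \<noteq> 0\<close> passes to both factors of a product and disposes of matrices with
  a zero row.\<close>

theorem nn_integral_lborel_matrix:
  fixes A :: "real^'n^'n" and g :: "real^'n \<Rightarrow> ennreal"
  assumes "det A \<noteq> 0" "g \<in> borel_measurable borel"
  shows "(\<integral>\<^sup>+x. g x \<partial>lborel) = \<bar>det A\<bar> * (\<integral>\<^sup>+x. g (A *v x) \<partial>lborel)"
proof -
  define P where "P A \<longleftrightarrow> (det A \<noteq> 0 \<longrightarrow> (\<forall>g. g \<in> borel_measurable borel \<longrightarrow>
     (\<integral>\<^sup>+x. g x \<partial>lborel) = \<bar>det A\<bar> * (\<integral>\<^sup>+x. g (A *v x) \<partial>lborel)))" for A :: "real^'n^'n"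
  have "P A"
  proof (rule induct_matrix_elementary_alt[where P = P])
    fix A B :: "real^'n^'n" assume A: "P A" and B: "P B"
    show "P (A ** B)"
      unfolding P_def
    proof (intro impI allI)
      fix g :: "real^'n \<Rightarrow> ennreal" assume d: "det (A ** B) \<noteq> 0" and [measurable]: "g \<in> borel_measurable borel"
      have "(\<integral>\<^sup>+x. g x \<partial>lborel) = \<bar>det A\<bar> * (\<integral>\<^sup>+x. g (A *v x) \<partial>lborel)"
        using d by (intro A[unfolded P_def, rule_format]) (auto simp: det_mul)
      also have "(\<integral>\<^sup>+x. g (A *v x) \<partial>lborel) = \<bar>det B\<bar> * (\<integral>\<^sup>+x. g (A *v (B *v x)) \<partial>lborel)"
        using d by (intro B[unfolded P_def, rule_format]) (auto simp: det_mul)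
      finally show "(\<integral>\<^sup>+x. g x \<partial>lborel) = \<bar>det (A ** B)\<bar> * (\<integral>\<^sup>+x. g ((A ** B) *v x) \<partial>lborel)"
        by (simp add: det_mul abs_mult ennreal_mult mult.assoc matrix_vector_mul_assoc)
    qed
  next
    fix A :: "real^'n^'n" and i assume "row i A = 0"
    then have "det A = 0" by (rule det_zero_row)
    then show "P A" by (simp add: P_def)
  next
    fix A :: "real^'n^'n" assume d: "\<And>i j. i \<noteq> j \<Longrightarrow> A $ i $ j = 0"
    have detA: "det A = (\<Prod>i\<in>UNIV. A $ i $ i)" using d by (rule det_diagonal)
    show "P A" unfolding P_def
    proof (intro impI allI)
      fix g :: "real^'n \<Rightarrow> ennreal" assume dA: "det A \<noteq> 0" and [measurable]: "g \<in> borel_measurable borel"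
      have nz: "A $ i $ i \<noteq> 0" for i using dA by (auto simp: detA)
      define c where "c b = (A *v b) \<bullet> b" for b
      have c_ax: "c (axis i 1) = A $ i $ i" for i
        by (simp add: c_def inner_axis matrix_vector_mult_basis column_def)
      have Ax: "A *v x = 0 + (\<Sum>b\<in>Basis. (c b * (x \<bullet> b)) *\<^sub>R b)" for x
      proof -
        have "(A *v x) $ i = A $ i $ i * x $ i" for i
          unfolding matrix_vector_mult_def
          by (simp, subst sum.remove[of _ i]) (auto simp: d)
        moreover have "(\<Sum>b\<in>Basis. (c b * (x \<bullet> b)) *\<^sub>R b) $ i = A $ i $ i * x $ i" for i
        proof -
          have "(\<Sum>b\<in>Basis. (c b * (x \<bullet> b)) *\<^sub>R b) $ i = (\<Sum>b\<in>Basis. (c b * (x \<bullet> b)) *\<^sub>R b) \<bullet> axis i 1"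
            by (simp add: inner_axis)
          also have "\<dots> = c (axis i 1) * (x \<bullet> axis i 1)"
            by (simp add: inner_sum_left inner_Basis axis_in_Basis_iff if_distrib sum.delta cong: if_cong)
          finally show ?thesis by (simp add: c_ax inner_axis)
        qed
        ultimately show ?thesis by (simp add: vec_eq_iff)
      qed
      have prd: "(\<Prod>j\<in>Basis. \<bar>c j\<bar>) = \<bar>det A\<bar>"
        by (simp add: detA Basis_vec_def UNION_singleton_eq_range prod.reindex inj_on_def axis_eq_axis c_ax abs_prod)
      have "c j \<noteq> 0" if "j \<in> Basis" for j using that nz by (auto simp: Basis_vec_def c_ax)
      then have "lborel = density (distr lborel borel (\<lambda>x. A *v x)) (\<lambda>_. \<bar>det A\<bar>)"
        using lborel_affine_euclidean[of c 0, OF _] unfolding Ax[symmetric] prd by simp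
      then have "(\<integral>\<^sup>+x. g x \<partial>lborel) = (\<integral>\<^sup>+x. g x \<partial>(density (distr lborel borel (\<lambda>x. A *v x)) (\<lambda>_. \<bar>det A\<bar>)))"
        by (rule arg_cong)
      also have "\<dots> = \<bar>det A\<bar> * (\<integral>\<^sup>+x. g (A *v x) \<partial>lborel)"
        by (simp add: nn_integral_density nn_integral_distr nn_integral_cmult)
      finally show "(\<integral>\<^sup>+x. g x \<partial>lborel) = \<bar>det A\<bar> * (\<integral>\<^sup>+x. g (A *v x) \<partial>lborel)" .
    qed
  next
    fix m n :: 'n assume mn: "m \<noteq> n"
    let ?A = "\<chi> i j. mat 1 $ i $ Transposition.transpose m n j :: real^'n^'n"
    have "det ?A = of_int (sign (Transposition.transpose m n)) * det (mat 1 :: real^'n^'n)"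
      by (rule det_permute_columns) (simp add: permutes_swap_id)
    then have dA: "\<bar>det ?A\<bar> = 1" using mn by (simp add: sign_swap_id)
    have "?A *v x = (\<chi> i. x $ Transposition.transpose m n i)" for x
    proof -
      have "(\<Sum>j\<in>UNIV. if i = Transposition.transpose m n j then x $ j else 0)
          = (\<Sum>j\<in>UNIV. if j = Transposition.transpose m n i then x $ j else 0)" for i
        by (intro sum.cong if_cong refl) (metis transpose_involutory)
      then show ?thesis
        by (simp add: vec_eq_iff matrix_vector_mult_def mat_def if_distrib[of "\<lambda>a. a * _"] cong: if_cong)
    qed
    moreover have [measurable]: "(\<lambda>x :: real^'n. \<chi> i. x $ Transposition.transpose m n i) \<in> borel_measurable borel"
      by (intro borel_measurable_continuous_onI continuous_intros)
    ultimately show "P ?A"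
      unfolding P_def using dA
      by (subst lborel_distr_permute[of "Transposition.transpose m n"]) (simp_all add: nn_integral_distr)
  next
    fix m n :: 'n assume mn: "m \<noteq> n"
    let ?A = "\<chi> i j. of_bool (i = m \<and> j = n \<or> i = j) :: real^'n^'n"
    have "?A *v x = x + axis m (x $ n)" for x
    proof -
      have "(?A *v x) $ i = (\<Sum>j\<in>UNIV. (if j = i then x $ j else 0) + (if j = n then if i = m then x $ j else 0 else 0))" for i
        unfolding matrix_vector_mult_def using mn by (auto intro!: sum.cong)
      then show ?thesis by (simp add: vec_eq_iff sum.distrib axis_def)
    qed
    then show "P ?A" using det_shear[OF mn] nn_integral_lborel_shear[OF mn] by (simp add: P_def)
  qed
  then show ?thesis using assms unfolding P_def by blast
qed

section \<open>The uniform distribution on the sphere and the angular Gaussian law\<close>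

lemma nn_integral_lborel_scaleR:
  fixes g :: "'a::euclidean_space \<Rightarrow> ennreal"
  assumes "c > 0" and [measurable]: "g \<in> borel_measurable borel"
  shows "(\<integral>\<^sup>+x. g x \<partial>lborel) = ennreal (c ^ DIM('a)) * (\<integral>\<^sup>+x. g (c *\<^sub>R x) \<partial>lborel)"
proof -
  have "(lborel :: 'a measure) = density (distr lborel borel (\<lambda>x. 0 + c *\<^sub>R x)) (\<lambda>_. \<bar>c\<bar> ^ DIM('a))"
    using assms by (intro lborel_affine) auto
  then have "(\<integral>\<^sup>+x. g x \<partial>lborel) =
      (\<integral>\<^sup>+x. g x \<partial>density (distr lborel borel (\<lambda>x. 0 + c *\<^sub>R x)) (\<lambda>_. \<bar>c\<bar> ^ DIM('a)))"
    by (rule arg_cong)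
  then show ?thesis
    using assms(1) by (simp add: nn_integral_density nn_integral_distr nn_integral_cmult)
qed

lemma AE_lborel_nonzero: "AE x in (lborel :: 'a::euclidean_space measure). x \<noteq> 0"
  by (rule AE_I[of _ _ "{0}"]) auto

text \<open>Turns a power of \<open>1 / r\<close> into an integral over an auxiliary radius
  \<open>s\<close>. The endpoint 0 is left out because the later substitution divides by
  \<open>s\<close>.\<close>

lemma nn_integral_power_Ioc:
  assumes "r > 0" "d > 0"
  shows "(\<integral>\<^sup>+s. ennreal (real d * s ^ (d - 1)) * indicator {0<..1/r} s \<partial>lborel) = ennreal ((1 / r) ^ d)"
proof -
  have "(\<integral>\<^sup>+s. ennreal (real d * s ^ (d - 1)) * indicator {0<..1/r} s \<partial>lborel)
      = (\<integral>\<^sup>+s. ennreal (real d * s ^ (d - 1)) * indicator {0..1/r} s \<partial>lborel)"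
    using AE_lborel_nonzero[where 'a = real] 
    by (intro nn_integral_cong_AE, elim eventually_mono) (auto simp: indicator_def)
  also have "\<dots> = ennreal ((1/r) ^ d - 0 ^ d)"
    using assms by (intro nn_integral_FTC_Icc) (auto intro!: derivative_eq_intros)
  finally show ?thesis using assms by simp
qed

text \<open>The mass left in the auxiliary radius after the substitution. It does not depend on
  \<open>r\<close>, so the first gauge disappears from the result.\<close>

lemma nn_integral_inverse_power_atLeast:
  assumes "r > 0" "d > 0"
  shows "(\<integral>\<^sup>+s. ennreal (real d * r ^ d / s ^ (d + 1)) * indicator {r..} s \<partial>lborel) = 1"
proof -
  have "(\<integral>\<^sup>+s. ennreal (real d * r ^ d / s ^ (d + 1)) * indicator {r..} s \<partial>lborel)
     = ennreal (0 - (- (r ^ d / r ^ d)))"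
  proof (rule nn_integral_FTC_atLeast[where F = "\<lambda>s. - (r ^ d / s ^ d)"])
    fix s assume "r \<le> s"
    then have s: "s > 0" using assms by simp
    show "DERIV (\<lambda>s. - (r ^ d / s ^ d)) s :> real d * r ^ d / s ^ (d + 1)"
    proof -
      obtain k where k: "d = Suc k" using assms by (cases d) auto
      have "DERIV (\<lambda>s. - (r ^ d / s ^ d)) s :> - ((0 * s ^ d - r ^ d * (real d * s ^ k)) / (s ^ d * s ^ d))"
      proof (intro DERIV_minus DERIV_divide DERIV_const)
        show "DERIV (\<lambda>s. s ^ d) s :> real d * s ^ k" using DERIV_pow[of d s UNIV] by (simp add: k)
      qed (use s in auto)
      also have "- ((0 * s ^ d - r ^ d * (real d * s ^ k)) / (s ^ d * s ^ d)) = real d * r ^ d / s ^ (d + 1)"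
        using s by (simp add: k)
      finally show ?thesis .
    qed
    show "0 \<le> real d * r ^ d / s ^ (d + 1)" using s assms by simp
  next
    have "((\<lambda>s. - (r ^ d * inverse (s ^ d))) \<longlongrightarrow> - (r ^ d * 0)) at_top"
      using assms by (intro tendsto_intros tendsto_inverse_0_at_top filterlim_pow_at_top filterlim_ident) auto
    then show "((\<lambda>s. - (r ^ d / s ^ d)) \<longlongrightarrow> 0) at_top" by (simp add: divide_inverse)
  qed auto
  then show ?thesis using assms by simp
qed

text \<open>The substitution \<open>x = y / s\<close> exchanges the roles of the two gauges once
  \<open>(1 / \<rho>2 x) ^ d\<close> has been written as an integral over \<open>s\<close>; this replaces polar coordinates.\<close>
lemma nn_integral_gauge_swap:
  fixes \<rho>1 \<rho>2 :: "'a::euclidean_space \<Rightarrow> real" and g :: "'a \<Rightarrow> ennreal"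
  assumes [measurable]: "\<rho>1 \<in> borel_measurable borel" "\<rho>2 \<in> borel_measurable borel" "g \<in> borel_measurable borel"
    and hom: "\<And>c x. c > 0 \<Longrightarrow> \<rho>1 (c *\<^sub>R x) = c * \<rho>1 x" "\<And>c x. c > 0 \<Longrightarrow> \<rho>2 (c *\<^sub>R x) = c * \<rho>2 x"
      "\<And>c x. c > 0 \<Longrightarrow> g (c *\<^sub>R x) = g x"
    and pos: "\<And>x. x \<noteq> 0 \<Longrightarrow> \<rho>1 x > 0" "\<And>x. x \<noteq> 0 \<Longrightarrow> \<rho>2 x > 0"
  shows "(\<integral>\<^sup>+x. g x * ennreal ((\<rho>1 x / \<rho>2 x) ^ DIM('a)) * indicator {x. \<rho>1 x \<le> 1} x \<partial>lborel)
       = (\<integral>\<^sup>+x. g x * indicator {x. \<rho>2 x \<le> 1} x \<partial>lborel)"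
proof -
  let ?d = "DIM('a)"
  have d: "?d > 0" by simp
  \<comment> \<open>For fixed \<open>x\<close> the integral over \<open>s\<close> is the left
    integrand with its factor \<open>(\<rho>1 x / \<rho>2 x) ^ d\<close>; for fixed \<open>s\<close>
    the variable \<open>x\<close> is free to be rescaled.\<close>
  define H where "H x s = g x * ennreal (real ?d * s ^ (?d - 1) * \<rho>1 x ^ ?d) * indicator {x. \<rho>1 x \<le> 1} x
     * indicator {s. 0 < s \<and> s * \<rho>2 x \<le> 1} s" for x :: 'a and s :: real
  have H_meas [measurable]: "case_prod H \<in> borel_measurable (lborel \<Otimes>\<^sub>M lborel)"
  proof -
    have "case_prod H = (\<lambda>z. g (fst z) * ennreal (real ?d * snd z ^ (?d - 1) * \<rho>1 (fst z) ^ ?d)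
       * (if \<rho>1 (fst z) \<le> 1 then 1 else 0) * (if 0 < snd z \<and> snd z * \<rho>2 (fst z) \<le> 1 then 1 else 0))"
      by (auto simp: H_def fun_eq_iff indicator_def)
    then show ?thesis by simp
  qed
  have "(\<integral>\<^sup>+x. g x * ennreal ((\<rho>1 x / \<rho>2 x) ^ ?d) * indicator {x. \<rho>1 x \<le> 1} x \<partial>lborel)
      = (\<integral>\<^sup>+x. (\<integral>\<^sup>+s. H x s \<partial>lborel) \<partial>lborel)"
  proof (rule nn_integral_cong_AE, use AE_lborel_nonzero in eventually_elim)
    fix x :: 'a assume x: "x \<noteq> 0"
    have *: "{s. 0 < s \<and> s * \<rho>2 x \<le> 1} = {0<..1 / \<rho>2 x}" using pos(2)[OF x] by (auto simp: field_simps)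
    have "(\<integral>\<^sup>+s. H x s \<partial>lborel) = (\<integral>\<^sup>+s. (g x * ennreal (\<rho>1 x ^ ?d) * indicator {x. \<rho>1 x \<le> 1} x)
        * (ennreal (real ?d * s ^ (?d - 1)) * indicator {0<..1 / \<rho>2 x} s) \<partial>lborel)"
      unfolding H_def * using pos(1)[OF x]
      by (intro nn_integral_cong) (auto simp: indicator_def ennreal_mult' mult_ac split: if_splits)
    also have "\<dots> = (g x * ennreal (\<rho>1 x ^ ?d) * indicator {x. \<rho>1 x \<le> 1} x) * ennreal ((1 / \<rho>2 x) ^ ?d)"
      by (subst nn_integral_cmult) (simp_all only: nn_integral_power_Ioc[OF pos(2)[OF x] d], measurable)
    also have "\<dots> = g x * ennreal ((\<rho>1 x / \<rho>2 x) ^ ?d) * indicator {x. \<rho>1 x \<le> 1} x"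
      using pos(1)[OF x] pos(2)[OF x] by (simp add: power_divide divide_inverse power_mult_distrib ennreal_mult' mult_ac)
    finally show "g x * ennreal ((\<rho>1 x / \<rho>2 x) ^ ?d) * indicator {x. \<rho>1 x \<le> 1} x = (\<integral>\<^sup>+s. H x s \<partial>lborel)" ..
  qed
  also have "\<dots> = (\<integral>\<^sup>+s. (\<integral>\<^sup>+x. H x s \<partial>lborel) \<partial>lborel)"
    by (rule lborel_pair.Fubini'[symmetric]) measurable
  \<comment> \<open>By homogeneity \<open>x = y / s\<close> turns \<open>\<rho>1 x \<le> 1\<close>
    into \<open>\<rho>1 y \<le> s\<close> and \<open>s * \<rho>2 x \<le> 1\<close> into
    \<open>\<rho>2 y \<le> 1\<close>, which no longer involves \<open>s\<close>. The Jacobian and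
    the power of \<open>\<rho>1\<close> contribute \<open>1 / s ^ d\<close> each, whence
    \<open>1 / s ^ (d + 1)\<close>.\<close>
  also have "\<dots> = (\<integral>\<^sup>+s. (\<integral>\<^sup>+y. (g y * indicator {x. \<rho>2 x \<le> 1} y)
      * (ennreal (real ?d * \<rho>1 y ^ ?d / s ^ (?d + 1)) * indicator {s. 0 < s \<and> \<rho>1 y \<le> s} s) \<partial>lborel) \<partial>lborel)"
  proof (rule nn_integral_cong)
    fix s :: real
    show "(\<integral>\<^sup>+x. H x s \<partial>lborel) = (\<integral>\<^sup>+y. (g y * indicator {x. \<rho>2 x \<le> 1} y)
      * (ennreal (real ?d * \<rho>1 y ^ ?d / s ^ (?d + 1)) * indicator {s. 0 < s \<and> \<rho>1 y \<le> s} s) \<partial>lborel)"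
    proof (cases "s > 0")
      case True
      have Hs [measurable]: "(\<lambda>x. H x s) \<in> borel_measurable borel" unfolding H_def by measurable
      have "(\<integral>\<^sup>+x. H x s \<partial>lborel) = ennreal ((1 / s) ^ ?d) * (\<integral>\<^sup>+y. H ((1 / s) *\<^sub>R y) s \<partial>lborel)"
        using True by (intro nn_integral_lborel_scaleR) auto
      also have "\<dots> = (\<integral>\<^sup>+y. ennreal ((1 / s) ^ ?d) * H ((1 / s) *\<^sub>R y) s \<partial>lborel)"
      proof (rule nn_integral_cmult[symmetric])
        show "(\<lambda>y. H ((1 / s) *\<^sub>R y) s) \<in> borel_measurable lborel"
          by (rule measurable_compose[OF _ Hs]) simp
      qed
      also have "\<dots> = (\<integral>\<^sup>+y. (g y * indicator {x. \<rho>2 x \<le> 1} y)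
         * (ennreal (real ?d * \<rho>1 y ^ ?d / s ^ (?d + 1)) * indicator {s. 0 < s \<and> \<rho>1 y \<le> s} s) \<partial>lborel)"
      proof (rule nn_integral_cong_AE, use AE_lborel_nonzero in eventually_elim)
        fix y :: 'a assume y: "y \<noteq> 0"
        have "(1 / s) ^ ?d * (real ?d * s ^ (?d - 1) * (\<rho>1 y / s) ^ ?d) = real ?d * \<rho>1 y ^ ?d / s ^ (?d + 1)"
          using True d by (cases ?d) (auto simp: power_divide field_simps)
        then have "ennreal ((1 / s) ^ ?d) * ennreal (real ?d * s ^ (?d - 1) * (\<rho>1 y / s) ^ ?d) = ennreal (real ?d * \<rho>1 y ^ ?d / s ^ (?d + 1))"
          using True by (subst ennreal_mult'[symmetric]) auto
        then show "ennreal ((1 / s) ^ ?d) * H ((1 / s) *\<^sub>R y) s = (g y * indicator {x. \<rho>2 x \<le> 1} y)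
         * (ennreal (real ?d * \<rho>1 y ^ ?d / s ^ (?d + 1)) * indicator {s. 0 < s \<and> \<rho>1 y \<le> s} s)"
          using True unfolding H_def hom(1)[of "1 / s" y, simplified True] 
          by (auto simp: hom indicator_def field_simps)
      qed
      finally show ?thesis .
    qed (simp add: H_def)
  qed
  also have "\<dots> = (\<integral>\<^sup>+y. (\<integral>\<^sup>+s. (g y * indicator {x. \<rho>2 x \<le> 1} y)
      * (ennreal (real ?d * \<rho>1 y ^ ?d / s ^ (?d + 1)) * indicator {s. 0 < s \<and> \<rho>1 y \<le> s} s) \<partial>lborel) \<partial>lborel)"
  proof (rule lborel_pair.Fubini'[of "\<lambda>y s. _ y s"])
    have "(\<lambda>(y, s). (g y * indicator {x. \<rho>2 x \<le> 1} y)
      * (ennreal (real ?d * \<rho>1 y ^ ?d / s ^ (?d + 1)) * indicator {s. 0 < s \<and> \<rho>1 y \<le> s} s))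
      = (\<lambda>z. (g (fst z) * (if \<rho>2 (fst z) \<le> 1 then 1 else 0))
      * (ennreal (real ?d * \<rho>1 (fst z) ^ ?d / snd z ^ (?d + 1)) * (if 0 < snd z \<and> \<rho>1 (fst z) \<le> snd z then 1 else 0)))"
      by (auto simp: fun_eq_iff indicator_def)
    then show "(\<lambda>(y, s). (g y * indicator {x. \<rho>2 x \<le> 1} y)
      * (ennreal (real ?d * \<rho>1 y ^ ?d / s ^ (?d + 1)) * indicator {s. 0 < s \<and> \<rho>1 y \<le> s} s)) \<in> borel_measurable (lborel \<Otimes>\<^sub>M lborel)"
      by simp
  qed
  also have "\<dots> = (\<integral>\<^sup>+y. g y * indicator {x. \<rho>2 x \<le> 1} y \<partial>lborel)"
  proof (rule nn_integral_cong_AE, use AE_lborel_nonzero in eventually_elim)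
    fix y :: 'a assume y: "y \<noteq> 0"
    have *: "{s. 0 < s \<and> \<rho>1 y \<le> s} = {\<rho>1 y..}" using pos(1)[OF y] by auto
    show "(\<integral>\<^sup>+s. (g y * indicator {x. \<rho>2 x \<le> 1} y)
      * (ennreal (real ?d * \<rho>1 y ^ ?d / s ^ (?d + 1)) * indicator {s. 0 < s \<and> \<rho>1 y \<le> s} s) \<partial>lborel) = g y * indicator {x. \<rho>2 x \<le> 1} y"
      unfolding * by (subst nn_integral_cmult)
        (simp_all only: nn_integral_inverse_power_atLeast[OF pos(1)[OF y] d] mult_1_right, measurable)
  qed
  finally show ?thesis .
qed

section \<open>The uniform law and the angular Gaussian laws as its images\<close>

lemma sets_borel_ball [measurable]: "ball (a :: 'a::metric_space) r \<in> sets borel"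
  by (simp add: borel_open)

text \<open>The normalised cone measure: the direction of a uniform point of the ball, parallel to
  the construction of \<open>surface_sphere\<close>. Since \<open>sgn 0 = 0\<close>, unit length of
  the direction is an almost-everywhere statement.\<close>

definition usphere :: "(real^'n) measure" where
  "usphere = distr (uniform_measure lborel (ball 0 1)) borel sgn"

lemma emeasure_unit_ball:
  "emeasure lborel (ball (0 :: real^'n) 1) = ennreal (unit_ball_vol (real CARD('n)))"
  by (simp add: emeasure_ball)

lemma prob_space_usphere: "prob_space (usphere :: (real^'n) measure)"
proof -
  have "prob_space (uniform_measure lborel (ball (0 :: real^'n) 1))"
    by (rule prob_space_uniform_measure) (simp_all add: emeasure_unit_ball less_imp_neq[OF unit_ball_vol_pos, symmetric])
  then show ?thesis unfolding usphere_def by (rule prob_space.prob_space_distr) simp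
qed

lemma sets_usphere [simp, measurable_cong]: "sets usphere = sets borel"
  and space_usphere [simp]: "space usphere = UNIV"
  by (simp_all add: usphere_def)

lemma nn_integral_usphere:
  fixes g :: "real^'n \<Rightarrow> ennreal"
  assumes [measurable]: "g \<in> borel_measurable borel"
  shows "(\<integral>\<^sup>+w. g w \<partial>usphere)
    = (\<integral>\<^sup>+x. g (sgn x) * indicator (ball 0 1) x \<partial>lborel) / unit_ball_vol (real CARD('n))"
  unfolding usphere_def
  by (simp add: nn_integral_distr nn_integral_uniform_measure emeasure_unit_ball)

lemma emeasure_distr_usphere:
  fixes f :: "real^'n \<Rightarrow> 'a::topological_space"
  assumes [measurable]: "f \<in> borel_measurable borel" "X \<in> sets borel"
  shows "emeasure (distr usphere borel f) X = (\<integral>\<^sup>+w. indicator X (f w) \<partial>usphere)"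
proof -
  have "emeasure (distr usphere borel f) X = (\<integral>\<^sup>+y. indicator X y \<partial>distr usphere borel f)" by simp
  then show ?thesis by (subst (asm) nn_integral_distr) auto
qed

lemma AE_usphere_norm: "AE w in (usphere :: (real^'n) measure). norm w = 1"
proof -
  have "AE x in uniform_measure lborel (ball (0 :: real^'n) 1). norm (sgn x) = 1"
    using AE_lborel_nonzero[where 'a = "real^'n"]
    by (intro AE_uniform_measureI) (auto elim!: eventually_mono simp: norm_sgn)
  then show ?thesis unfolding usphere_def by (subst AE_distr_iff) auto
qed

text \<open>The measures are built on the open ball, whereas the exchange of gauges works with
  closed gauge balls; the sphere in between is a null set.\<close>

lemma nn_integral_ball_cball:
  fixes g :: "'a::euclidean_space \<Rightarrow> ennreal"
  shows "(\<integral>\<^sup>+x. g x * indicator (ball 0 1) x \<partial>lborel) = (\<integral>\<^sup>+x. g x * indicator {x. norm x \<le> 1} x \<partial>lborel)"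
proof (rule nn_integral_cong_AE)
  have "negligible (sphere (0 :: 'a) 1)" by (rule negligible_sphere)
  then have "sphere (0 :: 'a) 1 \<in> null_sets lborel"
    by (auto simp: null_sets_completion_iff negligible_iff_null_sets)
  then have "AE x in lborel. x \<notin> sphere (0 :: 'a) 1" by (rule AE_not_in)
  then show "AE x in lborel. g x * indicator (ball 0 1) x = g x * indicator {x. norm x \<le> 1} x"
    by eventually_elim (auto simp: indicator_def)
qed

lemma sgn_scaleR_pos: "c > 0 \<Longrightarrow> sgn (c *\<^sub>R x) = sgn (x :: 'a::real_normed_vector)"
  by (simp add: sgn_scaleR)

lemma sgn_matrix_sgn: "sgn (A *v sgn x) = sgn (A *v (x :: real^'n))"
proof (cases "x = 0")
  case False
  have "A *v sgn x = inverse (norm x) *\<^sub>R (A *v x)" by (simp add: sgn_div_norm matrix_vector_mult_scaleR)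
  then show ?thesis using False by (simp add: sgn_scaleR)
qed simp

text \<open>An orthogonal map keeps the ball, commutes with \<open>sgn\<close> and has a determinant
  of modulus one.\<close>

lemma usphere_orthogonal_invariant:
  fixes Q :: "real^'n^'n"
  assumes "orthogonal_matrix Q"
  shows "distr usphere borel ((*v) Q) = usphere"
proof (rule measure_eqI)
  fix X assume "X \<in> sets (distr usphere borel ((*v) Q))"
  then have X [measurable]: "X \<in> sets borel" by simp
  have d: "\<bar>det Q\<bar> = 1" using det_orthogonal_matrix[OF assms] by auto
  have no: "norm (Q *v x) = norm x" for x
    using assms by (metis orthogonal_transformation_matrix orthogonal_transformation_norm matrix_of_matrix_vector_mul matrix_vector_mul_linear)
  have sg: "Q *v sgn x = sgn (Q *v x)" for x
    by (simp add: sgn_div_norm matrix_vector_mult_scaleR no)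
  have "emeasure (distr usphere borel ((*v) Q)) X = (\<integral>\<^sup>+w. indicator X (Q *v w) \<partial>usphere)"
    by (rule emeasure_distr_usphere) simp_all
  also have "\<dots> = (\<integral>\<^sup>+x. indicator X (sgn (Q *v x)) * indicator (ball 0 1) (Q *v x) \<partial>lborel) / unit_ball_vol (real CARD('n))"
    by (subst nn_integral_usphere) (auto simp: sg no indicator_def intro!: arg_cong2[where f = "(/)"] nn_integral_cong)
  also have "(\<integral>\<^sup>+x. indicator X (sgn (Q *v x)) * indicator (ball 0 1) (Q *v x) \<partial>lborel)
     = (\<integral>\<^sup>+x. indicator X (sgn x) * indicator (ball 0 1) x \<partial>lborel)"
  proof -
    have "det Q \<noteq> 0" using d by auto
    then show ?thesis
      by (subst (2) nn_integral_lborel_matrix[of Q]) (simp_all add: d)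
  qed
  also have "\<dots> / unit_ball_vol (real CARD('n)) = emeasure usphere X"
    by (subst nn_integral_usphere[symmetric]) auto
  finally show "emeasure (distr usphere borel ((*v) Q)) X = emeasure usphere X" .
qed simp

text \<open>Along the ray of \<open>x\<close> the density is a constant times
  \<open>(norm x / norm (R *v x)) ^ p\<close>, a ratio of two gauges. The exchange of gauges
  replaces the weighted ball by the ellipsoid \<open>norm (R *v x) \<le> 1\<close>, which is the
  image of the ball under \<open>A\<close>, and a linear substitution finishes.\<close>

theorem angular_gaussian_eq_distr_usphere:
  fixes A R V :: "real^'n^'n"
  assumes AR: "A ** R = mat 1" "R ** A = mat 1"
    and quad: "\<And>x. x \<bullet> (matrix_inv V *v x) = (norm (R *v x))\<^sup>2"
    and det: "det V = (det A)\<^sup>2"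
  shows "angular_gaussian V = distr usphere borel (\<lambda>w. sgn (A *v w))"
proof (rule measure_eqI)
  let ?p = "CARD('n)"
  have dA: "det A \<noteq> 0" using AR(1) by (metis det_I det_mul mult_zero_left zero_neq_one)
  have RA: "R *v (A *v x) = x" "A *v (R *v x) = x" for x by (simp_all add: matrix_vector_mul_assoc AR)
  have R0: "R *v x \<noteq> 0" if "x \<noteq> 0" for x using RA(2)[of x] that by auto
  fix X assume "X \<in> sets (angular_gaussian V)"
  then have X [measurable]: "X \<in> sets borel" by (simp add: angular_gaussian_def surface_sphere_def)
  define \<kappa> where "\<kappa> = Gamma (real ?p / 2) / (2 * pi powr (real ?p / 2) * sqrt (det V))"
  have \<kappa>0: "\<kappa> \<ge> 0" unfolding \<kappa>_def det by (intro divide_nonneg_nonneg Gamma_real_nonneg) auto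
  have ag [measurable]: "ag_density V \<in> borel_measurable borel" unfolding ag_density_def by measurable
  have sgn_eq: "(\<lambda>x :: real^'n. x /\<^sub>R norm x) = sgn" by (simp add: fun_eq_iff sgn_div_norm)
  have "emeasure (angular_gaussian V) X
     = (\<integral>\<^sup>+u. ennreal (ag_density V u) * indicator (sphere 0 1) u * indicator X u \<partial>surface_sphere)"
  proof -
    have [measurable]: "sphere (0 :: real^'n) 1 \<in> sets borel" by (simp add: borel_closed)
    have "(\<lambda>u. ennreal (ag_density V u) * indicator (sphere 0 1) u) \<in> borel_measurable surface_sphere"
      by (subst measurable_cong_sets[of surface_sphere borel]) (auto simp: surface_sphere_def)
    then show ?thesis
      unfolding angular_gaussian_def by (subst emeasure_density) (auto simp: surface_sphere_def)
  qed
  also have "\<dots> = of_nat ?p * (\<integral>\<^sup>+x. ennreal (ag_density V (sgn x)) * indicator (sphere 0 1) (sgn x) * indicator X (sgn x)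
       * indicator (ball 0 1) x \<partial>lborel)"
  proof -
    have [measurable]: "sphere (0 :: real^'n) 1 \<in> sets borel" by (simp add: borel_closed)
    have F: "(\<lambda>u. ennreal (ag_density V u) * indicator (sphere 0 1) u * indicator X u) \<in> borel_measurable borel"
      by measurable
    have s: "sgn \<in> restrict_space lborel (ball (0 :: real^'n) 1) \<rightarrow>\<^sub>M borel"
      by (rule measurable_restrict_space1) simp
    show ?thesis
      unfolding surface_sphere_def sgn_eq using F s
      by (simp add: nn_integral_scale_measure nn_integral_distr nn_integral_restrict_space)
  qed
  also have "(\<integral>\<^sup>+x. ennreal (ag_density V (sgn x)) * indicator (sphere 0 1) (sgn x) * indicator X (sgn x)
       * indicator (ball 0 1) x \<partial>lborel)
     = (\<integral>\<^sup>+x. ennreal \<kappa> * ((indicator X (sgn x) * ennreal ((norm x / norm (R *v x)) ^ DIM(real^'n))) * indicator (ball 0 1) x) \<partial>lborel)"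
  proof (rule nn_integral_cong_AE, use AE_lborel_nonzero in eventually_elim)
    fix x :: "real^'n" assume x: "x \<noteq> 0"
    have "norm (R *v sgn x) = norm (R *v x) / norm x"
      by (simp add: sgn_div_norm matrix_vector_mult_scaleR divide_inverse)
    then have "(sgn x \<bullet> (matrix_inv V *v sgn x)) powr (- (real ?p / 2)) = ((norm (R *v x) / norm x) powr 2) powr (- (real ?p / 2))"
      using x R0[OF x] by (simp add: quad powr_numeral)
    also have "\<dots> = (norm (R *v x) / norm x) powr (- real ?p)" by (simp only: powr_powr) simp
    also have "\<dots> = (norm x / norm (R *v x)) ^ ?p"
      using x R0[OF x] by (simp add: powr_minus powr_realpow power_divide)
    finally have "ag_density V (sgn x) = \<kappa> * (norm x / norm (R *v x)) ^ ?p"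
      by (simp add: ag_density_def \<kappa>_def)
    then show "ennreal (ag_density V (sgn x)) * indicator (sphere 0 1) (sgn x) * indicator X (sgn x) * indicator (ball 0 1) x
      = ennreal \<kappa> * ((indicator X (sgn x) * ennreal ((norm x / norm (R *v x)) ^ DIM(real^'n))) * indicator (ball 0 1) x)"
      using x \<kappa>0 by (simp add: ennreal_mult norm_sgn mult_ac)
  qed
  also have "\<dots> = ennreal \<kappa> * (\<integral>\<^sup>+x. indicator X (sgn x) * ennreal ((norm x / norm (R *v x)) ^ DIM(real^'n)) * indicator (ball 0 1) x \<partial>lborel)"
    by (rule nn_integral_cmult) measurable
  also have "(\<integral>\<^sup>+x. indicator X (sgn x) * ennreal ((norm x / norm (R *v x)) ^ DIM(real^'n)) * indicator (ball 0 1) x \<partial>lborel)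
     = (\<integral>\<^sup>+x. indicator X (sgn x) * indicator {x. norm (R *v x) \<le> 1} x \<partial>lborel)"
    unfolding nn_integral_ball_cball
    by (rule nn_integral_gauge_swap) (auto simp: matrix_vector_mult_scaleR sgn_scaleR_pos R0)
  also have "\<dots> = \<bar>det A\<bar> * (\<integral>\<^sup>+x. indicator X (sgn (A *v x)) * indicator (ball 0 1) x \<partial>lborel)"
    unfolding nn_integral_ball_cball
    by (subst nn_integral_lborel_matrix[OF dA]) (auto simp: RA indicator_def intro!: arg_cong2[where f = "(*)"] nn_integral_cong)
  also have "(\<integral>\<^sup>+x. indicator X (sgn (A *v x)) * indicator (ball 0 1) x \<partial>lborel)
     = ennreal (unit_ball_vol (real ?p)) * (\<integral>\<^sup>+w. indicator X (sgn (A *v w)) \<partial>usphere)"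
  proof -
    have "ennreal (unit_ball_vol (real ?p)) / ennreal (unit_ball_vol (real ?p)) = 1"
      by (intro ennreal_divide_self) (simp_all add: ennreal_eq_0_iff not_le)
    then show ?thesis
      by (subst nn_integral_usphere)
         (auto simp: sgn_matrix_sgn mult.commute[of "ennreal (unit_ball_vol _)"] ennreal_divide_times)
  qed
  also have "of_nat ?p * (ennreal \<kappa> * (ennreal \<bar>det A\<bar> * (ennreal (unit_ball_vol (real ?p)) * (\<integral>\<^sup>+w. indicator X (sgn (A *v w)) \<partial>usphere))))
     = ennreal (real ?p * \<kappa> * \<bar>det A\<bar> * unit_ball_vol (real ?p)) * (\<integral>\<^sup>+w. indicator X (sgn (A *v w)) \<partial>usphere)"
    using \<kappa>0 by (simp add: ennreal_mult mult.assoc ennreal_of_nat_eq_real_of_nat)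
  \<comment> \<open>\<open>Gamma (p / 2 + 1) = p / 2 * Gamma (p / 2)\<close> matches the constant of
    the density with the volume of the unit ball, and \<open>sqrt (det V)\<close> cancels the
    Jacobian.\<close>
  also have "real ?p * \<kappa> * \<bar>det A\<bar> * unit_ball_vol (real ?p) = 1"
  proof -
    have "Gamma (real ?p / 2 + 1) = real ?p / 2 * Gamma (real ?p / 2)"
      by (rule Gamma_plus1) (use nonpos_Ints_nonpos[of "real ?p / 2"] in auto)
    moreover have "Gamma (real ?p / 2) > 0" by (intro Gamma_real_pos) simp
    moreover have "sqrt (det V) = \<bar>det A\<bar>" by (simp add: det)
    moreover have "Gamma (real ?p / 2 + 1) \<noteq> 0" using Gamma_real_pos[of "real ?p / 2 + 1"] by linarith
    ultimately show ?thesis using dA by (simp add: \<kappa>_def unit_ball_vol_def)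
  qed
  also have "ennreal 1 * (\<integral>\<^sup>+w. indicator X (sgn (A *v w)) \<partial>usphere) = emeasure (distr usphere borel (\<lambda>w. sgn (A *v w))) X"
    by (subst emeasure_distr_usphere) simp_all
  finally show "emeasure (angular_gaussian V) X = emeasure (distr usphere borel (\<lambda>w. sgn (A *v w))) X" .
qed (simp add: angular_gaussian_def surface_sphere_def)

text \<open>The inner normalisation is a positive factor, invisible to the outer \<open>sgn\<close>,
  so \<open>R\<close> undoes \<open>A\<close> on directions.\<close>

lemma distr_angular_gaussian_standardize:
  fixes A R V :: "real^'n^'n"
  assumes AR: "A ** R = mat 1" "R ** A = mat 1"
    and ag: "angular_gaussian V = distr usphere borel (\<lambda>w. sgn (A *v w))"
  shows "distr (angular_gaussian V) borel (\<lambda>u. sgn (R *v u)) = usphere"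
proof -
  have "distr (angular_gaussian V) borel (\<lambda>u. sgn (R *v u)) = distr usphere borel (\<lambda>w. sgn (R *v sgn (A *v w)))"
    unfolding ag by (subst distr_distr) (auto simp: comp_def)
  also have "\<dots> = distr usphere borel (\<lambda>w. w)"
  proof (rule distr_cong_AE)
    show "AE w in usphere. sgn (R *v sgn (A *v w)) = w"
      using AE_usphere_norm
    proof eventually_elim
      fix w :: "real^'n" assume "norm w = 1"
      then show "sgn (R *v sgn (A *v w)) = w"
        by (simp only: sgn_matrix_sgn matrix_vector_mul_assoc AR) (simp add: sgn_div_norm)
    qed
  qed auto
  finally show ?thesis by (simp add: distr_id2)
qed

section \<open>Rows of independent bounded samples\<close>

lemma indep_vars_PiM_components:
  assumes "\<And>i. i \<in> I \<Longrightarrow> prob_space (M i)" and I: "I \<noteq> {}"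
  shows "prob_space.indep_vars (PiM I M) M (\<lambda>i \<omega>. \<omega> i) I"
proof -
  interpret prob_space "PiM I M" by (rule prob_space_PiM) (use assms in auto)
  have "distr (PiM I M) (PiM I M) (\<lambda>x. \<lambda>i\<in>I. x i) = distr (PiM I M) (PiM I M) (\<lambda>x. x)"
    by (intro distr_cong) (auto simp: space_PiM)
  also have "\<dots> = (\<Pi>\<^sub>M i\<in>I. distr (PiM I M) (M i) (\<lambda>\<omega>. \<omega> i))"
    using assms by (simp, intro PiM_cong refl) (simp add: distr_PiM_component)
  finally show ?thesis using I by (subst indep_vars_iff_distr_eq_PiM') simp_all
qed

text \<open>Hoeffding's inequality with intervals of length \<open>2 * k\<close>. It is used twice:
  for negligible remainders and for tightness.\<close>

lemma PiM_sum_Hoeffding: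
  fixes f :: "'a \<Rightarrow> real"
  assumes M: "prob_space M" and f [measurable]: "f \<in> borel_measurable M"
    and bd: "AE x in M. \<bar>f x\<bar> \<le> k" and mean: "(\<integral>x. f x \<partial>M) = 0" and "k > 0" "n > 0" "\<epsilon> \<ge> 0"
  shows "measure (PiM {..<n} (\<lambda>_. M)) {\<omega> \<in> space (PiM {..<n} (\<lambda>_. M)). \<bar>\<Sum>i<n. f (\<omega> i)\<bar> \<ge> \<epsilon>}
    \<le> 2 * exp (- (\<epsilon>\<^sup>2 / (2 * real n * k\<^sup>2)))"
proof -
  interpret prob_space "PiM {..<n} (\<lambda>_. M)" by (rule prob_space_PiM) (use M in auto)
  have indep: "indep_vars (\<lambda>_. borel) (\<lambda>i \<omega>. f (\<omega> i)) {..<n}"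
    by (rule indep_vars_compose2[OF indep_vars_PiM_components]) (use M \<open>n > 0\<close> in auto)
  have E: "expectation (\<lambda>\<omega>. f (\<omega> i)) = 0" if "i < n" for i
  proof -
    have "expectation (\<lambda>\<omega>. f (\<omega> i)) = (\<integral>x. f x \<partial>distr (PiM {..<n} (\<lambda>_. M)) M (\<lambda>\<omega>. \<omega> i))"
      using that by (subst integral_distr) auto
    also have "\<dots> = 0" using that M mean by (subst distr_PiM_component) auto
    finally show ?thesis .
  qed
  interpret Hoeffding_ineq "PiM {..<n} (\<lambda>_. M)" "{..<n}" "\<lambda>i \<omega>. f (\<omega> i)" "\<lambda>_. -k" "\<lambda>_. k" 0
  proof unfold_locales
    fix i assume "i \<in> {..<n}"
    then have "AE \<omega> in PiM {..<n} (\<lambda>_. M). \<bar>f (\<omega> i)\<bar> \<le> k"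
      using M by (intro AE_PiM_component bd) auto
    then show "AE \<omega> in PiM {..<n} (\<lambda>_. M). f (\<omega> i) \<in> {-k..k}"
      by eventually_elim auto
  qed (simp_all add: indep E)
  have "prob {\<omega> \<in> space (PiM {..<n} (\<lambda>_. M)). \<bar>(\<Sum>i<n. f (\<omega> i)) - 0\<bar> \<ge> \<epsilon>}
     \<le> 2 * exp (-2 * \<epsilon>\<^sup>2 / (\<Sum>i<n. (k - - k)\<^sup>2))"
    using assms by (intro Hoeffding_ineq_abs_ge) simp_all
  also have "-2 * \<epsilon>\<^sup>2 / (\<Sum>i<n. (k - - k)\<^sup>2) = - (\<epsilon>\<^sup>2 / (2 * real n * k\<^sup>2))"
    using assms by (simp add: power2_eq_square field_simps)
  finally show ?thesis by simp
qed

text \<open>The exponent in Hoeffding's inequality is \<open>\<epsilon>^2 / (2 n k^2)\<close>, and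
  it diverges because \<open>sqrt n * k\<close> tends to zero. The row laws may be arbitrary, which
  accommodates a triangular array.\<close>

lemma PiM_sum_tendsto_zero:
  fixes f :: "nat \<Rightarrow> 'a \<Rightarrow> real" and M :: "nat \<Rightarrow> 'a measure"
  assumes M: "\<And>n. n > 0 \<Longrightarrow> prob_space (M n)" and f: "\<And>n. n > 0 \<Longrightarrow> f n \<in> borel_measurable (M n)"
    and bd: "\<And>n. n > 0 \<Longrightarrow> AE x in M n. \<bar>f n x\<bar> \<le> k n" and mean: "\<And>n. n > 0 \<Longrightarrow> (\<integral>x. f n x \<partial>M n) = 0"
    and k: "(\<lambda>n. sqrt (real n) * k n) \<longlonglongrightarrow> 0" and "\<epsilon> > 0"
  shows "(\<lambda>n. measure (PiM {..<n} (\<lambda>_. M n)) {\<omega> \<in> space (PiM {..<n} (\<lambda>_. M n)). \<bar>\<Sum>i<n. f n (\<omega> i)\<bar> \<ge> \<epsilon>}) \<longlonglongrightarrow> 0"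
proof (rule Lim_null_comparison)
  \<comment> \<open>The summand \<open>1 / n\<close> makes the bound strictly positive, as
    Hoeffding's inequality wants, and is itself \<open>o(1 / sqrt n)\<close>.\<close>
  define k' where "k' n = \<bar>k n\<bar> + 1 / real n" for n
  have k'_pos: "k' n > 0" if "n > 0" for n using that by (simp add: k'_def add_nonneg_pos)
  have "(\<lambda>n. \<bar>sqrt (real n) * k n\<bar> + sqrt (real n) / real n) \<longlonglongrightarrow> 0 + 0"
  proof (rule tendsto_add)
    show "(\<lambda>n. \<bar>sqrt (real n) * k n\<bar>) \<longlonglongrightarrow> 0" using k by (rule tendsto_rabs_zero)
    show "(\<lambda>n. sqrt (real n) / real n) \<longlonglongrightarrow> 0" by real_asymp
  qed
  then have k'0: "(\<lambda>n. sqrt (real n) * k' n) \<longlonglongrightarrow> 0"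
    by (simp add: k'_def abs_mult distrib_left)
  have "filterlim (\<lambda>n. 2 * (sqrt (real n) * k' n)\<^sup>2) (at_right 0) sequentially"
  proof (rule tendsto_imp_filterlim_at_right)
    show "(\<lambda>n. 2 * (sqrt (real n) * k' n)\<^sup>2) \<longlonglongrightarrow> 0"
      using tendsto_mult[OF tendsto_const[of 2] tendsto_power[OF k'0, of 2]] by simp
    show "\<forall>\<^sub>F n in sequentially. 0 < 2 * (sqrt (real n) * k' n)\<^sup>2"
      using eventually_gt_at_top[of 0] by eventually_elim (use k'_pos in \<open>simp add: less_imp_neq[symmetric]\<close>)
  qed
  then have "filterlim (\<lambda>n. \<epsilon>\<^sup>2 * inverse (2 * (sqrt (real n) * k' n)\<^sup>2)) at_top sequentially"
    using \<open>\<epsilon> > 0\<close> by (intro filterlim_tendsto_pos_mult_at_top[OF tendsto_const]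
      filterlim_compose[OF filterlim_inverse_at_top_right]) auto
  then have "(\<lambda>n. exp (- (\<epsilon>\<^sup>2 * inverse (2 * (sqrt (real n) * k' n)\<^sup>2)))) \<longlonglongrightarrow> 0"
    by (intro filterlim_compose[OF exp_at_bot]) (simp add: filterlim_uminus_at_bot)
  then show "(\<lambda>n. 2 * exp (- (\<epsilon>\<^sup>2 * inverse (2 * (sqrt (real n) * k' n)\<^sup>2)))) \<longlonglongrightarrow> 0"
    using tendsto_mult_right_zero by blast
  show "\<forall>\<^sub>F n in sequentially. norm (measure (PiM {..<n} (\<lambda>_. M n)) {\<omega> \<in> space (PiM {..<n} (\<lambda>_. M n)). \<bar>\<Sum>i<n. f n (\<omega> i)\<bar> \<ge> \<epsilon>})
      \<le> 2 * exp (- (\<epsilon>\<^sup>2 * inverse (2 * (sqrt (real n) * k' n)\<^sup>2)))"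
    using eventually_gt_at_top[of 0]
  proof eventually_elim
    fix n :: nat assume n: "n > 0"
    have AEk: "AE x in M n. \<bar>f n x\<bar> \<le> k' n"
      using bd[OF n] by eventually_elim (auto simp: k'_def intro: order_trans add_increasing2)
    have eq: "\<epsilon>\<^sup>2 * inverse (2 * (sqrt (real n) * k' n)\<^sup>2) = \<epsilon>\<^sup>2 / (2 * real n * (k' n)\<^sup>2)"
      unfolding power_mult_distrib divide_inverse real_sqrt_pow2[OF of_nat_0_le_iff] by (simp only: mult.assoc)
    from PiM_sum_Hoeffding[OF M[OF n] f[OF n] AEk mean[OF n] k'_pos[OF n] n, of \<epsilon>] \<open>\<epsilon> > 0\<close>
    show "norm (measure (PiM {..<n} (\<lambda>_. M n)) {\<omega> \<in> space (PiM {..<n} (\<lambda>_. M n)). \<bar>\<Sum>i<n. f n (\<omega> i)\<bar> \<ge> \<epsilon>})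
      \<le> 2 * exp (- (\<epsilon>\<^sup>2 * inverse (2 * (sqrt (real n) * k' n)\<^sup>2)))"
      unfolding eq by simp
  qed
qed

text \<open>Both sides agree on rectangles by Fubini. This makes the likelihood ratio of a sample
  the product of those of its observations.\<close>

lemma PiM_density:
  assumes M: "prob_space M" and [measurable]: "f \<in> borel_measurable M"
    and D: "prob_space (density M f)" and I: "finite I"
  shows "PiM I (\<lambda>_. density M f) = density (PiM I (\<lambda>_. M)) (\<lambda>\<omega>. \<Prod>i\<in>I. f (\<omega> i))"
proof -
  interpret M: product_prob_space "\<lambda>_. M" I
    by (simp add: M product_prob_space_def product_prob_space_axioms_def product_sigma_finite_def prob_space_imp_sigma_finite)
  interpret D: product_prob_space "\<lambda>_. density M f" I
    by (simp add: D product_prob_space_def product_prob_space_axioms_def product_sigma_finite_def prob_space_imp_sigma_finite)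
  show ?thesis
  proof (rule D.PiM_eqI[OF I, symmetric])
    show "sets (density (PiM I (\<lambda>_. M)) (\<lambda>\<omega>. \<Prod>i\<in>I. f (\<omega> i))) = sets (PiM I (\<lambda>_. density M f))"
      by (simp cong: sets_PiM_cong)
    fix A assume "\<And>i. i \<in> I \<Longrightarrow> A i \<in> sets (density M f)"
    then have A [measurable]: "\<And>i. i \<in> I \<Longrightarrow> A i \<in> sets M" by simp
    have "emeasure (density (PiM I (\<lambda>_. M)) (\<lambda>\<omega>. \<Prod>i\<in>I. f (\<omega> i))) (Pi\<^sub>E I A)
        = (\<integral>\<^sup>+\<omega>. (\<Prod>i\<in>I. f (\<omega> i)) * indicator (Pi\<^sub>E I A) \<omega> \<partial>PiM I (\<lambda>_. M))"
      using I by (intro emeasure_density) (auto intro!: sets_PiM_I_finite A)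
    also have "\<dots> = (\<integral>\<^sup>+\<omega>. (\<Prod>i\<in>I. f (\<omega> i) * indicator (A i) (\<omega> i)) \<partial>PiM I (\<lambda>_. M))"
    proof (rule nn_integral_cong)
      fix \<omega> assume "\<omega> \<in> space (PiM I (\<lambda>_. M))"
      then have "indicator (Pi\<^sub>E I A) \<omega> = (\<Prod>i\<in>I. indicator (A i) (\<omega> i) :: ennreal)"
        using I by (auto simp: space_PiM PiE_iff indicator_def prod_zero_iff)
      then show "(\<Prod>i\<in>I. f (\<omega> i)) * indicator (Pi\<^sub>E I A) \<omega> = (\<Prod>i\<in>I. f (\<omega> i) * indicator (A i) (\<omega> i))"
        by (simp add: prod.distrib)
    qed
    also have "\<dots> = (\<Prod>i\<in>I. \<integral>\<^sup>+x. f x * indicator (A i) x \<partial>M)"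
      using I by (intro M.product_nn_integral_prod) auto
    also have "\<dots> = (\<Prod>i\<in>I. emeasure (density M f) (A i))"
      by (intro prod.cong refl emeasure_density[symmetric]) auto
    finally show "emeasure (density (PiM I (\<lambda>_. M)) (\<lambda>\<omega>. \<Prod>i\<in>I. f (\<omega> i))) (Pi\<^sub>E I A) = (\<Prod>i\<in>I. emeasure (density M f) (A i))" .
  qed
qed

text \<open>Boundedness gives a third moment, so the characteristic function at
  \<open>1 / sqrt n\<close> differs from \<open>1 - v / (2 n)\<close> by a multiple of
  \<open>n^(-3/2)\<close>. Taking \<open>n\<close>-th powers of numbers of modulus at most one
  multiplies the error by at most \<open>n\<close>, and it still vanishes.\<close>

lemma char_power_tendsto_normal:
  fixes f :: "'a \<Rightarrow> real"
  assumes "prob_space M" and [measurable]: "f \<in> borel_measurable M"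
    and bd: "AE x in M. \<bar>f x\<bar> \<le> K" and mean: "(\<integral>x. f x \<partial>M) = 0"
  shows "(\<lambda>n. (\<integral>x. cis (f x / sqrt (real n)) \<partial>M) ^ n) \<longlonglongrightarrow> complex_of_real (exp (- (\<integral>x. (f x)\<^sup>2 \<partial>M) / 2))"
proof -
  interpret prob_space M by fact
  define v where "v = (\<integral>x. (f x)\<^sup>2 \<partial>M)"
  have K: "K \<ge> 0"
  proof -
    have "AE x in M. K \<ge> 0" using bd by eventually_elim auto
    then show ?thesis by simp
  qed
  have int: "integrable M (\<lambda>x. f x ^ j)" for j
    by (rule integrable_const_bound[where B = "K ^ j"])
       (use bd in \<open>auto elim!: eventually_mono simp: power_abs intro!: power_mono\<close>)
  have int3: "integrable M (\<lambda>x. \<bar>f x\<bar> ^ 3)"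
    using integrable_abs[OF int[of 3]] by (simp add: power_abs)
  define B where "B = (\<integral>x. \<bar>f x\<bar> ^ 3 \<partial>M)"
  have approx: "norm ((\<integral>x. cis (f x / sqrt (real n)) \<partial>M) - complex_of_real (1 + (- v / 2) / real n))
       \<le> B / (6 * sqrt (real n) ^ 3)" if n: "n > 0" for n
  proof -
    define s where "s = 1 / sqrt (real n)"
    have s: "s > 0" "s\<^sup>2 = 1 / real n" using n by (auto simp: s_def power_divide)
    have icis: "integrable M (\<lambda>x. cis (f x * s))"
      by (rule integrable_const_bound[where B = 1]) (auto simp: cis_conv_exp)
    have "norm ((\<integral>x. cis (f x * s) \<partial>M) - (\<integral>x. (\<Sum>k\<le>2. (\<i> * (f x * s)) ^ k / fact k) \<partial>M))
       = norm (\<integral>x. (cis (f x * s) - (\<Sum>k\<le>2. (\<i> * (f x * s)) ^ k / fact k)) \<partial>M)"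
    proof (subst Bochner_Integration.integral_diff)
      show "integrable M (\<lambda>x. cis (f x * s))" by (rule icis)
      show "integrable M (\<lambda>x. \<Sum>k\<le>2. (\<i> * (f x * s)) ^ k / fact k)"
        using int by (auto simp: power_mult_distrib simp flip: of_real_power intro!: integrable_sum)
    qed simp
    also have "\<dots> \<le> (\<integral>x. s ^ 3 / 6 * \<bar>f x\<bar> ^ 3 \<partial>M)"
    proof (rule order_trans[OF integral_norm_bound integral_mono])
      show "integrable M (\<lambda>x. norm (cis (f x * s) - (\<Sum>k\<le>2. (\<i> * (f x * s)) ^ k / fact k)))"
        using int icis by (intro integrable_norm Bochner_Integration.integrable_diff)
          (auto simp: power_mult_distrib simp flip: of_real_power intro!: integrable_sum)
      show "integrable M (\<lambda>x. s ^ 3 / 6 * \<bar>f x\<bar> ^ 3)" using int3 by simp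
      fix x
      have "norm (iexp (f x * s) - (\<Sum>k\<le>2. (\<i> * (f x * s)) ^ k / fact k)) \<le> \<bar>f x * s\<bar> ^ Suc 2 / fact (Suc 2)"
        by (rule iexp_approx1)
      also have "\<bar>f x * s\<bar> ^ Suc 2 / fact (Suc 2) = s ^ 3 / 6 * \<bar>f x\<bar> ^ 3"
        using s(1) by (simp add: abs_mult power_mult_distrib eval_nat_numeral)
      finally show "norm (cis (f x * s) - (\<Sum>k\<le>2. (\<i> * (f x * s)) ^ k / fact k)) \<le> s ^ 3 / 6 * \<bar>f x\<bar> ^ 3"
        by (simp add: cis_conv_exp)
    qed
    also have "\<dots> = B / (6 * sqrt (real n) ^ 3)" by (simp add: B_def s_def power_divide)
    also have "(\<integral>x. (\<Sum>k\<le>2. (\<i> * (f x * s)) ^ k / fact k) \<partial>M) = complex_of_real (1 + (- v / 2) / real n)"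
    proof -
      have 2: "{..2 :: nat} = {0, 1, 2}" by auto
      have eq: "(\<Sum>k\<le>2. (\<i> * (f x * s)) ^ k / fact k)
          = complex_of_real (1 - s\<^sup>2 / 2 * f x ^ 2) + \<i> * complex_of_real (s * f x ^ 1)" for x
      proof -
        have "(\<Sum>k\<in>{0, 1, 2}. (\<i> * z) ^ k / fact k) = 1 + \<i> * z - z\<^sup>2 / 2" for z :: complex
          by (simp add: power_mult_distrib)
        then show ?thesis unfolding 2 by (simp add: power_mult_distrib)
      qed
      have i: "integrable M (\<lambda>x. 1 - s\<^sup>2 / 2 * f x ^ 2)" "integrable M (\<lambda>x. s * f x ^ 1)"
        using int[of 1] int[of 2] by simp_all
      have "(\<integral>x. (\<Sum>k\<le>2. (\<i> * (f x * s)) ^ k / fact k) \<partial>M)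
          = complex_of_real (\<integral>x. 1 - s\<^sup>2 / 2 * f x ^ 2 \<partial>M) + \<i> * complex_of_real (\<integral>x. s * f x ^ 1 \<partial>M)"
        unfolding eq using i by (subst Bochner_Integration.integral_add) (simp_all del: of_real_add of_real_diff of_real_mult)
      also have "(\<integral>x. 1 - s\<^sup>2 / 2 * f x ^ 2 \<partial>M) = 1 - s\<^sup>2 / 2 * v"
        using int[of 2] by (subst Bochner_Integration.integral_diff) (simp_all add: v_def prob_space)
      also have "(\<integral>x. s * f x ^ 1 \<partial>M) = 0" using mean by simp
      finally show ?thesis by (simp add: s)
    qed
    finally show ?thesis by (simp add: s_def)
  qed
  have lim: "(\<lambda>n. complex_of_real ((1 + (- v / 2) / real n) ^ n)) \<longlonglongrightarrow> complex_of_real (exp (- v / 2))"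
    by (intro tendsto_of_real tendsto_exp_limit_sequentially)
  have "(\<lambda>n. (\<integral>x. cis (f x / sqrt (real n)) \<partial>M) ^ n - complex_of_real ((1 + (- v / 2) / real n) ^ n)) \<longlonglongrightarrow> 0"
  proof (rule Lim_null_comparison)
    have "(\<lambda>n. real n * (1 / (6 * sqrt (real n) ^ 3))) \<longlonglongrightarrow> 0" by real_asymp
    from tendsto_mult_right_zero[OF this, of B]
    show "(\<lambda>n. real n * (B / (6 * sqrt (real n) ^ 3))) \<longlonglongrightarrow> 0" by (simp add: mult_ac)
    show "\<forall>\<^sub>F n in sequentially. norm ((\<integral>x. cis (f x / sqrt (real n)) \<partial>M) ^ n - complex_of_real ((1 + (- v / 2) / real n) ^ n))
       \<le> real n * (B / (6 * sqrt (real n) ^ 3))"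
      \<comment> \<open>From \<open>n \<ge> v\<close> on, \<open>1 - v / (2 n)\<close> has modulus
        at most one, as \<open>norm_power_diff\<close> demands.\<close>
      using eventually_ge_at_top[of "nat \<lceil>v\<rceil> + 1"]
    proof eventually_elim
      fix n assume n: "nat \<lceil>v\<rceil> + 1 \<le> n"
      have v0: "v \<ge> 0" by (simp add: v_def)
      have "real n \<ge> v" using n by linarith
      then have "\<bar>1 + (- v / 2) / real n\<bar> \<le> 1" using n v0 by (auto simp: abs_le_iff field_simps)
      then have 1: "norm (complex_of_real (1 + (- v / 2) / real n)) \<le> 1" by (simp only: norm_of_real)
      have "norm (\<integral>x. cis (f x / sqrt (real n)) \<partial>M) \<le> (\<integral>x. norm (cis (f x / sqrt (real n))) \<partial>M)"
        by (rule integral_norm_bound)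
      then have 2: "norm (\<integral>x. cis (f x / sqrt (real n)) \<partial>M) \<le> 1" by (simp add: prob_space)
      have "norm ((\<integral>x. cis (f x / sqrt (real n)) \<partial>M) ^ n - complex_of_real (1 + (- v / 2) / real n) ^ n)
         \<le> real n * norm ((\<integral>x. cis (f x / sqrt (real n)) \<partial>M) - complex_of_real (1 + (- v / 2) / real n))"
        using 2 1 by (rule norm_power_diff)
      also have "\<dots> \<le> real n * (B / (6 * sqrt (real n) ^ 3))"
        using n by (intro mult_left_mono approx) auto
      finally show "norm ((\<integral>x. cis (f x / sqrt (real n)) \<partial>M) ^ n - complex_of_real ((1 + (- v / 2) / real n) ^ n))
         \<le> real n * (B / (6 * sqrt (real n) ^ 3))" by simp
    qed
  qed
  from tendsto_add[OF this lim] show ?thesis by (simp add: v_def)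
qed

section \<open>Weak convergence from characteristic functions\<close>

text \<open>Products are not among the rules, so that induction only meets real and imaginary parts
  of characteristic functions and their sums. Closure under products is derived from the
  product-to-sum identities.\<close>

inductive trig_poly :: "('a::euclidean_space \<Rightarrow> real) \<Rightarrow> bool" where
  cos: "trig_poly (\<lambda>x. c * cos (t \<bullet> x))"
| sin: "trig_poly (\<lambda>x. c * sin (t \<bullet> x))"
| add: "trig_poly f \<Longrightarrow> trig_poly g \<Longrightarrow> trig_poly (\<lambda>x. f x + g x)"

lemma trig_poly_const: "trig_poly (\<lambda>x. c)"
  using trig_poly.cos[of c 0] by simp

lemma trig_poly_sum: "finite I \<Longrightarrow> (\<And>i. i \<in> I \<Longrightarrow> trig_poly (f i)) \<Longrightarrow> trig_poly (\<lambda>x. \<Sum>i\<in>I. f i x)"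
  by (induction I rule: finite_induct) (auto intro: trig_poly.add trig_poly_const)

lemma trig_poly_cos_mult: "trig_poly g \<Longrightarrow> trig_poly (\<lambda>x. c * cos (t \<bullet> x) * g x)"
proof (induction g rule: trig_poly.induct)
  case (cos d s)
  have "(\<lambda>x. c * cos (t \<bullet> x) * (d * cos (s \<bullet> x)))
     = (\<lambda>x. (c * d / 2) * cos ((t - s) \<bullet> x) + (c * d / 2) * cos ((t + s) \<bullet> x))"
    by (simp add: fun_eq_iff inner_diff_left inner_add_left cos_add cos_diff algebra_simps)
  then show ?case by (simp only:) (intro trig_poly.intros)
next
  case (sin d s)
  have "(\<lambda>x. c * cos (t \<bullet> x) * (d * sin (s \<bullet> x)))
     = (\<lambda>x. (c * d / 2) * sin ((t + s) \<bullet> x) + (- c * d / 2) * sin ((t - s) \<bullet> x))"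
    by (simp add: fun_eq_iff inner_diff_left inner_add_left sin_add sin_diff algebra_simps)
  then show ?case by (simp only:) (intro trig_poly.intros)
next
  case (add f g)
  then show ?case using trig_poly.add[OF add.IH] by (simp add: distrib_left)
qed

lemma trig_poly_sin_mult: "trig_poly g \<Longrightarrow> trig_poly (\<lambda>x. c * sin (t \<bullet> x) * g x)"
proof (induction g rule: trig_poly.induct)
  case (cos d s)
  have "(\<lambda>x. c * sin (t \<bullet> x) * (d * cos (s \<bullet> x)))
     = (\<lambda>x. (c * d / 2) * sin ((t + s) \<bullet> x) + (c * d / 2) * sin ((t - s) \<bullet> x))"
    by (simp add: fun_eq_iff inner_diff_left inner_add_left sin_add sin_diff algebra_simps)
  then show ?case by (simp only:) (intro trig_poly.intros)
next
  case (sin d s)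
  have "(\<lambda>x. c * sin (t \<bullet> x) * (d * sin (s \<bullet> x)))
     = (\<lambda>x. (c * d / 2) * cos ((t - s) \<bullet> x) + (- c * d / 2) * cos ((t + s) \<bullet> x))"
    by (simp add: fun_eq_iff inner_diff_left inner_add_left cos_add cos_diff algebra_simps)
  then show ?case by (simp only:) (intro trig_poly.intros)
next
  case (add f g)
  then show ?case using trig_poly.add[OF add.IH] by (simp add: distrib_left)
qed

lemma trig_poly_mult: "trig_poly f \<Longrightarrow> trig_poly g \<Longrightarrow> trig_poly (\<lambda>x. f x * g x)"
proof (induction f rule: trig_poly.induct)
  case (add f1 f2)
  then show ?case using trig_poly.add[of "\<lambda>x. f1 x * g x" "\<lambda>x. f2 x * g x"] by (simp add: distrib_right)
qed (simp_all add: trig_poly_cos_mult trig_poly_sin_mult)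

text \<open>A linear functional of the vector of sines is a combination of sines with frequencies
  \<open>k *\<^sub>R b\<close>; closure under sums and products extends this to all
  polynomials.\<close>

lemma trig_poly_polynomial_sin:
  fixes P :: "'a::euclidean_space \<Rightarrow> real"
  assumes "real_polynomial_function P"
  shows "trig_poly (\<lambda>x. P (\<Sum>b\<in>Basis. sin (k * (x \<bullet> b)) *\<^sub>R b))"
  using assms
proof (induction P rule: real_polynomial_function.induct)
  case (linear f)
  interpret bounded_linear f by fact
  have "(\<lambda>x. f (\<Sum>b\<in>Basis. sin (k * (x \<bullet> b)) *\<^sub>R b)) = (\<lambda>x. \<Sum>b\<in>Basis. f b * sin ((k *\<^sub>R b) \<bullet> x))"
    by (simp add: fun_eq_iff sum scaleR inner_commute mult.commute)
  then show ?case by (simp only:) (intro trig_poly_sum trig_poly.intros finite_Basis)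
qed (auto intro: trig_poly_const trig_poly.add trig_poly_mult)

lemma trig_poly_continuous: "trig_poly f \<Longrightarrow> continuous_on UNIV f"
  by (induction rule: trig_poly.induct) (auto intro!: continuous_intros)

lemma trig_poly_bounded: "trig_poly f \<Longrightarrow> \<exists>B. \<forall>x. \<bar>f x\<bar> \<le> B"
proof (induction rule: trig_poly.induct)
  case (cos c t)
  have "\<bar>c * cos (t \<bullet> x)\<bar> \<le> \<bar>c\<bar>" for x by (simp add: abs_mult mult_left_le)
  then show ?case by blast
next
  case (sin c t)
  have "\<bar>c * sin (t \<bullet> x)\<bar> \<le> \<bar>c\<bar>" for x by (simp add: abs_mult mult_left_le)
  then show ?case by blast
next
  case (add f g)
  then obtain B C where "\<And>x. \<bar>f x\<bar> \<le> B" "\<And>x. \<bar>g x\<bar> \<le> C" by auto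
  then have "\<bar>f x + g x\<bar> \<le> B + C" for x by (meson abs_triangle_ineq add_mono order_trans)
  then show ?case by blast
qed

section \<open>From trigonometric polynomials to bounded continuous functions\<close>

lemma (in prob_space) integrable_bounded_continuous:
  fixes f :: "'b::euclidean_space \<Rightarrow> real"
  assumes "continuous_on UNIV f" "\<And>x. \<bar>f x\<bar> \<le> B" and [measurable]: "X \<in> borel_measurable M"
  shows "integrable M (\<lambda>\<omega>. f (X \<omega>))"
proof -
  have [measurable]: "f \<in> borel_measurable borel" by (rule borel_measurable_continuous_onI) fact
  show ?thesis by (rule integrable_const_bound[where B = B]) (use assms in auto)
qed

lemma trig_poly_expectation_tendsto:
  fixes X :: "nat \<Rightarrow> 'a \<Rightarrow> 'b::euclidean_space"
  assumes "trig_poly f" and P: "\<And>n. prob_space (P n)" and X: "\<And>n. X n \<in> borel_measurable (P n)"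
    and \<mu>: "prob_space \<mu>" "sets \<mu> = sets borel"
    and char: "\<And>t. (\<lambda>n. \<integral>\<omega>. cis (t \<bullet> X n \<omega>) \<partial>P n) \<longlonglongrightarrow> (\<integral>x. cis (t \<bullet> x) \<partial>\<mu>)"
  shows "(\<lambda>n. \<integral>\<omega>. f (X n \<omega>) \<partial>P n) \<longlonglongrightarrow> (\<integral>x. f x \<partial>\<mu>)"
proof -
  have id: "(\<lambda>x. x) \<in> borel_measurable \<mu>" using \<mu>(2) by (simp add: measurable_ident_sets)
  have cis_int: "integrable M (\<lambda>\<omega>. cis (t \<bullet> Y \<omega>))"
    if "prob_space M" and [measurable]: "Y \<in> borel_measurable M" for M :: "'c measure" and Y :: "'c \<Rightarrow> 'b" and t
  proof -
    interpret prob_space M by fact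
    show ?thesis by (rule integrable_const_bound[where B = 1]) (auto simp: cis_conv_exp)
  qed
  show ?thesis
    using \<open>trig_poly f\<close>
  proof (induction rule: trig_poly.induct)
    case (cos c t)
    have "(\<lambda>n. c * Re (\<integral>\<omega>. cis (t \<bullet> X n \<omega>) \<partial>P n)) \<longlonglongrightarrow> c * Re (\<integral>x. cis (t \<bullet> x) \<partial>\<mu>)"
      by (intro tendsto_intros char)
    then show ?case
      by (simp add: integral_Re[symmetric] cis_int[OF P X] cis_int[OF \<mu>(1) id])
  next
    case (sin c t)
    have "(\<lambda>n. c * Im (\<integral>\<omega>. cis (t \<bullet> X n \<omega>) \<partial>P n)) \<longlonglongrightarrow> c * Im (\<integral>x. cis (t \<bullet> x) \<partial>\<mu>)"
      by (intro tendsto_intros char)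
    then show ?case
      by (simp add: integral_Im[symmetric] cis_int[OF P X] cis_int[OF \<mu>(1) id])
  next
    case (add f g)
    obtain B C where "\<And>x. \<bar>f x\<bar> \<le> B" "\<And>x. \<bar>g x\<bar> \<le> C"
      using add.hyps trig_poly_bounded by metis
    then have int: "integrable M (\<lambda>\<omega>. f (Y \<omega>))" "integrable M (\<lambda>\<omega>. g (Y \<omega>))"
      if "prob_space M" "Y \<in> borel_measurable M" for M :: "'c measure" and Y :: "'c \<Rightarrow> 'b"
      using that add.hyps trig_poly_continuous prob_space.integrable_bounded_continuous by metis+
    show ?case
      using tendsto_add[OF add.IH] by (simp add: int[OF P X] int[OF \<mu>(1) id])
  qed
qed

text \<open>Inside the box the two integrands differ by at most \<open>\<epsilon>\<close>; outside,
  on an event of probability at most \<open>\<delta>\<close>, by at most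
  \<open>B + (B + \<epsilon>)\<close>.\<close>

lemma (in prob_space) expectation_diff_le_tight:
  fixes f h :: "'b::euclidean_space \<Rightarrow> real"
  assumes [measurable]: "X \<in> borel_measurable M" and f: "continuous_on UNIV f" "\<And>x. \<bar>f x\<bar> \<le> B"
    and h: "continuous_on UNIV h" "\<And>x. \<bar>h x\<bar> \<le> B + \<epsilon>"
    and close: "\<And>x. (\<forall>b\<in>Basis. \<bar>x \<bullet> b\<bar> \<le> L) \<Longrightarrow> \<bar>f x - h x\<bar> \<le> \<epsilon>" and "\<epsilon> \<ge> 0"
    and tight: "prob {\<omega> \<in> space M. \<exists>b\<in>Basis. \<bar>X \<omega> \<bullet> b\<bar> > L} \<le> \<delta>"
  shows "\<bar>expectation (\<lambda>\<omega>. f (X \<omega>)) - expectation (\<lambda>\<omega>. h (X \<omega>))\<bar> \<le> \<epsilon> + (2 * B + \<epsilon>) * \<delta>"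
proof -
  let ?A = "{\<omega> \<in> space M. \<exists>b\<in>Basis. \<bar>X \<omega> \<bullet> b\<bar> > L}"
  have B: "B \<ge> 0" using f(2)[of 0] by linarith
  have [measurable]: "?A \<in> sets M" by measurable
  have fi: "integrable M (\<lambda>\<omega>. f (X \<omega>))" and hi: "integrable M (\<lambda>\<omega>. h (X \<omega>))"
    by (intro integrable_bounded_continuous[OF f] integrable_bounded_continuous[OF h]; measurable)+
  have "\<bar>expectation (\<lambda>\<omega>. f (X \<omega>)) - expectation (\<lambda>\<omega>. h (X \<omega>))\<bar> = \<bar>expectation (\<lambda>\<omega>. f (X \<omega>) - h (X \<omega>))\<bar>"
    using fi hi by simp
  also have "\<dots> \<le> expectation (\<lambda>\<omega>. \<bar>f (X \<omega>) - h (X \<omega>)\<bar>)" by (rule integral_abs_bound)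
  also have "\<dots> \<le> expectation (\<lambda>\<omega>. \<epsilon> + (2 * B + \<epsilon>) * indicator ?A \<omega>)"
  proof (rule integral_mono)
    show "integrable M (\<lambda>\<omega>. \<bar>f (X \<omega>) - h (X \<omega>)\<bar>)" using fi hi by auto
    show "integrable M (\<lambda>\<omega>. \<epsilon> + (2 * B + \<epsilon>) * indicator ?A \<omega>)" by (auto simp: emeasure_eq_measure)
    fix \<omega> assume \<omega>: "\<omega> \<in> space M"
    show "\<bar>f (X \<omega>) - h (X \<omega>)\<bar> \<le> \<epsilon> + (2 * B + \<epsilon>) * indicator ?A \<omega>"
    proof (cases "\<omega> \<in> ?A")
      case True
      have "\<bar>f (X \<omega>) - h (X \<omega>)\<bar> \<le> B + (B + \<epsilon>)" using f(2)[of "X \<omega>"] h(2)[of "X \<omega>"] by linarith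
      then show ?thesis using True \<open>\<epsilon> \<ge> 0\<close> by simp
    next
      case False
      then show ?thesis using close[of "X \<omega>"] \<omega> by (auto simp: not_less)
    qed
  qed
  also have "\<dots> = \<epsilon> + (2 * B + \<epsilon>) * prob ?A" by (simp add: prob_space emeasure_eq_measure)
  also have "\<dots> \<le> \<epsilon> + (2 * B + \<epsilon>) * \<delta>" using B \<open>\<epsilon> \<ge> 0\<close> tight by (intro add_left_mono mult_left_mono) auto
  finally show ?thesis .
qed

text \<open>The sets of points outside the box of size \<open>n\<close> decrease to the empty set,
  so their measures tend to zero.\<close>

lemma tight_borel:
  fixes M :: "'a::euclidean_space measure"
  assumes "prob_space M" "sets M = sets borel" "\<epsilon> > 0"
  shows "\<exists>R. \<forall>L\<ge>R. measure M {x \<in> space M. \<exists>b\<in>Basis. \<bar>x \<bullet> b\<bar> > L} \<le> \<epsilon>"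
proof -
  interpret prob_space M by fact
  define A where "A n = {x \<in> space M. \<exists>b\<in>Basis. \<bar>x \<bullet> b\<bar> > real n}" for n
  have [measurable]: "(\<lambda>x. x) \<in> borel_measurable M" using assms(2) by (simp add: measurable_ident_sets)
  have Am [measurable]: "{x \<in> space M. \<exists>b\<in>Basis. \<bar>x \<bullet> b\<bar> > L} \<in> sets M" for L by measurable
  have "(\<lambda>n. prob (A n)) \<longlonglongrightarrow> prob (\<Inter>n. A n)"
  proof (rule finite_Lim_measure_decseq)
    show "range A \<subseteq> sets M" using Am by (auto simp: A_def)
    show "decseq A" unfolding decseq_def A_def by (auto, metis of_nat_mono order_le_less_trans)
  qed
  also have "(\<Inter>n. A n) = {}"
  proof (rule ccontr)
    assume "(\<Inter>n. A n) \<noteq> {}"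
    then obtain x where x: "\<And>n. x \<in> A n" by auto
    obtain n where n: "norm x < real n" using reals_Archimedean2 by blast
    from x[of n] obtain b where "b \<in> Basis" "real n < \<bar>x \<bullet> b\<bar>" by (auto simp: A_def)
    with Basis_le_norm[of b x] n show False by simp
  qed
  finally have "\<forall>\<^sub>F n in sequentially. prob (A n) < \<epsilon>" using assms(3) by (auto dest: order_tendstoD(2))
  then obtain n where n: "prob (A n) < \<epsilon>" by (auto simp: eventually_sequentially)
  have "prob {x \<in> space M. \<exists>b\<in>Basis. \<bar>x \<bullet> b\<bar> > L} \<le> prob (A n)" if "L \<ge> real n" for L
    using that Am by (intro finite_measure_mono) (auto simp: A_def, metis order_le_less_trans)
  then show ?thesis using n by (intro exI[of _ "real n"]) force
qed

text \<open>The Stone--Weierstrass polynomial is evaluated at \<open>sin (\<pi> x\<^sub>b / (2 L))\<close>, so that the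
  approximant is a trigonometric polynomial whose values outside the box of size \<open>L\<close> are
  controlled by its values inside.\<close>
lemma trig_poly_approximation:
  fixes f :: "'a::euclidean_space \<Rightarrow> real"
  assumes f: "continuous_on UNIV f" "\<And>x. \<bar>f x\<bar> \<le> B" and "L > 0" "\<epsilon> > 0"
  shows "\<exists>h. trig_poly h \<and> (\<forall>x. \<bar>h x\<bar> \<le> B + \<epsilon>) \<and> (\<forall>x. (\<forall>b\<in>Basis. \<bar>x \<bullet> b\<bar> \<le> L) \<longrightarrow> \<bar>f x - h x\<bar> \<le> \<epsilon>)"
proof -
  \<comment> \<open>With \<open>k * L = pi / 2\<close> the map
    \<open>x \<mapsto> sin (k * x)\<close> is a bijection from \<open>[-L, L]\<close> onto
    \<open>[-1, 1]\<close> with inverse \<open>s \<mapsto> arcsin s / k\<close>; through it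
    \<open>F\<close> transports \<open>f\<close> to the cube \<open>K\<close>.\<close>
  define k where "k = pi / (2 * L)"
  have k: "k > 0" using assms by (simp add: k_def)
  define F where "F s = f (\<Sum>b\<in>Basis. (arcsin (s \<bullet> b) / k) *\<^sub>R b)" for s :: 'a
  define K where "K = cbox (- One) (One :: 'a)"
  have K: "s \<in> K \<longleftrightarrow> (\<forall>b\<in>Basis. \<bar>s \<bullet> b\<bar> \<le> 1)" for s by (auto simp: K_def mem_box abs_le_iff)
  have "continuous_on K F"
    unfolding F_def
    using k by (intro continuous_on_compose2[OF f(1)]) (auto intro!: continuous_intros continuous_on_arcsin simp: K abs_le_iff)
  moreover have "compact K" by (simp add: K_def)
  ultimately obtain P where P: "real_polynomial_function P" "\<And>s. s \<in> K \<Longrightarrow> \<bar>F s - P s\<bar> < \<epsilon>"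
    using Stone_Weierstrass_real_polynomial_function \<open>\<epsilon> > 0\<close> by metis
  define S where "S x = (\<Sum>b\<in>Basis. sin (k * (x \<bullet> b)) *\<^sub>R b)" for x :: 'a
  have SK: "S x \<in> K" for x
    by (auto simp: K S_def inner_sum_left inner_Basis if_distrib cong: if_cong)
  have "\<bar>P (S x)\<bar> \<le> B + \<epsilon>" for x using P(2)[OF SK[of x]] f(2)[of "\<Sum>b\<in>Basis. (arcsin (S x \<bullet> b) / k) *\<^sub>R b"] unfolding F_def by linarith
  moreover have "\<bar>f x - P (S x)\<bar> \<le> \<epsilon>" if x: "\<forall>b\<in>Basis. \<bar>x \<bullet> b\<bar> \<le> L" for x
  proof -
    have "arcsin (S x \<bullet> b) / k = x \<bullet> b" if b: "b \<in> Basis" for b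
    proof -
      have "S x \<bullet> b = sin (k * (x \<bullet> b))"
        using b by (simp add: S_def inner_sum_left inner_Basis if_distrib cong: if_cong)
      moreover have "\<bar>k * (x \<bullet> b)\<bar> \<le> k * L" using k x b by (simp add: abs_mult)
      moreover have "k * L = pi / 2" using \<open>L > 0\<close> by (simp add: k_def)
      ultimately show ?thesis using k by (simp add: arcsin_sin abs_le_iff)
    qed
    then have "F (S x) = f x" unfolding F_def by (simp add: euclidean_representation)
    then show ?thesis using P(2)[OF SK[of x]] by simp
  qed
  ultimately show ?thesis
    using trig_poly_polynomial_sin[OF P(1), of k] unfolding S_def by blast
qed

text \<open>Characteristic functions settle the limit for a trigonometric polynomial
  \<open>h\<close>; tightness of the sequence and of \<open>\<mu>\<close> bounds the cost of
  replacing \<open>f\<close> by \<open>h\<close>. The order of choices is \<open>L\<close>, then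
  \<open>h\<close>, then \<open>n\<close>, so the tightness hypothesis lets the threshold in
  \<open>n\<close> depend on \<open>L\<close>.\<close>

theorem weak_convergence_charI:
  fixes X :: "nat \<Rightarrow> 'a \<Rightarrow> 'b::euclidean_space" and f :: "'b \<Rightarrow> real"
  assumes P: "\<And>n. prob_space (P n)" and X: "\<And>n. X n \<in> borel_measurable (P n)"
    and \<mu>: "prob_space \<mu>" "sets \<mu> = sets borel"
    and char: "\<And>t. (\<lambda>n. \<integral>\<omega>. cis (t \<bullet> X n \<omega>) \<partial>P n) \<longlonglongrightarrow> (\<integral>x. cis (t \<bullet> x) \<partial>\<mu>)"
    and tight: "\<And>\<epsilon>. \<epsilon> > 0 \<Longrightarrow> \<exists>R. \<forall>L\<ge>R. \<forall>\<^sub>F n in sequentially.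
        measure (P n) {\<omega> \<in> space (P n). \<exists>b\<in>Basis. \<bar>X n \<omega> \<bullet> b\<bar> > L} \<le> \<epsilon>"
    and f: "continuous_on UNIV f" "bounded (range f)"
  shows "(\<lambda>n. \<integral>\<omega>. f (X n \<omega>) \<partial>P n) \<longlonglongrightarrow> (\<integral>x. f x \<partial>\<mu>)"
proof (rule LIMSEQ_I)
  fix e :: real assume "e > 0"
  obtain B where B: "\<And>x. \<bar>f x\<bar> \<le> B" using f(2) by (auto simp: bounded_iff)
  have B0: "B \<ge> 0" using B[of 0] by linarith
  interpret \<mu>: prob_space \<mu> by fact
  \<comment> \<open>Replacing \<open>f\<close> by \<open>h\<close> happens twice and costs
    \<open>\<epsilon> * (2 + 2 * B)\<close> each time, where \<open>\<epsilon> \<le> 1\<close>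
    bounds the square of \<open>\<epsilon>\<close>; the convergence for \<open>h\<close> costs one
    more \<open>\<epsilon>\<close>. The sum is \<open>\<epsilon> * (5 + 4 * B)\<close>, at most
    \<open>e / 2\<close>.\<close>
  define \<epsilon> where "\<epsilon> = min 1 (e / (2 * (5 + 4 * B)))"
  have \<epsilon>: "\<epsilon> > 0" "\<epsilon> \<le> 1" using \<open>e > 0\<close> B0 by (auto simp: \<epsilon>_def)
  have "\<epsilon> * (5 + 4 * B) \<le> e / (2 * (5 + 4 * B)) * (5 + 4 * B)"
    using B0 by (intro mult_right_mono) (auto simp: \<epsilon>_def)
  also have "\<dots> = e / 2" using B0 by (simp add: field_simps)
  finally have e: "\<epsilon> * (5 + 4 * B) < e" using \<open>e > 0\<close> by linarith
  obtain R1 where R1: "\<And>L. L \<ge> R1 \<Longrightarrow> \<forall>\<^sub>F n in sequentially.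
      measure (P n) {\<omega> \<in> space (P n). \<exists>b\<in>Basis. \<bar>X n \<omega> \<bullet> b\<bar> > L} \<le> \<epsilon>"
    using tight[OF \<epsilon>(1)] by blast
  obtain R2 where R2: "\<And>L. L \<ge> R2 \<Longrightarrow> \<mu>.prob {x \<in> space \<mu>. \<exists>b\<in>Basis. \<bar>x \<bullet> b\<bar> > L} \<le> \<epsilon>"
    using tight_borel[OF \<mu> \<epsilon>(1)] by blast
  define L where "L = max 1 (max R1 R2)"
  have "L > 0" by (simp add: L_def)
  obtain h where h: "trig_poly h" "\<And>x. \<bar>h x\<bar> \<le> B + \<epsilon>"
      "\<And>x. (\<forall>b\<in>Basis. \<bar>x \<bullet> b\<bar> \<le> L) \<Longrightarrow> \<bar>f x - h x\<bar> \<le> \<epsilon>"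
    using trig_poly_approximation[OF f(1) B \<open>L > 0\<close> \<epsilon>(1)] by blast
  note hc = trig_poly_continuous[OF h(1)]
  have id: "(\<lambda>x. x) \<in> borel_measurable \<mu>" using \<mu>(2) by (simp add: measurable_ident_sets)
  have le: "\<epsilon> + (2 * B + \<epsilon>) * \<epsilon> \<le> \<epsilon> * (2 + 2 * B)"
    using \<epsilon> mult_left_le[of \<epsilon> \<epsilon>] by (simp add: algebra_simps)
  have \<mu>le: "\<bar>(\<integral>x. f x \<partial>\<mu>) - (\<integral>x. h x \<partial>\<mu>)\<bar> \<le> \<epsilon> + (2 * B + \<epsilon>) * \<epsilon>"
    by (rule \<mu>.expectation_diff_le_tight[OF id f(1) B hc h(2) h(3)]) (use R2[of L] \<epsilon> in \<open>auto simp: L_def\<close>)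
  have "(\<lambda>n. \<integral>\<omega>. h (X n \<omega>) \<partial>P n) \<longlonglongrightarrow> (\<integral>x. h x \<partial>\<mu>)"
    by (rule trig_poly_expectation_tendsto[OF h(1) P X \<mu> char])
  then have "\<forall>\<^sub>F n in sequentially. \<bar>(\<integral>\<omega>. h (X n \<omega>) \<partial>P n) - (\<integral>x. h x \<partial>\<mu>)\<bar> < \<epsilon>"
    using \<epsilon>(1) by (auto simp: tendsto_iff dist_real_def)
  moreover have "\<forall>\<^sub>F n in sequentially. measure (P n) {\<omega> \<in> space (P n). \<exists>b\<in>Basis. \<bar>X n \<omega> \<bullet> b\<bar> > L} \<le> \<epsilon>"
    by (rule R1) (simp add: L_def)
  ultimately have "\<forall>\<^sub>F n in sequentially. norm ((\<integral>\<omega>. f (X n \<omega>) \<partial>P n) - (\<integral>x. f x \<partial>\<mu>)) < e"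
  proof eventually_elim
    fix n
    assume 1: "\<bar>(\<integral>\<omega>. h (X n \<omega>) \<partial>P n) - (\<integral>x. h x \<partial>\<mu>)\<bar> < \<epsilon>"
      and 2: "measure (P n) {\<omega> \<in> space (P n). \<exists>b\<in>Basis. \<bar>X n \<omega> \<bullet> b\<bar> > L} \<le> \<epsilon>"
    have "\<bar>(\<integral>\<omega>. f (X n \<omega>) \<partial>P n) - (\<integral>\<omega>. h (X n \<omega>) \<partial>P n)\<bar> \<le> \<epsilon> + (2 * B + \<epsilon>) * \<epsilon>"
      by (rule prob_space.expectation_diff_le_tight[OF P X f(1) B hc h(2) h(3) _ 2]) (use \<epsilon> in auto)
    then have "\<bar>(\<integral>\<omega>. f (X n \<omega>) \<partial>P n) - (\<integral>x. f x \<partial>\<mu>)\<bar> < \<epsilon> + 2 * (\<epsilon> * (2 + 2 * B))"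
      using 1 \<mu>le le by linarith
    also have "\<dots> = \<epsilon> * (5 + 4 * B)" by (simp add: algebra_simps)
    finally show "norm ((\<integral>\<omega>. f (X n \<omega>) \<partial>P n) - (\<integral>x. f x \<partial>\<mu>)) < e" using e by simp
  qed
  then show "\<exists>no. \<forall>n\<ge>no. norm ((\<integral>\<omega>. f (X n \<omega>) \<partial>P n) - (\<integral>x. f x \<partial>\<mu>)) < e"
    by (simp add: eventually_sequentially)
qed

text \<open>Witness: the law of the sum of \<open>Z k *\<^sub>R V k\<close> with independent
  standard normal \<open>Z k\<close>, whose characteristic function factorises.\<close>

lemma ex_centred_normal:
  fixes V :: "'k \<Rightarrow> 'b::euclidean_space"
  assumes I: "finite I"
  shows "\<exists>\<mu>. is_centred_normal \<mu> (\<lambda>t. \<Sum>k\<in>I. (t \<bullet> V k)\<^sup>2)"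
proof -
  let ?N = "PiM I (\<lambda>_. std_normal_distribution)"
  interpret N: real_distribution std_normal_distribution by (rule real_dist_normal_dist)
  interpret product_prob_space "\<lambda>_. std_normal_distribution" I
    by (simp add: product_prob_space_def product_prob_space_axioms_def product_sigma_finite_def
        N.prob_space_axioms prob_space_imp_sigma_finite)
  define Z where "Z \<omega> = (\<Sum>k\<in>I. \<omega> k *\<^sub>R V k)" for \<omega> :: "'k \<Rightarrow> real"
  have Z [measurable]: "Z \<in> borel_measurable ?N" unfolding Z_def by measurable
  have "(\<integral>x. cis (t \<bullet> x) \<partial>distr ?N borel Z) = complex_of_real (exp (- (\<Sum>k\<in>I. (t \<bullet> V k)\<^sup>2) / 2))" for t
  proof -
    have "(\<integral>x. cis (t \<bullet> x) \<partial>distr ?N borel Z) = (\<integral>\<omega>. cis (t \<bullet> Z \<omega>) \<partial>?N)"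
      by (subst integral_distr) (auto simp: cis_conv_exp)
    also have "\<dots> = (\<integral>\<omega>. (\<Prod>k\<in>I. iexp ((t \<bullet> V k) * \<omega> k)) \<partial>?N)"
      using I by (simp add: Z_def inner_sum_right cis_conv_exp exp_sum sum_distrib_left mult_ac)
    also have "\<dots> = (\<Prod>k\<in>I. \<integral>x. iexp ((t \<bullet> V k) * x) \<partial>std_normal_distribution)"
      by (rule product_integral_prod[OF I]) (rule N.integrable_iexp, auto)
    also have "\<dots> = (\<Prod>k\<in>I. char std_normal_distribution (t \<bullet> V k))"
      by (simp add: char_def)
    also have "\<dots> = complex_of_real (exp (- (\<Sum>k\<in>I. (t \<bullet> V k)\<^sup>2) / 2))"
      using I by (simp add: char_std_normal_distribution exp_sum[symmetric] of_real_prod[symmetric]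
          sum_divide_distrib sum_negf del: of_real_prod)
    finally show ?thesis .
  qed
  moreover have "prob_space (distr ?N borel Z)" 
    by (rule prob_space.prob_space_distr[OF prob_space_PiM]) (simp_all add: N.prob_space_axioms)
  ultimately show ?thesis
    unfolding is_centred_normal_def by (intro exI[of _ "distr ?N borel Z"]) simp
qed

text \<open>The vectors \<open>V k\<close> are the adjoint images of the basis. A covariance form,
  possibly degenerate, thus has a normal law as soon as it is displayed as a squared norm of a
  linear image.\<close>

corollary ex_centred_normal_linear:
  fixes L :: "'b::euclidean_space \<Rightarrow> 'c::euclidean_space"
  assumes "linear L"
  shows "\<exists>\<mu>. is_centred_normal \<mu> (\<lambda>t. (norm (L t))\<^sup>2)"
proof -
  have "(norm (L t))\<^sup>2 = (\<Sum>k\<in>Basis. (t \<bullet> adjoint L k)\<^sup>2)" for t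
    by (subst power2_norm_eq_inner, subst euclidean_inner) (simp add: adjoint_works[OF assms] power2_eq_square)
  then show ?thesis using ex_centred_normal[OF finite_Basis, of "adjoint L"] by simp
qed

text \<open>Each row law \<open>M n\<close> is carried by \<open>T n\<close> to the same
  \<open>N\<close>, so the characteristic function of \<open>X n\<close> is exactly an
  \<open>n\<close>-th power for one fixed bounded \<open>Y\<close>. The map \<open>L\<close> serves
  to construct the limit law, and Hoeffding's inequality in every coordinate gives
  tightness.\<close>

lemma asymp_normal_iid:
  fixes Y :: "'c \<Rightarrow> 'b::euclidean_space" and T :: "nat \<Rightarrow> 'a \<Rightarrow> 'c" and L :: "'b \<Rightarrow> 'd::euclidean_space"
  assumes M: "\<And>n. n > 0 \<Longrightarrow> prob_space (M n)" and T: "\<And>n. n > 0 \<Longrightarrow> T n \<in> M n \<rightarrow>\<^sub>M N"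
    and distr: "\<And>n. n > 0 \<Longrightarrow> distr (M n) N (T n) = N" and N: "prob_space N"
    and Y [measurable]: "Y \<in> borel_measurable N" and bd: "AE x in N. norm (Y x) \<le> K"
    and mean: "\<And>t. (\<integral>x. t \<bullet> Y x \<partial>N) = 0"
    and X: "\<And>n. X n \<in> borel_measurable (PiM {..<n} (\<lambda>_. M n))"
    and X_eq: "\<And>n \<omega>. n > 0 \<Longrightarrow> X n \<omega> = (1 / sqrt (real n)) *\<^sub>R (\<Sum>i<n. Y (T n (\<omega> i)))"
    and q: "\<And>t. q t = (\<integral>x. (t \<bullet> Y x)\<^sup>2 \<partial>N)" and L: "linear L" "\<And>t. q t = (norm (L t))\<^sup>2"
  shows "asymp_normal (\<lambda>n. PiM {..<n} (\<lambda>_. M n)) X q"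
proof -
  interpret N: prob_space N by fact
  obtain \<mu> where \<mu>: "is_centred_normal \<mu> q"
    using ex_centred_normal_linear[OF L(1)] L(2) by (metis (no_types, lifting) ext)
  have P: "prob_space (PiM {..<n} (\<lambda>_. M n))" for n
    by (rule prob_space_PiM) (use M in \<open>cases n; auto\<close>)
  have TY: "(\<lambda>x. Y (T n x)) \<in> borel_measurable (M n)" if "n > 0" for n
    using T[OF that] Y by (rule measurable_compose)
  have push: "(\<integral>x. f (T n x) \<partial>M n) = (\<integral>x. f x \<partial>N)"
    if "n > 0" "f \<in> borel_measurable N" for n and f :: "'c \<Rightarrow> 'e::{banach, second_countable_topology}"
    using integral_distr[OF T[OF that(1)] that(2)] distr[OF that(1)] by simp
  have AE_push: "AE x in M n. Q (T n x)" if "n > 0" "AE x in N. Q x" for n Q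
  proof -
    have "AE x in distr (M n) N (T n). Q x" by (subst distr[OF that(1)]) (rule that(2))
    then show ?thesis by (rule AE_distrD[OF T[OF that(1)]])
  qed
  have bdt: "AE x in N. \<bar>t \<bullet> Y x\<bar> \<le> norm t * K" for t
    using bd by eventually_elim (meson Cauchy_Schwarz_ineq2 mult_left_mono norm_ge_zero order_trans)
  have char: "(\<lambda>n. \<integral>\<omega>. cis (t \<bullet> X n \<omega>) \<partial>PiM {..<n} (\<lambda>_. M n)) \<longlonglongrightarrow> (\<integral>x. cis (t \<bullet> x) \<partial>\<mu>)" for t
  proof -
    have "(\<lambda>n. (\<integral>x. cis ((t \<bullet> Y x) / sqrt (real n)) \<partial>N) ^ n) \<longlonglongrightarrow> complex_of_real (exp (- (\<integral>x. (t \<bullet> Y x)\<^sup>2 \<partial>N) / 2))"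
      by (rule char_power_tendsto_normal[OF N _ bdt mean]) measurable
    moreover have "(\<integral>x. cis (t \<bullet> x) \<partial>\<mu>) = complex_of_real (exp (- (\<integral>x. (t \<bullet> Y x)\<^sup>2 \<partial>N) / 2))"
      using \<mu> by (simp add: is_centred_normal_def q)
    moreover have "\<forall>\<^sub>F n in sequentially. (\<integral>x. cis ((t \<bullet> Y x) / sqrt (real n)) \<partial>N) ^ n
        = (\<integral>\<omega>. cis (t \<bullet> X n \<omega>) \<partial>PiM {..<n} (\<lambda>_. M n))"
      using eventually_gt_at_top[of 0]
    proof eventually_elim
      fix n :: nat assume n: "n > 0"
      interpret Mn: prob_space "M n" by (rule M[OF n])
      interpret product_prob_space "\<lambda>_. M n" "{..<n}"
        by (simp add: product_prob_space_def product_prob_space_axioms_def product_sigma_finite_def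
            Mn.prob_space_axioms prob_space_imp_sigma_finite)
      note [measurable] = TY[OF n]
      have "(\<integral>\<omega>. cis (t \<bullet> X n \<omega>) \<partial>PiM {..<n} (\<lambda>_. M n))
         = (\<integral>\<omega>. (\<Prod>i<n. cis ((t \<bullet> Y (T n (\<omega> i))) / sqrt (real n))) \<partial>PiM {..<n} (\<lambda>_. M n))"
        by (simp add: X_eq[OF n] inner_sum_right cis_conv_exp exp_sum sum_distrib_left sum_divide_distrib)
      also have "\<dots> = (\<Prod>i<n. \<integral>x. cis ((t \<bullet> Y (T n x)) / sqrt (real n)) \<partial>M n)"
      proof (rule product_integral_prod)
        fix i :: nat
        show "integrable (M n) (\<lambda>x. cis ((t \<bullet> Y (T n x)) / sqrt (real n)))"
          by (rule Mn.integrable_const_bound[where B = 1]) (auto simp: cis_conv_exp)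
      qed simp
      also have "\<dots> = (\<integral>x. cis ((t \<bullet> Y x) / sqrt (real n)) \<partial>N) ^ n"
        using push[OF n, of "\<lambda>x. cis ((t \<bullet> Y x) / sqrt (real n))"] by (simp add: cis_conv_exp)
      finally show "(\<integral>x. cis ((t \<bullet> Y x) / sqrt (real n)) \<partial>N) ^ n
        = (\<integral>\<omega>. cis (t \<bullet> X n \<omega>) \<partial>PiM {..<n} (\<lambda>_. M n))" ..
    qed
    ultimately show ?thesis by (simp add: Lim_transform_eventually)
  qed
  have tight: "\<exists>R. \<forall>l\<ge>R. \<forall>\<^sub>F n in sequentially. measure (PiM {..<n} (\<lambda>_. M n))
      {\<omega> \<in> space (PiM {..<n} (\<lambda>_. M n)). \<exists>b\<in>Basis. \<bar>X n \<omega> \<bullet> b\<bar> > l} \<le> \<epsilon>" if "\<epsilon> > 0" for \<epsilon>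
  proof -
    define K' where "K' = \<bar>K\<bar> + 1"
    have K': "K' > 0" by (simp add: K'_def)
    have "((\<lambda>l :: real. real DIM('b) * (2 * exp (- (l\<^sup>2 / (2 * K'\<^sup>2))))) \<longlongrightarrow> 0) at_top"
    proof -
      have "filterlim (\<lambda>l :: real. l\<^sup>2 * (1 / (2 * K'\<^sup>2))) at_top at_top"
        using K' by (intro filterlim_at_top_mult_tendsto_pos[OF tendsto_const] filterlim_pow_at_top filterlim_ident) auto
      then have "((\<lambda>l :: real. exp (- (l\<^sup>2 * (1 / (2 * K'\<^sup>2))))) \<longlongrightarrow> 0) at_top"
        by (intro filterlim_compose[OF exp_at_bot]) (simp add: filterlim_uminus_at_bot)
      then have "((\<lambda>l :: real. exp (- (l\<^sup>2 / (2 * K'\<^sup>2)))) \<longlongrightarrow> 0) at_top" by simp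
      then show ?thesis by (intro tendsto_mult_right_zero)
    qed
    from order_tendstoD(2)[OF this that] obtain R where
      R: "\<And>l. l \<ge> R \<Longrightarrow> real DIM('b) * (2 * exp (- (l\<^sup>2 / (2 * K'\<^sup>2)))) < \<epsilon>"
      by (auto simp: eventually_at_top_linorder)
    have "measure (PiM {..<n} (\<lambda>_. M n)) {\<omega> \<in> space (PiM {..<n} (\<lambda>_. M n)). \<exists>b\<in>Basis. \<bar>X n \<omega> \<bullet> b\<bar> > l} \<le> \<epsilon>"
      if l: "l \<ge> max R 0" and n: "n > 0" for l n
    proof -
      let ?P = "PiM {..<n} (\<lambda>_. M n)"
      interpret Pn: prob_space ?P by (rule P)
      note [measurable] = TY[OF n] X[of n]
      let ?S = "\<lambda>b. {\<omega> \<in> space ?P. \<bar>\<Sum>i<n. Y (T n (\<omega> i)) \<bullet> b\<bar> \<ge> l * sqrt (real n)}"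
      have Sm: "?S b \<in> sets ?P" for b by measurable
      \<comment> \<open>The threshold \<open>l * sqrt n\<close> cancels the factor \<open>n\<close>
        in the exponent, so the bound is uniform in \<open>n\<close>.\<close>
      have S: "measure ?P (?S b) \<le> 2 * exp (- (l\<^sup>2 / (2 * K'\<^sup>2)))" if b: "b \<in> Basis" for b
      proof -
        have "AE x in M n. \<bar>Y (T n x) \<bullet> b\<bar> \<le> K'"
          using AE_push[OF n bdt[of b]] by eventually_elim (use b in \<open>auto simp: K'_def inner_commute\<close>)
        moreover have "(\<integral>x. Y (T n x) \<bullet> b \<partial>M n) = 0"
          using push[OF n, of "\<lambda>x. Y x \<bullet> b"] mean[of b] by (simp add: inner_commute)
        ultimately have "measure ?P (?S b) \<le> 2 * exp (- ((l * sqrt (real n))\<^sup>2 / (2 * real n * K'\<^sup>2)))"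
          using l n K' by (intro PiM_sum_Hoeffding M) auto
        also have "(l * sqrt (real n))\<^sup>2 / (2 * real n * K'\<^sup>2) = l\<^sup>2 / (2 * K'\<^sup>2)"
          using n by (simp add: power_mult_distrib)
        finally show ?thesis .
      qed
      have "{\<omega> \<in> space ?P. \<exists>b\<in>Basis. \<bar>X n \<omega> \<bullet> b\<bar> > l} \<subseteq> (\<Union>b\<in>Basis. ?S b)"
      proof (safe, rule UN_I)
        fix \<omega> b assume \<omega>: "\<omega> \<in> space ?P" and "b \<in> Basis" and l': "l < \<bar>X n \<omega> \<bullet> b\<bar>"
        have "\<bar>X n \<omega> \<bullet> b\<bar> = \<bar>\<Sum>i<n. Y (T n (\<omega> i)) \<bullet> b\<bar> / sqrt (real n)"
          by (simp add: X_eq[OF n] inner_sum_left abs_mult)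
        then have "l < \<bar>\<Sum>i<n. Y (T n (\<omega> i)) \<bullet> b\<bar> / sqrt (real n)" using l' by simp
        then have "l * sqrt (real n) \<le> \<bar>\<Sum>i<n. Y (T n (\<omega> i)) \<bullet> b\<bar>"
          using n by (simp add: pos_less_divide_eq)
        then show "\<omega> \<in> ?S b" using \<omega> by simp
      qed
      then have "measure ?P {\<omega> \<in> space ?P. \<exists>b\<in>Basis. \<bar>X n \<omega> \<bullet> b\<bar> > l} \<le> measure ?P (\<Union>b\<in>Basis. ?S b)"
        using Sm by (intro Pn.finite_measure_mono sets.finite_UN) auto
      also have "\<dots> \<le> (\<Sum>b\<in>Basis. measure ?P (?S b))"
        using Sm by (intro Pn.finite_measure_subadditive_finite) auto
      also have "\<dots> \<le> (\<Sum>b\<in>(Basis :: 'b set). 2 * exp (- (l\<^sup>2 / (2 * K'\<^sup>2))))" by (intro sum_mono S)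
      also have "\<dots> \<le> \<epsilon>" using R[of l] l by simp
      finally show ?thesis .
    qed
    then show ?thesis
      by (intro exI[of _ "max R 0"]) (auto intro!: eventually_mono[OF eventually_gt_at_top[of 0]])
  qed
  show ?thesis
    unfolding asymp_normal_def
  proof (intro conjI allI X exI[of _ \<mu>] \<mu> impI)
    fix f :: "'b \<Rightarrow> real" assume "continuous_on UNIV f \<and> bounded (range f)"
    then show "(\<lambda>n. \<integral>\<omega>. f (X n \<omega>) \<partial>PiM {..<n} (\<lambda>_. M n)) \<longlonglongrightarrow> (\<integral>x. f x \<partial>\<mu>)"
      using \<mu> by (intro weak_convergence_charI P X char tight) (auto simp: is_centred_normal_def)
  qed
qed

section \<open>Moments of the uniform distribution on the sphere\<close>

lemma integrable_usphere:
  fixes f :: "real^'n \<Rightarrow> real"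
  assumes [measurable]: "f \<in> borel_measurable borel" and bd: "\<And>w. norm w = 1 \<Longrightarrow> \<bar>f w\<bar> \<le> B"
  shows "integrable usphere f"
proof -
  interpret prob_space "usphere :: (real^'n) measure" by (rule prob_space_usphere)
  show ?thesis
    by (rule integrable_const_bound[where B = B])
       (use AE_usphere_norm bd in \<open>auto elim!: eventually_mono\<close>)
qed

lemma integrable_usphere_inner4 [simp]:
  "integrable usphere (\<lambda>w :: real^'n. (a \<bullet> w) * (b \<bullet> w) * (c \<bullet> w) * (d \<bullet> w))"
proof (rule integrable_usphere)
  fix w :: "real^'n" assume w: "norm w = 1"
  have "\<bar>x \<bullet> w\<bar> \<le> norm x" for x using Cauchy_Schwarz_ineq2[of x w] w by simp
  then show "\<bar>(a \<bullet> w) * (b \<bullet> w) * (c \<bullet> w) * (d \<bullet> w)\<bar> \<le> norm a * norm b * norm c * norm d"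
    by (simp add: abs_mult mult_mono)
qed measurable

lemma integrable_usphere_inner2 [simp]:
  "integrable usphere (\<lambda>w :: real^'n. (a \<bullet> w) * (b \<bullet> w))"
proof (rule integrable_usphere)
  fix w :: "real^'n" assume w: "norm w = 1"
  have "\<bar>x \<bullet> w\<bar> \<le> norm x" for x using Cauchy_Schwarz_ineq2[of x w] w by simp
  then show "\<bar>(a \<bullet> w) * (b \<bullet> w)\<bar> \<le> norm a * norm b"
    by (simp add: abs_mult mult_mono)
qed measurable

text \<open>Some orthogonal map carries \<open>b\<close> to \<open>a\<close>; its transpose
  preserves the uniform law and can be moved across the inner product.\<close>

lemma usphere_inner_rotate:
  fixes a b :: "real^'n" and g :: "real \<Rightarrow> real"
  assumes ab: "norm a = norm b" and [measurable]: "g \<in> borel_measurable borel"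
  shows "(\<integral>w. g (a \<bullet> w) \<partial>usphere) = (\<integral>w. g (b \<bullet> w) \<partial>usphere)"
proof -
  obtain f where f: "orthogonal_transformation f" "f b = a"
    using orthogonal_transformation_exists[OF ab[symmetric]] by metis
  define Q where "Q = matrix f"
  have Q: "orthogonal_matrix Q" "Q *v b = a"
    using f orthogonal_transformation_matrix[of f] by (auto simp: Q_def orthogonal_transformation_def matrix_works)
  then have QT: "orthogonal_matrix (transpose Q)" by (simp add: orthogonal_matrix_transpose)
  have "(\<integral>w. g (b \<bullet> w) \<partial>usphere) = (\<integral>w. g (b \<bullet> w) \<partial>distr usphere borel ((*v) (transpose Q)))"
    by (simp add: usphere_orthogonal_invariant[OF QT])
  also have "\<dots> = (\<integral>w. g (b \<bullet> (transpose Q *v w)) \<partial>usphere)"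
    by (rule integral_distr) (simp_all del: transpose_matrix_vector)
  also have "\<dots> = (\<integral>w. g (a \<bullet> w) \<partial>usphere)"
  proof -
    have "b \<bullet> (transpose Q *v w) = a \<bullet> w" for w
      using Q(2) dot_lmul_matrix[of w Q b] by (simp add: inner_commute)
    then show ?thesis by simp
  qed
  finally show ?thesis ..
qed

lemma usphere_inner_power:
  fixes a u :: "real^'n"
  assumes "norm u = 1"
  shows "(\<integral>w. (a \<bullet> w) ^ k \<partial>usphere) = norm a ^ k * (\<integral>w. (u \<bullet> w) ^ k \<partial>usphere)"
proof -
  have "(\<integral>w. (a \<bullet> w) ^ k \<partial>usphere) = (\<integral>w. ((norm a *\<^sub>R u) \<bullet> w) ^ k \<partial>usphere)"
    by (rule usphere_inner_rotate) (simp_all add: assms)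
  then show ?thesis by (simp add: power_mult_distrib)
qed

lemma sum_axis_inner_sq: "(\<Sum>i\<in>UNIV. (axis i 1 \<bullet> w)\<^sup>2) = (norm (w :: real^'n))\<^sup>2"
  by (simp add: inner_axis' norm_vec_def L2_set_def sum_nonneg)

text \<open>Rotation invariance leaves a single constant \<open>c\<close> on the diagonal. Summing
  over the axes and using \<open>norm w = 1\<close> gives \<open>p * c = 1\<close>, and polarisation
  gives the mixed moments.\<close>

lemma usphere_inner2:
  fixes a b :: "real^'n"
  shows "(\<integral>w. (a \<bullet> w) * (b \<bullet> w) \<partial>usphere) = (a \<bullet> b) / real CARD('n)"
proof -
  interpret prob_space "usphere :: (real^'n) measure" by (rule prob_space_usphere)
  define u :: "real^'n" where "u = axis undefined 1"
  define c where "c = (\<integral>w. (u \<bullet> w)\<^sup>2 \<partial>usphere)"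
  have u: "norm u = 1" by (simp add: u_def)
  have sq: "(\<integral>w. (a \<bullet> w) * (a \<bullet> w) \<partial>usphere) = (norm a)\<^sup>2 * c" for a :: "real^'n"
    using usphere_inner_power[OF u, of a 2] by (simp add: c_def power2_eq_square)
  have "1 = (\<integral>w. (\<Sum>i\<in>UNIV. ((axis i 1 :: real^'n) \<bullet> w) * (axis i 1 \<bullet> w)) \<partial>usphere)"
  proof -
    have "(\<integral>w. (\<Sum>i\<in>UNIV. ((axis i 1 :: real^'n) \<bullet> w) * (axis i 1 \<bullet> w)) \<partial>usphere) = (\<integral>w. 1 \<partial>(usphere :: (real^'n) measure))"
    proof (intro integral_cong_AE)
      show "AE w in usphere. (\<Sum>i\<in>UNIV. ((axis i 1 :: real^'n) \<bullet> w) * (axis i 1 \<bullet> w)) = 1"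
        using AE_usphere_norm
      proof eventually_elim
        fix w :: "real^'n" assume "norm w = 1"
        then show "(\<Sum>i\<in>UNIV. ((axis i 1 :: real^'n) \<bullet> w) * (axis i 1 \<bullet> w)) = 1"
          using sum_axis_inner_sq[of w] by (simp add: power2_eq_square)
      qed
    qed simp_all
    then show ?thesis using prob_space by simp
  qed
  also have "\<dots> = (\<Sum>i\<in>(UNIV :: 'n set). (\<integral>w. ((axis i 1 :: real^'n) \<bullet> w) * (axis i 1 \<bullet> w) \<partial>usphere))"
    by (rule Bochner_Integration.integral_sum) simp
  also have "\<dots> = real CARD('n) * c" by (simp add: sq)
  finally have c: "c = 1 / real CARD('n)" by (simp add: field_simps)
  have "4 * (\<integral>w. (a \<bullet> w) * (b \<bullet> w) \<partial>usphere)
     = (\<integral>w. ((a + b) \<bullet> w) * ((a + b) \<bullet> w) - ((a - b) \<bullet> w) * ((a - b) \<bullet> w) \<partial>usphere)"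
    unfolding integral_mult_right_zero[symmetric]
    by (rule Bochner_Integration.integral_cong) (auto simp: inner_simps algebra_simps)
  also have "\<dots> = (norm (a + b))\<^sup>2 * c - (norm (a - b))\<^sup>2 * c"
    by (subst Bochner_Integration.integral_diff) (simp_all add: sq)
  also have "\<dots> = 4 * (a \<bullet> b) * c"
    by (simp add: power2_norm_eq_inner inner_simps algebra_simps inner_commute)
  finally show ?thesis by (simp add: c)
qed

text \<open>The fourth moment \<open>T\<close> is symmetric and multilinear, hence fixed by its
  diagonal, and rotation invariance makes the diagonal a multiple of
  \<open>(a \<bullet> a)^2\<close>. Polarising in stages recovers the sum over the three pairings;
  the spherical constraint then determines the constant.\<close>

lemma usphere_inner4:
  fixes a b c d :: "real^'n"
  defines "p \<equiv> real CARD('n)"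
  shows "(\<integral>w. (a \<bullet> w) * (b \<bullet> w) * (c \<bullet> w) * (d \<bullet> w) \<partial>usphere)
    = ((a \<bullet> b) * (c \<bullet> d) + (a \<bullet> c) * (b \<bullet> d) + (a \<bullet> d) * (b \<bullet> c)) / (p * (p + 2))"
proof -
  define T where "T a b c d = (\<integral>w. (a \<bullet> w) * (b \<bullet> w) * (c \<bullet> w) * (d \<bullet> w) \<partial>usphere)" for a b c d :: "real^'n"
  define u :: "real^'n" where "u = axis undefined 1"
  \<comment> \<open>Dividing by 3, the number of pairings of four slots, makes \<open>m\<close> the
    weight of each pairing.\<close>
  define m where "m = (\<integral>w. (u \<bullet> w) ^ 4 \<partial>usphere) / 3"
  have u: "norm u = 1" by (simp add: u_def)
  have T4: "T a a a a = 3 * m * (a \<bullet> a)\<^sup>2" for a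
  proof -
    have "T a a a a = (\<integral>w. (a \<bullet> w) ^ 4 \<partial>usphere)" unfolding T_def by (simp add: power4_eq_xxxx)
    also have "\<dots> = norm a ^ 4 * (3 * m)" using usphere_inner_power[OF u, of a 4] by (simp add: m_def)
    also have "norm a ^ 4 = (a \<bullet> a)\<^sup>2" by (simp add: power2_norm_eq_inner[symmetric])
    finally show ?thesis by simp
  qed
  have lin1: "T (a + b) c d e = T a c d e + T b c d e" "T (a - b) c d e = T a c d e - T b c d e" for a b c d e
    unfolding T_def by (simp_all add: inner_add_left inner_diff_left distrib_right left_diff_distrib)
  have comm: "T a b c d = T b a c d" "T a b c d = T a c b d" "T a b c d = T a b d c" for a b c d
    unfolding T_def by (simp_all add: mult_ac)
  have lin2: "T c (a + b) d e = T c a d e + T c b d e" "T c (a - b) d e = T c a d e - T c b d e" for a b c d e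
    using lin1 comm(1) by metis+
  have lin3: "T c d (a + b) e = T c d a e + T c d b e" "T c d (a - b) e = T c d a e - T c d b e" for a b c d e
    using lin2 comm(2) by metis+
  have lin4: "T c d e (a + b) = T c d e a + T c d e b" "T c d e (a - b) = T c d e a - T c d e b" for a b c d e
    using lin3 comm(3) by metis+
  note lin = lin1 lin2 lin3 lin4
  have T22: "T a a b b = m * ((a \<bullet> a) * (b \<bullet> b) + 2 * (a \<bullet> b)\<^sup>2)" for a b
  proof -
    have c: "T a b a b = T a a b b" "T a b b a = T a a b b" "T b a a b = T a a b b" "T b a b a = T a a b b" "T b b a a = T a a b b"
      using comm by metis+
    have "12 * T a a b b = T (a + b) (a + b) (a + b) (a + b) + T (a - b) (a - b) (a - b) (a - b) - 2 * T a a a a - 2 * T b b b b"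
      unfolding lin by (simp add: c)
    also have "\<dots> = 12 * (m * ((a \<bullet> a) * (b \<bullet> b) + 2 * (a \<bullet> b)\<^sup>2))"
      unfolding T4 by (simp add: inner_simps inner_commute[of b a] power2_eq_square algebra_simps)
    finally show ?thesis by simp
  qed
  have T112: "T a b c c = m * ((a \<bullet> b) * (c \<bullet> c) + 2 * (a \<bullet> c) * (b \<bullet> c))" for a b c
  proof -
    have "4 * T a b c c = T (a + b) (a + b) c c - T (a - b) (a - b) c c"
      unfolding lin by (simp add: comm(1)[of b a])
    also have "\<dots> = 4 * (m * ((a \<bullet> b) * (c \<bullet> c) + 2 * (a \<bullet> c) * (b \<bullet> c)))"
      unfolding T22 by (simp add: inner_simps inner_commute[of b a] power2_eq_square algebra_simps)
    finally show ?thesis by simp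
  qed
  have T1111: "T a b c d = m * ((a \<bullet> b) * (c \<bullet> d) + (a \<bullet> c) * (b \<bullet> d) + (a \<bullet> d) * (b \<bullet> c))"
  proof -
    have "4 * T a b c d = T a b (c + d) (c + d) - T a b (c - d) (c - d)"
      unfolding lin by (simp add: comm(3)[of a b d c])
    also have "\<dots> = 4 * (m * ((a \<bullet> b) * (c \<bullet> d) + (a \<bullet> c) * (b \<bullet> d) + (a \<bullet> d) * (b \<bullet> c)))"
      unfolding T112 by (simp add: inner_simps inner_commute[of d c] power2_eq_square algebra_simps)
    finally show ?thesis by simp
  qed
  \<comment> \<open>Summing the first two slots over the axes inserts \<open>|w|^2 = 1\<close> into
    a second moment, which is \<open>1 / p\<close>; the pairing formula gives
    \<open>m * (p + 2)\<close> for the same sum.\<close>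
  have "1 / p = (\<integral>w. (u \<bullet> w) * (u \<bullet> w) \<partial>usphere)"
    using u by (simp add: usphere_inner2 p_def power2_norm_eq_inner[symmetric])
  also have "\<dots> = (\<integral>w. (\<Sum>i\<in>UNIV. (axis i 1 \<bullet> w) * (axis i 1 \<bullet> w) * (u \<bullet> w) * (u \<bullet> w)) \<partial>usphere)"
  proof (intro integral_cong_AE)
    show "AE w in usphere. (u \<bullet> w) * (u \<bullet> w) = (\<Sum>i\<in>UNIV. (axis i 1 \<bullet> w) * (axis i 1 \<bullet> w) * (u \<bullet> w) * (u \<bullet> w))"
      using AE_usphere_norm
    proof eventually_elim
      fix w :: "real^'n" assume "norm w = 1"
      then show "(u \<bullet> w) * (u \<bullet> w) = (\<Sum>i\<in>UNIV. (axis i 1 \<bullet> w) * (axis i 1 \<bullet> w) * (u \<bullet> w) * (u \<bullet> w))"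
        using sum_axis_inner_sq[of w] by (simp add: sum_distrib_right[symmetric] power2_eq_square)
    qed
  qed simp_all
  also have "\<dots> = (\<Sum>i\<in>UNIV. T (axis i 1) (axis i 1) u u)"
    unfolding T_def by (rule Bochner_Integration.integral_sum) simp
  also have "\<dots> = (\<Sum>i\<in>(UNIV :: 'n set). m * (1 + 2 * (axis i 1 \<bullet> u)\<^sup>2))"
    using u by (simp add: T22 power2_norm_eq_inner[symmetric])
  also have "\<dots> = m * (p + 2)"
    using sum_axis_inner_sq[of u] u by (simp add: sum_distrib_left[symmetric] sum.distrib p_def)
  finally have eq: "1 / p = m * (p + 2)" .
  have "p + 2 \<noteq> 0" by (simp add: p_def)
  then have "m = (1 / p) / (p + 2)" unfolding eq by simp
  then have "m = 1 / (p * (p + 2))" by simp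
  then show ?thesis using T1111 by (simp add: T_def)
qed

lemma quadratic_form_expand:
  "w \<bullet> (T *v w) = (\<Sum>i\<in>UNIV. (axis i 1 \<bullet> w) * (T $ i \<bullet> (w :: real^'n)))"
proof -
  have "(T *v w) $ i = T $ i \<bullet> w" for i by (simp add: matrix_vector_mult_def inner_vec_def)
  then show ?thesis by (subst inner_vec_def) (simp add: inner_axis')
qed

lemma usphere_quadratic_form:
  fixes T :: "real^'n^'n"
  shows "(\<integral>w. w \<bullet> (T *v w) \<partial>usphere) = trace T / real CARD('n)"
proof -
  have "(\<integral>w. w \<bullet> (T *v w) \<partial>usphere) = (\<Sum>i\<in>UNIV. \<integral>w. (axis i 1 \<bullet> w) * (T $ i \<bullet> w) \<partial>usphere)"
    unfolding quadratic_form_expand by (rule Bochner_Integration.integral_sum) (rule integrable_usphere_inner2)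
  also have "\<dots> = (\<Sum>i\<in>UNIV. (axis i 1 \<bullet> T $ i) / real CARD('n))" by (simp only: usphere_inner2)
  finally show ?thesis by (simp add: trace_def inner_axis' sum_divide_distrib)
qed

text \<open>The square expands into fourth moments in \<open>axis i 1\<close>, row \<open>i\<close>
  of \<open>T\<close>, \<open>axis k 1\<close> and row \<open>k\<close> of \<open>T\<close>. The
  three pairings produce the squared trace, the squared Frobenius norm and the trace of
  \<open>T ** T\<close>, in this order.\<close>

lemma usphere_quadratic_form_sq:
  fixes T :: "real^'n^'n"
  defines "p \<equiv> real CARD('n)"
  shows "(\<integral>w. (w \<bullet> (T *v w))\<^sup>2 \<partial>usphere)
     = ((trace T)\<^sup>2 + (\<Sum>i\<in>UNIV. \<Sum>k\<in>UNIV. (T $ i $ k)\<^sup>2) + (\<Sum>i\<in>UNIV. \<Sum>k\<in>UNIV. T $ i $ k * T $ k $ i)) / (p * (p + 2))"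
proof -
  have "(w \<bullet> (T *v w))\<^sup>2 = (\<Sum>i\<in>UNIV. \<Sum>k\<in>UNIV. (axis i 1 \<bullet> w) * (T $ i \<bullet> w) * (axis k 1 \<bullet> w) * (T $ k \<bullet> w))" for w
    unfolding quadratic_form_expand power2_eq_square sum_product by (simp add: mult.assoc)
  then have "(\<integral>w. (w \<bullet> (T *v w))\<^sup>2 \<partial>usphere)
     = (\<Sum>i\<in>UNIV. \<Sum>k\<in>UNIV. (\<integral>w. (axis i 1 \<bullet> w) * (T $ i \<bullet> w) * (axis k 1 \<bullet> w) * (T $ k \<bullet> w) \<partial>usphere))"
    by (simp only: Bochner_Integration.integral_sum Bochner_Integration.integrable_sum integrable_usphere_inner4)
  also have "\<dots> = (\<Sum>i\<in>UNIV. \<Sum>k\<in>UNIV. ((axis i 1 \<bullet> T $ i) * (axis k 1 \<bullet> T $ k) + ((axis i 1 :: real^'n) \<bullet> axis k 1) * (T $ i \<bullet> T $ k)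
      + (axis i 1 \<bullet> T $ k) * (T $ i \<bullet> axis k 1)) / (p * (p + 2)))"
    by (simp only: usphere_inner4 p_def)
  also have "\<dots> = (\<Sum>i\<in>UNIV. \<Sum>k\<in>UNIV. (T $ i $ i * T $ k $ k + (if i = k then T $ i \<bullet> T $ k else 0) + T $ k $ i * T $ i $ k) / (p * (p + 2)))"
  proof -
    have "axis i 1 $ k = (if i = k then 1 else 0 :: real)" for i k :: 'n by (simp add: axis_def)
    then show ?thesis by (intro sum.cong refl) (auto simp: inner_axis' inner_axis)
  qed
  also have "\<dots> = ((\<Sum>i\<in>UNIV. \<Sum>k\<in>UNIV. T $ i $ i * T $ k $ k) + (\<Sum>i\<in>UNIV. T $ i \<bullet> T $ i) + (\<Sum>i\<in>UNIV. \<Sum>k\<in>UNIV. T $ k $ i * T $ i $ k)) / (p * (p + 2))"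
    by (simp add: sum_divide_distrib[symmetric] sum.distrib)
  finally show ?thesis
    by (simp add: trace_def power2_eq_square sum_product inner_vec_def mult.commute)
qed

section \<open>Spiked matrices and their angular Gaussian laws\<close>

lemma symmetric_matrix_inner:
  fixes A :: "real^'n^'n"
  assumes "transpose A = A"
  shows "x \<bullet> (A *v y) = (A *v x) \<bullet> y"
proof -
  have "A *v x = x v* A" using transpose_matrix_vector[of A x] assms by simp
  then show ?thesis by (simp add: dot_lmul_matrix)
qed

lemma trace_eq_sum_axis:
  fixes A :: "real^'n^'n"
  shows "trace A = (\<Sum>i\<in>UNIV. axis i 1 \<bullet> (A *v axis i 1))"
  by (simp add: trace_def matrix_vector_mult_basis column_def inner_axis')

text \<open>For \<open>D = R - S\<close> one has \<open>R D + D S = R R - S S = 0\<close>.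
  Multiplying by \<open>D\<close> and taking the trace yields a vanishing sum of the nonnegative
  numbers \<open>(D e_i) \<bullet> (R + S) (D e_i)\<close>, so \<open>D\<close> kills every axis.
  This justifies the definite description in \<open>inv_sqrt_mat\<close> without
  diagonalisation.\<close>

lemma posdef_sqrt_unique:
  fixes R S :: "real^'n^'n"
  assumes R: "posdef R" and S: "posdef S" and eq: "R ** R = S ** S"
  shows "R = S"
proof -
  define D where "D = R - S"
  have sym: "transpose R = R" "transpose S = S" using R S by (auto simp: posdef_def)
  have D: "transpose D = D" using sym by (simp add: D_def transpose_def vec_eq_iff)
  have pd: "x \<bullet> (R *v x) + x \<bullet> (S *v x) > 0" if "x \<noteq> 0" for x
    using R S that by (auto simp: posdef_def add_pos_pos)
  have nn: "x \<bullet> (R *v x) + x \<bullet> (S *v x) \<ge> 0" for x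
    using pd[of x] by (cases "x = 0") auto
  have "R *v (R *v x) = S *v (S *v x)" for x
    using eq by (simp add: matrix_vector_mul_assoc)
  then have z: "R ** D + D ** S = 0"
    unfolding matrix_eq D_def
    by (simp add: matrix_vector_mult_add_rdistrib matrix_vector_mul_assoc[symmetric]
        matrix_vector_mult_diff_rdistrib matrix_vector_mult_diff_distrib)
  have "trace (D ** (R ** D + D ** S)) = 0"
    unfolding z by (simp add: trace_def matrix_matrix_mult_def)
  then have "trace (D ** (R ** D)) + trace (D ** (D ** S)) = 0"
    by (simp add: matrix_add_ldistrib trace_add)
  also have "trace (D ** (D ** S)) = trace (D ** (S ** D))"
    by (metis matrix_mul_assoc trace_mul_sym)
  also have "trace (D ** (R ** D)) + trace (D ** (S ** D))
     = (\<Sum>i\<in>UNIV. (D *v axis i 1) \<bullet> (R *v (D *v axis i 1)) + (D *v axis i 1) \<bullet> (S *v (D *v axis i 1)))"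
    unfolding trace_eq_sum_axis
    by (simp add: matrix_vector_mul_assoc[symmetric] symmetric_matrix_inner[OF D] sum.distrib)
  finally have "(D *v axis i 1) \<bullet> (R *v (D *v axis i 1)) + (D *v axis i 1) \<bullet> (S *v (D *v axis i 1)) = 0" for i
    using nn by (subst (asm) sum_nonneg_eq_0_iff) auto
  then have "D *v axis i 1 = 0" for i using pd less_irrefl by metis
  then have "D = 0" by (simp add: matrix_vector_mult_basis column_def vec_eq_iff)
  then show ?thesis by (simp add: D_def)
qed

lemma matrix_inv_eqI:
  fixes A B :: "real^'n^'n"
  assumes "A ** B = mat 1" "B ** A = mat 1"
  shows "matrix_inv A = B"
proof -
  have "invertible A" using assms by (auto simp: invertible_def)
  then have "A ** matrix_inv A = mat 1 \<and> matrix_inv A ** A = mat 1"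
    unfolding matrix_inv_def invertible_def by (rule someI_ex)
  then show ?thesis by (metis assms(2) matrix_mul_assoc matrix_mul_lid matrix_mul_rid)
qed

text \<open>With two free coefficients and a fixed unit vector the family is closed under products,
  inverses and square roots, unlike the shapes of trace \<open>p\<close>, so matrix computations
  reduce to those on the eigenvalues \<open>a + b\<close> and \<open>a\<close>.\<close>

definition spike :: "real \<Rightarrow> real \<Rightarrow> real^'n \<Rightarrow> real^'n^'n" where
  "spike a b \<theta> = a *\<^sub>R mat 1 + b *\<^sub>R outer \<theta> \<theta>"

lemma outer_mult: "outer x y *v z = (y \<bullet> z) *\<^sub>R x"
  by (simp add: outer_def matrix_vector_mult_def vec_eq_iff inner_vec_def sum_distrib_left mult_ac)

lemma spike_mult_vec: "spike a b \<theta> *v x = a *\<^sub>R x + (b * (\<theta> \<bullet> x)) *\<^sub>R \<theta>"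
  by (simp add: spike_def matrix_vector_mult_add_rdistrib scaleR_matrix_vector_assoc[symmetric] outer_mult)

lemma transpose_spike: "transpose (spike a b \<theta>) = spike a b \<theta>"
  by (simp add: spike_def transpose_def outer_def mat_def vec_eq_iff mult.commute)

lemma spike_mult:
  assumes "norm \<theta> = 1"
  shows "spike a b \<theta> ** spike a' b' \<theta> = spike (a * a') (a * b' + b * a' + b * b') \<theta>"
  unfolding matrix_eq using assms
  by (simp add: matrix_vector_mul_assoc[symmetric] spike_mult_vec inner_simps algebra_simps norm_eq_1)

lemma spike_one [simp]: "spike 1 0 \<theta> = mat 1"
  by (simp add: spike_def)

lemma spike_inner: "x \<bullet> (spike a b \<theta> *v y) = a * (x \<bullet> y) + b * (\<theta> \<bullet> x) * (\<theta> \<bullet> y)"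
  by (simp add: spike_mult_vec inner_simps inner_commute)

lemma posdef_spike:
  fixes \<theta> :: "real^'n"
  assumes \<theta>: "norm \<theta> = 1" and "a > 0" "a + b > 0"
  shows "posdef (spike a b \<theta>)"
  unfolding posdef_def
proof (intro conjI allI impI transpose_spike)
  fix x :: "real^'n" assume x: "x \<noteq> 0"
  have cs: "(\<theta> \<bullet> x)\<^sup>2 \<le> (norm x)\<^sup>2" using Cauchy_Schwarz_ineq[of \<theta> x] \<theta> by (simp add: power2_norm_eq_inner norm_eq_1)
  have "x \<bullet> (spike a b \<theta> *v x) = a * ((norm x)\<^sup>2 - (\<theta> \<bullet> x)\<^sup>2) + (a + b) * (\<theta> \<bullet> x)\<^sup>2"
    unfolding spike_inner power2_norm_eq_inner by (simp add: power2_eq_square algebra_simps)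
  also have "\<dots> > 0"
  proof (cases "\<theta> \<bullet> x = 0")
    case False
    then have "(a + b) * (\<theta> \<bullet> x)\<^sup>2 > 0" using assms by simp
    moreover have "a * ((norm x)\<^sup>2 - (\<theta> \<bullet> x)\<^sup>2) \<ge> 0" using cs assms by simp
    ultimately show ?thesis by linarith
  qed (use x assms in simp)
  finally show "0 < x \<bullet> (spike a b \<theta> *v x)" .
qed

text \<open>The form is tested on \<open>\<theta>\<close> and on a nonzero vector orthogonal to it;
  the latter exists because the dimension is at least two.\<close>

lemma posdef_spikeD:
  fixes \<theta> :: "real^'n"
  assumes p: "posdef (spike a b \<theta>)" and \<theta>: "norm \<theta> = 1" and "CARD('n) \<ge> 2"
  shows "a > 0" "a + b > 0"
proof -
  have "\<theta> \<noteq> 0" using \<theta> by auto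
  then have "\<theta> \<bullet> (spike a b \<theta> *v \<theta>) > 0" using p by (simp add: posdef_def)
  then show "a + b > 0" using \<theta> by (simp add: spike_inner norm_eq_1)
  obtain x where x: "x \<noteq> 0" "orthogonal \<theta> x"
    using orthogonal_to_vector_exists[of \<theta>] assms(3) by auto
  then have "x \<bullet> (spike a b \<theta> *v x) > 0" using p by (simp add: posdef_def)
  then have "a * (x \<bullet> x) > 0" using x by (simp add: spike_inner orthogonal_def)
  moreover have "x \<bullet> x > 0" using x by simp
  ultimately show "a > 0" by (rule zero_less_mult_pos2)
qed

text \<open>\<open>spike l (m - l) \<theta>\<close> has eigenvalue \<open>m\<close> on the line of \<open>\<theta>\<close> and \<open>l\<close> on its orthogonal complement.\<close>
lemma spike_mult_eigen:
  assumes "norm \<theta> = 1"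
  shows "spike l (m - l) \<theta> ** spike l' (m' - l') \<theta> = spike (l * l') (m * m' - l * l') \<theta>"
  by (simp add: spike_mult[OF assms] algebra_simps)

definition spike_sqrt :: "real \<Rightarrow> real \<Rightarrow> real^'n \<Rightarrow> real^'n^'n" where
  "spike_sqrt a b \<theta> = spike (sqrt a) (sqrt (a + b) - sqrt a) \<theta>"

definition spike_isqrt :: "real \<Rightarrow> real \<Rightarrow> real^'n \<Rightarrow> real^'n^'n" where
  "spike_isqrt a b \<theta> = spike (1 / sqrt a) (1 / sqrt (a + b) - 1 / sqrt a) \<theta>"

lemma
  fixes \<theta> :: "real^'n"
  assumes a: "a > 0" and ab: "a + b > 0" and \<theta>: "norm \<theta> = 1"
  shows spike_sqrt_sq: "spike_sqrt a b \<theta> ** spike_sqrt a b \<theta> = spike a b \<theta>"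
    and spike_sqrt_isqrt: "spike_sqrt a b \<theta> ** spike_isqrt a b \<theta> = mat 1"
    and spike_isqrt_sqrt: "spike_isqrt a b \<theta> ** spike_sqrt a b \<theta> = mat 1"
    and matrix_inv_spike: "matrix_inv (spike a b \<theta>) = spike (1 / a) (1 / (a + b) - 1 / a) \<theta>"
    and inv_sqrt_mat_spike: "inv_sqrt_mat (spike a b \<theta>) = spike_isqrt a b \<theta>"
    and spike_isqrt_quadratic: "x \<bullet> (matrix_inv (spike a b \<theta>) *v x) = (norm (spike_isqrt a b \<theta> *v x))\<^sup>2"
    and det_spike_sqrt: "det (spike a b \<theta>) = (det (spike_sqrt a b \<theta>))\<^sup>2"
proof -
  have nz: "sqrt a \<noteq> 0" "sqrt (a + b) \<noteq> 0" using a ab by simp_all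
  show sq: "spike_sqrt a b \<theta> ** spike_sqrt a b \<theta> = spike a b \<theta>"
    unfolding spike_sqrt_def spike_mult_eigen[OF \<theta>] using a ab by simp
  show "spike_sqrt a b \<theta> ** spike_isqrt a b \<theta> = mat 1" "spike_isqrt a b \<theta> ** spike_sqrt a b \<theta> = mat 1"
    unfolding spike_sqrt_def spike_isqrt_def spike_mult_eigen[OF \<theta>] using nz by simp_all
  \<comment> \<open>Exhibits the eigenvalues \<open>a\<close> and \<open>a + b\<close> in the
    pattern of \<open>spike_mult_eigen\<close>.\<close>
  have ba: "spike a b \<theta> = spike a ((a + b) - a) \<theta>" by simp
  show inv: "matrix_inv (spike a b \<theta>) = spike (1 / a) (1 / (a + b) - 1 / a) \<theta>"
    by (rule matrix_inv_eqI; subst ba; subst spike_mult_eigen[OF \<theta>]) (use a ab in simp_all)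
  have R: "posdef (spike_isqrt a b \<theta>)"
    unfolding spike_isqrt_def using a ab by (intro posdef_spike \<theta>) simp_all
  have RR: "spike_isqrt a b \<theta> ** spike_isqrt a b \<theta> = matrix_inv (spike a b \<theta>)"
    unfolding inv spike_isqrt_def spike_mult_eigen[OF \<theta>] using a ab by simp
  show "inv_sqrt_mat (spike a b \<theta>) = spike_isqrt a b \<theta>"
    unfolding inv_sqrt_mat_def
  proof (rule the_equality)
    show "posdef (spike_isqrt a b \<theta>) \<and> spike_isqrt a b \<theta> ** spike_isqrt a b \<theta> = matrix_inv (spike a b \<theta>)"
      using R RR by simp
    show "S = spike_isqrt a b \<theta>" if "posdef S \<and> S ** S = matrix_inv (spike a b \<theta>)" for S
      by (rule posdef_sqrt_unique[OF _ R]) (use that RR in auto)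
  qed
  show "x \<bullet> (matrix_inv (spike a b \<theta>) *v x) = (norm (spike_isqrt a b \<theta> *v x))\<^sup>2"
  proof -
    have "x \<bullet> (spike_isqrt a b \<theta> *v (spike_isqrt a b \<theta> *v x)) = (spike_isqrt a b \<theta> *v x) \<bullet> (spike_isqrt a b \<theta> *v x)"
      using R by (intro symmetric_matrix_inner) (simp add: posdef_def)
    then show ?thesis by (simp only: RR[symmetric] matrix_vector_mul_assoc[symmetric] power2_norm_eq_inner)
  qed
  show "det (spike a b \<theta>) = (det (spike_sqrt a b \<theta>))\<^sup>2"
    unfolding sq[symmetric] det_mul by (simp add: power2_eq_square)
qed

text \<open>An orthogonal map carrying one vector to the other conjugates the matrices. The null and
  the alternative shape therefore have equal determinants, and the normalising constants cancel in
  the likelihood ratio.\<close>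

lemma det_spike_cong:
  fixes \<theta> \<theta>' :: "real^'n"
  assumes "norm \<theta> = norm \<theta>'"
  shows "det (spike a b \<theta>) = det (spike a b \<theta>')"
proof -
  obtain f where f: "orthogonal_transformation f" "f \<theta> = \<theta>'"
    using orthogonal_transformation_exists[OF assms] by metis
  define Q where "Q = matrix f"
  have Q: "orthogonal_matrix Q" "Q *v \<theta> = \<theta>'"
    using f orthogonal_transformation_matrix[of f] by (auto simp: Q_def orthogonal_transformation_def matrix_works)
  then have QQ: "Q ** transpose Q = mat 1" by (simp add: orthogonal_matrix_def)
  have adj: "\<theta> \<bullet> (transpose Q *v x) = \<theta>' \<bullet> x" for x
    using Q(2) dot_lmul_matrix[of x Q \<theta>] by (simp add: inner_commute)
  have "Q ** spike a b \<theta> ** transpose Q = spike a b \<theta>'"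
    unfolding matrix_eq
  proof
    fix x
    have "(Q ** spike a b \<theta> ** transpose Q) *v x = Q *v (a *\<^sub>R (transpose Q *v x) + (b * (\<theta>' \<bullet> x)) *\<^sub>R \<theta>)"
      by (simp only: matrix_vector_mul_assoc[symmetric] spike_mult_vec adj)
    also have "\<dots> = a *\<^sub>R ((Q ** transpose Q) *v x) + (b * (\<theta>' \<bullet> x)) *\<^sub>R \<theta>'"
      by (simp only: matrix_vector_right_distrib matrix_vector_mult_scaleR matrix_vector_mul_assoc Q(2))
    finally show "(Q ** spike a b \<theta> ** transpose Q) *v x = spike a b \<theta>' *v x"
      by (simp only: QQ spike_mult_vec matrix_vector_mul_lid)
  qed
  then have "det (spike a b \<theta>') = det Q * det (spike a b \<theta>) * det Q"
    by (simp only: det_mul det_transpose flip: \<open>Q ** spike a b \<theta> ** transpose Q = spike a b \<theta>'\<close>)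
  then have "det (spike a b \<theta>') = (det Q)\<^sup>2 * det (spike a b \<theta>)"
    by (simp add: power2_eq_square)
  moreover have "(det Q)\<^sup>2 = 1" using det_orthogonal_matrix[OF Q(1)] by auto
  ultimately show ?thesis by simp
qed

section \<open>Likelihood ratios between spiked angular Gaussian laws\<close>

lemma
  fixes \<theta> :: "real^'n"
  assumes "a > 0" "a + b > 0" "norm \<theta> = 1"
  shows prob_space_angular_gaussian_spike: "prob_space (angular_gaussian (spike a b \<theta>))"
    and distr_angular_gaussian_spike:
      "distr (angular_gaussian (spike a b \<theta>)) borel (\<lambda>u. sgn (spike_isqrt a b \<theta> *v u)) = usphere"
proof -
  have ag: "angular_gaussian (spike a b \<theta>) = distr usphere borel (\<lambda>w. sgn (spike_sqrt a b \<theta> *v w))"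
    using assms by (intro angular_gaussian_eq_distr_usphere[where R = "spike_isqrt a b \<theta>"]
      spike_sqrt_isqrt spike_isqrt_sqrt spike_isqrt_quadratic det_spike_sqrt)
  show "prob_space (angular_gaussian (spike a b \<theta>))"
    unfolding ag by (rule prob_space.prob_space_distr[OF prob_space_usphere]) simp
  show "distr (angular_gaussian (spike a b \<theta>)) borel (\<lambda>u. sgn (spike_isqrt a b \<theta> *v u)) = usphere"
    by (rule distr_angular_gaussian_standardize[OF _ _ ag]) (use assms spike_sqrt_isqrt spike_isqrt_sqrt in auto)
qed

lemma sets_angular_gaussian [simp, measurable_cong]: "sets (angular_gaussian V) = sets borel"
  and space_angular_gaussian [simp]: "space (angular_gaussian V) = UNIV"
  by (simp_all add: angular_gaussian_def surface_sphere_def space_scale_measure)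

lemma sets_surface_sphere [simp, measurable_cong]: "sets surface_sphere = sets borel"
  by (simp add: surface_sphere_def)

lemma borel_measurable_ag_density [measurable]: "ag_density V \<in> borel_measurable borel"
  unfolding ag_density_def by measurable

lemma sets_borel_sphere [measurable]: "sphere (x :: 'a::euclidean_space) r \<in> sets borel"
  by (simp add: borel_closed)

lemma AE_angular_gaussian_norm: "AE u in angular_gaussian V. norm u = 1"
proof -
  have "(\<lambda>u. ennreal (ag_density V u) * indicator (sphere 0 1) u) \<in> borel_measurable surface_sphere"
    by measurable
  moreover have "AE u in surface_sphere. 0 < ennreal (ag_density V u) * indicator (sphere 0 1) u \<longrightarrow> norm u = 1"
    by (rule AE_I2) (auto simp: indicator_def split: if_splits)
  ultimately show ?thesis unfolding angular_gaussian_def by (simp add: AE_density)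
qed

text \<open>For \<open>w\<close> on the sphere, \<open>1 - spike_dev a b \<nu> \<theta> \<tau> w\<close> is the quadratic form of
  \<open>V\<^sub>0\<^sup>1\<^sup>/\<^sup>2 V\<^sub>1\<^sup>-\<^sup>1 V\<^sub>0\<^sup>1\<^sup>/\<^sup>2\<close> at \<open>w\<close>; the shapes have equal determinants, so each
  observation contributes \<open>- p / 2 * ln (1 - spike_dev \<dots>)\<close> to the log-likelihood ratio.\<close>
definition spike_dev :: "real \<Rightarrow> real \<Rightarrow> real \<Rightarrow> real^'n \<Rightarrow> real^'n \<Rightarrow> real^'n \<Rightarrow> real" where
  "spike_dev a b \<nu> \<theta> \<tau> w = b / (a * (a + b)) * (2 * \<nu> * sqrt (a + b) * (\<theta> \<bullet> w) * ((spike_sqrt a b \<theta> *v \<tau>) \<bullet> w)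
     + \<nu>\<^sup>2 * ((spike_sqrt a b \<theta> *v \<tau>) \<bullet> w)\<^sup>2)"

lemma spike_sqrt_theta:
  assumes "norm \<theta> = 1"
  shows "spike_sqrt a b \<theta> *v \<theta> = sqrt (a + b) *\<^sub>R \<theta>"
  using assms by (simp add: spike_sqrt_def spike_mult_vec norm_eq_1 scaleR_left_distrib[symmetric])

text \<open>The inverse shape is the identity times \<open>1 / a\<close> minus a rank-one term with
  coefficient \<open>b / (a * (a + b))\<close>. The terms without \<open>\<nu>\<close> add up to 1
  for unit \<open>w\<close>, because for \<open>\<nu> = 0\<close> the square roots cancel the
  inverse; the other terms form \<open>spike_dev\<close>.\<close>

lemma spike_dev_eq:
  fixes \<theta> \<tau> w :: "real^'n"
  assumes a: "a > 0" and ab: "a + b > 0" and \<theta>: "norm \<theta> = 1" and \<theta>': "norm (\<theta> + \<nu> *\<^sub>R \<tau>) = 1" and w: "norm w = 1"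
  shows "1 - spike_dev a b \<nu> \<theta> \<tau> w
    = (spike_sqrt a b \<theta> *v w) \<bullet> (matrix_inv (spike a b (\<theta> + \<nu> *\<^sub>R \<tau>)) *v (spike_sqrt a b \<theta> *v w))"
proof -
  let ?A = "spike_sqrt a b \<theta>" and ?c = "b / (a * (a + b))" and ?\<theta>' = "\<theta> + \<nu> *\<^sub>R \<tau>"
  have symA: "x \<bullet> (?A *v y) = (?A *v x) \<bullet> y" for x y
    by (rule symmetric_matrix_inner) (simp add: spike_sqrt_def transpose_spike)
  have c: "1 / (a + b) - 1 / a = - ?c" using a ab by (simp add: field_simps)
  have "(?A *v w) \<bullet> (?A *v w) = w \<bullet> (spike a b \<theta> *v w)"
    by (simp add: symA[symmetric] matrix_vector_mul_assoc spike_sqrt_sq[OF a ab \<theta>])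
  also have "\<dots> = a + b * (\<theta> \<bullet> w)\<^sup>2"
    using w by (simp add: spike_inner norm_eq_1 power2_eq_square)
  finally have AA: "(?A *v w) \<bullet> (?A *v w) = a + b * (\<theta> \<bullet> w)\<^sup>2" .
  have \<theta>A: "?\<theta>' \<bullet> (?A *v w) = sqrt (a + b) * (\<theta> \<bullet> w) + \<nu> * ((?A *v \<tau>) \<bullet> w)"
    by (simp add: symA matrix_vector_right_distrib matrix_vector_mult_scaleR spike_sqrt_theta[OF \<theta>] inner_simps)
  have "(?A *v w) \<bullet> (matrix_inv (spike a b ?\<theta>') *v (?A *v w))
      = (a + b * (\<theta> \<bullet> w)\<^sup>2) / a - ?c * (sqrt (a + b) * (\<theta> \<bullet> w) + \<nu> * ((?A *v \<tau>) \<bullet> w))\<^sup>2"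
    unfolding matrix_inv_spike[OF a ab \<theta>'] spike_inner c AA \<theta>A by (simp add: power2_eq_square)
  also have "(sqrt (a + b) * (\<theta> \<bullet> w) + \<nu> * ((?A *v \<tau>) \<bullet> w))\<^sup>2 = (a + b) * (\<theta> \<bullet> w)\<^sup>2
      + (2 * \<nu> * sqrt (a + b) * (\<theta> \<bullet> w) * ((?A *v \<tau>) \<bullet> w) + \<nu>\<^sup>2 * ((?A *v \<tau>) \<bullet> w)\<^sup>2)"
    using ab by (simp add: power2_sum power_mult_distrib)
  also have "(a + b * (\<theta> \<bullet> w)\<^sup>2) / a - ?c * \<dots> = 1 - spike_dev a b \<nu> \<theta> \<tau> w"
  proof -
    have "?c * (a + b) = b / a" using ab by simp
    then have "?c * ((a + b) * (\<theta> \<bullet> w)\<^sup>2) = b * (\<theta> \<bullet> w)\<^sup>2 / a" by (metis mult.assoc times_divide_eq_left)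
    then show ?thesis using a by (simp only: spike_dev_def distrib_left) (simp add: add_divide_distrib)
  qed
  finally show ?thesis ..
qed

text \<open>If \<open>w\<close> is the direction of \<open>R u\<close>, then \<open>u\<close> is
  \<open>norm (R u)\<close> times \<open>A w\<close>. Hence the alternative quadratic form at
  \<open>u\<close> divided by the null one is \<open>1 - spike_dev\<close> at
  \<open>w\<close>.\<close>

lemma density_angular_gaussian_spike:
  fixes \<theta> \<tau> :: "real^'n"
  assumes a: "a > 0" and ab: "a + b > 0" and \<theta>: "norm \<theta> = 1" and \<theta>': "norm (\<theta> + \<nu> *\<^sub>R \<tau>) = 1"
  shows "density (angular_gaussian (spike a b \<theta>))
      (\<lambda>u. ennreal ((1 - spike_dev a b \<nu> \<theta> \<tau> (sgn (spike_isqrt a b \<theta> *v u))) powr (- (real CARD('n) / 2))))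
    = angular_gaussian (spike a b (\<theta> + \<nu> *\<^sub>R \<tau>))"
proof -
  let ?A = "spike_sqrt a b \<theta>" and ?R = "spike_isqrt a b \<theta>" and ?\<theta>' = "\<theta> + \<nu> *\<^sub>R \<tau>"
  let ?r = "\<lambda>u. (1 - spike_dev a b \<nu> \<theta> \<tau> (sgn (?R *v u))) powr (- (real CARD('n) / 2))"
  have AR: "?A *v (?R *v u) = u" for u
    by (simp add: matrix_vector_mul_assoc spike_sqrt_isqrt[OF a ab \<theta>])
  have eq: "ag_density (spike a b \<theta>) u * ?r u = ag_density (spike a b ?\<theta>') u" if u: "norm u = 1" for u
  proof -
    let ?q = "u \<bullet> (matrix_inv (spike a b ?\<theta>') *v u)" and ?s = "(norm (?R *v u))\<^sup>2"
    have Ru: "?R *v u \<noteq> 0" using AR[of u] u by auto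
    then have s: "?s > 0" by simp
    have q: "?q \<ge> 0" by (simp add: spike_isqrt_quadratic[OF a ab \<theta>'])
    have "?A *v sgn (?R *v u) = u /\<^sub>R norm (?R *v u)"
      by (simp add: sgn_div_norm matrix_vector_mult_scaleR AR)
    then have "1 - spike_dev a b \<nu> \<theta> \<tau> (sgn (?R *v u)) = ?q / ?s"
      using spike_dev_eq[OF a ab \<theta> \<theta>', of "sgn (?R *v u)"] Ru
      by (simp add: norm_sgn matrix_vector_mult_scaleR power2_eq_square divide_inverse)
    then have "?s powr (- (real CARD('n) / 2)) * ?r u = ?q powr (- (real CARD('n) / 2))"
      using s q by (simp add: powr_divide)
    then show ?thesis
      unfolding ag_density_def spike_isqrt_quadratic[OF a ab \<theta>]
      using det_spike_cong[of ?\<theta>' \<theta> a b] \<theta> \<theta>' by (simp add: mult.assoc)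
  qed
  have [measurable]: "spike_dev a b \<nu> \<theta> \<tau> \<in> borel_measurable borel" unfolding spike_dev_def by measurable
  have r [measurable]: "(\<lambda>u. ennreal (?r u)) \<in> borel_measurable borel" by measurable
  show ?thesis
    unfolding angular_gaussian_def
  proof (subst density_density_eq)
    show "density surface_sphere (\<lambda>u. ennreal (ag_density (spike a b \<theta>) u) * indicator (sphere 0 1) u * ennreal (?r u))
      = density surface_sphere (\<lambda>u. ennreal (ag_density (spike a b ?\<theta>') u) * indicator (sphere 0 1) u)"
    proof (intro density_cong AE_I2)
      fix u :: "real^'n"
      have pos: "?r u \<ge> 0" by simp
      show "ennreal (ag_density (spike a b \<theta>) u) * indicator (sphere 0 1) u * ennreal (?r u)
        = ennreal (ag_density (spike a b ?\<theta>') u) * indicator (sphere 0 1) u"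
        using eq[of u] pos by (cases "norm u = 1") (auto simp: ennreal_mult'' [symmetric] indicator_def)
    qed measurable
  qed measurable
qed

section \<open>Quadratic expansion of the log-likelihood ratio\<close>

lemma borel_measurable_spike_dev [measurable]: "spike_dev a b \<nu> \<theta> \<tau> \<in> borel_measurable borel"
  unfolding spike_dev_def by measurable

text \<open>\<open>1 - spike_dev\<close> is the squared length of an invertible matrix, inverse root
  of the alternative shape times root of the null shape, applied to \<open>w\<close>. So the
  logarithm is taken at a positive argument.\<close>

lemma spike_dev_less_one:
  fixes \<theta> \<tau> w :: "real^'n"
  assumes a: "a > 0" and ab: "a + b > 0" and \<theta>: "norm \<theta> = 1" and \<theta>': "norm (\<theta> + \<nu> *\<^sub>R \<tau>) = 1" and w: "norm w = 1"
  shows "spike_dev a b \<nu> \<theta> \<tau> w < 1"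
proof -
  let ?x = "spike_isqrt a b (\<theta> + \<nu> *\<^sub>R \<tau>) *v (spike_sqrt a b \<theta> *v w)"
  have "spike_isqrt a b \<theta> *v (spike_sqrt a b (\<theta> + \<nu> *\<^sub>R \<tau>) *v ?x) = w"
    by (simp only: matrix_vector_mul_assoc spike_sqrt_isqrt[OF a ab \<theta>'] matrix_mul_assoc)
       (simp add: matrix_mul_assoc[symmetric] spike_sqrt_isqrt[OF a ab \<theta>'] spike_isqrt_sqrt[OF a ab \<theta>])
  then have "?x \<noteq> 0" using w by auto
  then have "1 - spike_dev a b \<nu> \<theta> \<tau> w > 0"
    unfolding spike_dev_eq[OF a ab \<theta> \<theta>' w] spike_isqrt_quadratic[OF a ab \<theta>'] by simp
  then show ?thesis by simp
qed

lemma AE_sample_law: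
  assumes "prob_space (angular_gaussian V)" "AE u in angular_gaussian V. Q u"
  shows "AE \<omega> in sample_law n V. \<forall>i<n. Q (\<omega> i)"
proof -
  have "AE \<omega> in PiM {..<n} (\<lambda>_. angular_gaussian V). Q (\<omega> i)" if "i < n" for i
    using assms that by (intro AE_PiM_component) auto
  then have "AE \<omega> in sample_law n V. \<forall>i\<in>{..<n}. Q (\<omega> i)"
    unfolding sample_law_def by (intro AE_finite_allI) auto
  then show ?thesis by eventually_elim auto
qed

text \<open>A Radon-Nikodym derivative is determined only up to null sets, hence the
  almost-everywhere form. Observations of unit length make every factor positive, so the logarithm
  of the product splits.\<close>

lemma AE_log_lr_spike:
  fixes \<theta> \<tau> :: "real^'n"
  assumes a: "a > 0" and ab: "a + b > 0" and \<theta>: "norm \<theta> = 1" and \<theta>': "norm (\<theta> + \<nu> *\<^sub>R \<tau>) = 1"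
  shows "AE \<omega> in sample_law n (spike a b \<theta>). log_lr n (spike a b \<theta>) (spike a b (\<theta> + \<nu> *\<^sub>R \<tau>)) \<omega>
    = (\<Sum>i<n. - (real CARD('n) / 2) * ln (1 - spike_dev a b \<nu> \<theta> \<tau> (sgn (spike_isqrt a b \<theta> *v \<omega> i))))"
proof -
  let ?M = "angular_gaussian (spike a b \<theta>)" and ?R = "spike_isqrt a b \<theta>"
  let ?d = "\<lambda>u. 1 - spike_dev a b \<nu> \<theta> \<tau> (sgn (?R *v u))"
  let ?r = "\<lambda>u. ?d u powr (- (real CARD('n) / 2))"
  note M = prob_space_angular_gaussian_spike[OF a ab \<theta>]
  have D: "density ?M (\<lambda>u. ennreal (?r u)) = angular_gaussian (spike a b (\<theta> + \<nu> *\<^sub>R \<tau>))"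
    by (rule density_angular_gaussian_spike[OF a ab \<theta> \<theta>'])
  have P: "prob_space (sample_law n (spike a b \<theta>))"
    unfolding sample_law_def by (rule prob_space_PiM) (rule M)
  then interpret P: prob_space "sample_law n (spike a b \<theta>)" .
  have "sample_law n (spike a b (\<theta> + \<nu> *\<^sub>R \<tau>)) = density (sample_law n (spike a b \<theta>)) (\<lambda>\<omega>. \<Prod>i<n. ennreal (?r (\<omega> i)))"
    unfolding sample_law_def D[symmetric]
  proof (rule PiM_density[OF M])
    show "prob_space (density ?M (\<lambda>u. ennreal (?r u)))"
      unfolding D by (rule prob_space_angular_gaussian_spike[OF a ab \<theta>'])
    show "(\<lambda>u. ennreal (?r u)) \<in> borel_measurable ?M" by measurable
  qed simp
  moreover have "(\<lambda>\<omega>. \<Prod>i<n. ennreal (?r (\<omega> i))) \<in> borel_measurable (sample_law n (spike a b \<theta>))"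
    unfolding sample_law_def by measurable
  ultimately have RN: "AE \<omega> in sample_law n (spike a b \<theta>). (\<Prod>i<n. ennreal (?r (\<omega> i)))
      = RN_deriv (sample_law n (spike a b \<theta>)) (sample_law n (spike a b (\<theta> + \<nu> *\<^sub>R \<tau>))) \<omega>"
    by (intro P.RN_deriv_unique) simp_all
  have pos: "?d u > 0" if "norm u = 1" for u
  proof -
    have "spike_sqrt a b \<theta> *v (?R *v u) = u" by (simp add: matrix_vector_mul_assoc spike_sqrt_isqrt[OF a ab \<theta>])
    then have "?R *v u \<noteq> 0" using that by auto
    then show ?thesis using spike_dev_less_one[OF a ab \<theta> \<theta>', of "sgn (?R *v u)"] by (simp add: norm_sgn)
  qed
  from RN AE_sample_law[OF M AE_angular_gaussian_norm] show ?thesis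
  proof eventually_elim
    fix \<omega> :: "nat \<Rightarrow> real^'n"
    assume RN: "(\<Prod>i<n. ennreal (?r (\<omega> i)))
        = RN_deriv (sample_law n (spike a b \<theta>)) (sample_law n (spike a b (\<theta> + \<nu> *\<^sub>R \<tau>))) \<omega>"
      and n1: "\<forall>i<n. norm (\<omega> i) = 1"
    have rpos: "?r (\<omega> i) > 0" if "i < n" for i
      unfolding powr_gt_zero using n1 pos[of "\<omega> i"] that by auto
    have "log_lr n (spike a b \<theta>) (spike a b (\<theta> + \<nu> *\<^sub>R \<tau>)) \<omega> = ln (\<Prod>i<n. ?r (\<omega> i))"
      unfolding log_lr_def RN[symmetric] by (simp add: prod_ennreal prod_nonneg)
    also have "\<dots> = (\<Sum>i<n. ln (?r (\<omega> i)))"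
    proof (rule ln_prod)
      fix i assume "i \<in> {..<n}"
      then show "?r (\<omega> i) \<noteq> 0" using rpos[of i] by auto
    qed simp
    also have "\<dots> = (\<Sum>i<n. - (real CARD('n) / 2) * ln (?d (\<omega> i)))"
      by (simp only: ln_powr)
    finally show "log_lr n (spike a b \<theta>) (spike a b (\<theta> + \<nu> *\<^sub>R \<tau>)) \<omega> = (\<Sum>i<n. - (real CARD('n) / 2) * ln (?d (\<omega> i)))" .
  qed
qed

section \<open>Size and moments of the deviation\<close>

lemma
  fixes \<theta> \<tau> :: "real^'n"
  assumes "a > 0" and ab: "a + b > 0" and \<theta>: "norm \<theta> = 1"
  shows spike_sqrt_inner_theta: "\<theta> \<bullet> (spike_sqrt a b \<theta> *v \<tau>) = sqrt (a + b) * (\<theta> \<bullet> \<tau>)"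
    and norm_spike_sqrt: "(norm (spike_sqrt a b \<theta> *v \<tau>))\<^sup>2 = a * (norm \<tau>)\<^sup>2 + b * (\<theta> \<bullet> \<tau>)\<^sup>2"
proof -
  have symA: "x \<bullet> (spike_sqrt a b \<theta> *v y) = (spike_sqrt a b \<theta> *v x) \<bullet> y" for x y
    by (rule symmetric_matrix_inner) (simp add: spike_sqrt_def transpose_spike)
  show "\<theta> \<bullet> (spike_sqrt a b \<theta> *v \<tau>) = sqrt (a + b) * (\<theta> \<bullet> \<tau>)"
    by (simp add: symA spike_sqrt_theta[OF \<theta>])
  have "(norm (spike_sqrt a b \<theta> *v \<tau>))\<^sup>2 = \<tau> \<bullet> ((spike_sqrt a b \<theta> ** spike_sqrt a b \<theta>) *v \<tau>)"
    by (simp only: power2_norm_eq_inner symA[symmetric] matrix_vector_mul_assoc)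
  also have "\<dots> = a * (norm \<tau>)\<^sup>2 + b * (\<theta> \<bullet> \<tau>)\<^sup>2"
    unfolding spike_sqrt_sq[OF assms] spike_inner by (simp add: power2_norm_eq_inner power2_eq_square[of "\<theta> \<bullet> \<tau>"])
  finally show "(norm (spike_sqrt a b \<theta> *v \<tau>))\<^sup>2 = a * (norm \<tau>)\<^sup>2 + b * (\<theta> \<bullet> \<tau>)\<^sup>2" .
qed

lemma abs_inner_le_unit: "norm w = 1 \<Longrightarrow> \<bar>x \<bullet> w\<bar> \<le> norm (x :: 'a::real_inner)"
  using Cauchy_Schwarz_ineq2[of x w] by simp

lemma spike_dev_bound:
  fixes \<theta> \<tau> w :: "real^'n"
  assumes a: "a > 0" and b: "b > 0" and \<theta>: "norm \<theta> = 1" and w: "norm w = 1" and "\<nu> > 0" and U: "norm (spike_sqrt a b \<theta> *v \<tau>) \<le> U"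
  shows "\<bar>spike_dev a b \<nu> \<theta> \<tau> w\<bar> \<le> b / (a * (a + b)) * (2 * \<nu> * sqrt (a + b) * U + \<nu>\<^sup>2 * U\<^sup>2)"
proof -
  let ?u = "spike_sqrt a b \<theta> *v \<tau>"
  have u: "\<bar>?u \<bullet> w\<bar> \<le> U" using abs_inner_le_unit[OF w, of ?u] U by linarith
  have t: "\<bar>\<theta> \<bullet> w\<bar> \<le> 1" using abs_inner_le_unit[OF w, of \<theta>] \<theta> by simp
  have "\<bar>(\<theta> \<bullet> w) * (?u \<bullet> w)\<bar> \<le> 1 * U" unfolding abs_mult using t u by (intro mult_mono) auto
  then have 1: "\<bar>2 * \<nu> * sqrt (a + b) * ((\<theta> \<bullet> w) * (?u \<bullet> w))\<bar> \<le> 2 * \<nu> * sqrt (a + b) * U"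
    unfolding abs_mult[of "2 * \<nu> * sqrt (a + b)"] using assms by (simp add: mult_left_mono)
  have "(?u \<bullet> w)\<^sup>2 \<le> U\<^sup>2" using u by (metis abs_le_square_iff abs_of_nonneg abs_ge_zero order_trans)
  then have 2: "\<nu>\<^sup>2 * (?u \<bullet> w)\<^sup>2 \<le> \<nu>\<^sup>2 * U\<^sup>2" by (simp add: mult_left_mono)
  have "\<bar>2 * \<nu> * sqrt (a + b) * (\<theta> \<bullet> w) * (?u \<bullet> w) + \<nu>\<^sup>2 * (?u \<bullet> w)\<^sup>2\<bar> \<le> 2 * \<nu> * sqrt (a + b) * U + \<nu>\<^sup>2 * U\<^sup>2"
  proof (rule order_trans[OF abs_triangle_ineq add_mono])
    show "\<bar>2 * \<nu> * sqrt (a + b) * (\<theta> \<bullet> w) * (?u \<bullet> w)\<bar> \<le> 2 * \<nu> * sqrt (a + b) * U"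
      using 1 by (simp only: mult.assoc)
    show "\<bar>\<nu>\<^sup>2 * (?u \<bullet> w)\<^sup>2\<bar> \<le> \<nu>\<^sup>2 * U\<^sup>2" using 2 by simp
  qed
  then show ?thesis
    unfolding spike_dev_def abs_mult[of "b / (a * (a + b))"] using a b by (intro mult_mono) auto
qed

text \<open>Why \<open>s\<close> alone decides both moments: the quadratic form
  \<open>spike_dev\<close> has rank at most two, and the form \<open>1 - spike_dev\<close> has
  determinant one because the shapes have equal determinants. If its trace is \<open>- s\<close>,
  then the product of its two possibly nonzero eigenvalues is also \<open>- s\<close>, and their
  squares sum to \<open>s^2 + 2 s\<close>. The proof verifies the formulas by direct
  computation.\<close>

lemma
  fixes \<theta> \<tau> :: "real^'n"
  assumes a: "a > 0" and ab: "a + b > 0" and \<theta>: "norm \<theta> = 1" and \<theta>': "norm (\<theta> + \<nu> *\<^sub>R \<tau>) = 1"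
  defines "p \<equiv> real CARD('n)" and "s \<equiv> b\<^sup>2 * \<nu>\<^sup>2 / (a * (a + b)) * ((norm \<tau>)\<^sup>2 - (\<theta> \<bullet> \<tau>)\<^sup>2)"
  shows usphere_spike_dev: "(\<integral>w. spike_dev a b \<nu> \<theta> \<tau> w \<partial>usphere) = - s / p"
    and usphere_spike_dev_sq: "(\<integral>w. (spike_dev a b \<nu> \<theta> \<tau> w)\<^sup>2 \<partial>usphere) = (3 * s\<^sup>2 + 4 * s) / (p * (p + 2))"
proof -
  define u where "u = spike_sqrt a b \<theta> *v \<tau>"
  \<comment> \<open>Unit length of the alternative direction gives
    \<open>\<nu>^2 |\<tau>|^2 = - 2 y\<close>, so every inner product that enters becomes a function
    of \<open>a\<close>, \<open>b\<close> and \<open>y\<close>.\<close>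
  define y where "y = \<nu> * (\<theta> \<bullet> \<tau>)"
  define q where "q = - 2 * a * y + b * y\<^sup>2"
  define c where "c = b / (a * (a + b))"
  define rb where "rb = sqrt (a + b)"
  have rb: "rb * rb = a + b" using ab by (simp add: rb_def)
  have "(norm (\<theta> + \<nu> *\<^sub>R \<tau>))\<^sup>2 = (norm \<theta>)\<^sup>2 + (2 * y + \<nu>\<^sup>2 * (norm \<tau>)\<^sup>2)"
    unfolding power2_norm_eq_inner y_def by (simp add: inner_simps inner_commute power2_eq_square algebra_simps)
  then have m: "\<nu>\<^sup>2 * (norm \<tau>)\<^sup>2 = - 2 * y" using \<theta> \<theta>' by simp
  have \<nu>u: "\<nu> * (\<theta> \<bullet> u) = rb * y"
    by (simp add: u_def spike_sqrt_inner_theta[OF a ab \<theta>] rb_def y_def)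
  have uu: "\<nu>\<^sup>2 * (u \<bullet> u) = q"
    using m by (simp add: u_def power2_norm_eq_inner[symmetric] norm_spike_sqrt[OF a ab \<theta>] q_def y_def distrib_left power_mult_distrib)
       (simp add: mult.left_commute)
  have cb: "c * (a * (a + b)) = b" using a ab by (simp add: c_def)
  have s: "s = - c * b * (2 * y + y\<^sup>2)"
  proof -
    have "s = c * b * (\<nu>\<^sup>2 * (norm \<tau>)\<^sup>2 - y\<^sup>2)"
    proof -
      have "b\<^sup>2 * \<nu>\<^sup>2 / (a * (a + b)) = c * b * \<nu>\<^sup>2" by (simp add: c_def power2_eq_square)
      then show ?thesis unfolding s_def y_def by (simp add: power_mult_distrib right_diff_distrib mult.assoc)
    qed
    then show ?thesis unfolding m by (simp add: algebra_simps)
  qed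
  have dev: "spike_dev a b \<nu> \<theta> \<tau> w = (2 * c * \<nu> * rb) * ((\<theta> \<bullet> w) * (u \<bullet> w)) + (c * \<nu>\<^sup>2) * ((u \<bullet> w) * (u \<bullet> w))" for w
    by (simp add: spike_dev_def u_def c_def rb_def power2_eq_square algebra_simps)
  have "(\<integral>w. spike_dev a b \<nu> \<theta> \<tau> w \<partial>usphere) = (2 * c * \<nu> * rb) * ((\<theta> \<bullet> u) / p) + (c * \<nu>\<^sup>2) * ((u \<bullet> u) / p)"
    unfolding dev by (subst Bochner_Integration.integral_add) (simp_all add: usphere_inner2 p_def)
  also have "\<dots> = c * (2 * rb * (\<nu> * (\<theta> \<bullet> u)) + \<nu>\<^sup>2 * (u \<bullet> u)) / p"
    by (simp add: add_divide_distrib algebra_simps)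
  also have "\<dots> = c * (2 * (rb * rb) * y + q) / p"
    unfolding \<nu>u uu by (simp add: algebra_simps)
  also have "c * (2 * (rb * rb) * y + q) = - s"
    unfolding rb s q_def by (simp add: algebra_simps power2_eq_square)
  finally show "(\<integral>w. spike_dev a b \<nu> \<theta> \<tau> w \<partial>usphere) = - s / p" .
  have "(spike_dev a b \<nu> \<theta> \<tau> w)\<^sup>2 = (4 * c\<^sup>2 * \<nu>\<^sup>2 * (rb * rb)) * ((\<theta> \<bullet> w) * (\<theta> \<bullet> w) * (u \<bullet> w) * (u \<bullet> w))
      + (4 * c\<^sup>2 * \<nu> * \<nu>\<^sup>2 * rb) * ((\<theta> \<bullet> w) * (u \<bullet> w) * (u \<bullet> w) * (u \<bullet> w))
      + (c\<^sup>2 * \<nu>\<^sup>2 * \<nu>\<^sup>2) * ((u \<bullet> w) * (u \<bullet> w) * (u \<bullet> w) * (u \<bullet> w))" for w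
    unfolding dev by (simp add: power2_eq_square algebra_simps)
  then have "(\<integral>w. (spike_dev a b \<nu> \<theta> \<tau> w)\<^sup>2 \<partial>usphere)
     = (4 * c\<^sup>2 * \<nu>\<^sup>2 * (rb * rb)) * (((\<theta> \<bullet> \<theta>) * (u \<bullet> u) + (\<theta> \<bullet> u) * (\<theta> \<bullet> u) + (\<theta> \<bullet> u) * (\<theta> \<bullet> u)) / (p * (p + 2)))
      + (4 * c\<^sup>2 * \<nu> * \<nu>\<^sup>2 * rb) * (((\<theta> \<bullet> u) * (u \<bullet> u) + (\<theta> \<bullet> u) * (u \<bullet> u) + (\<theta> \<bullet> u) * (u \<bullet> u)) / (p * (p + 2)))
      + (c\<^sup>2 * \<nu>\<^sup>2 * \<nu>\<^sup>2) * (((u \<bullet> u) * (u \<bullet> u) + (u \<bullet> u) * (u \<bullet> u) + (u \<bullet> u) * (u \<bullet> u)) / (p * (p + 2)))"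
    by (simp only: Bochner_Integration.integral_add Bochner_Integration.integrable_add integrable_mult_right
        integral_mult_right_zero integrable_usphere_inner4 usphere_inner4 p_def)
  also have "\<dots> = c\<^sup>2 * (4 * (rb * rb) * ((\<theta> \<bullet> \<theta>) * (\<nu>\<^sup>2 * (u \<bullet> u)) + 2 * (\<nu> * (\<theta> \<bullet> u)) * (\<nu> * (\<theta> \<bullet> u)))
      + 12 * rb * (\<nu> * (\<theta> \<bullet> u)) * (\<nu>\<^sup>2 * (u \<bullet> u)) + 3 * (\<nu>\<^sup>2 * (u \<bullet> u)) * (\<nu>\<^sup>2 * (u \<bullet> u))) / (p * (p + 2))"
    unfolding times_divide_eq_right add_divide_distrib[symmetric]
    by (intro arg_cong2[where f = "(/)"] refl) (simp add: power2_eq_square algebra_simps)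
  also have "\<dots> = c\<^sup>2 * (4 * (rb * rb) * (q + 2 * (rb * rb) * (y * y)) + 12 * (rb * rb) * y * q + 3 * q * q) / (p * (p + 2))"
    unfolding \<nu>u uu using \<theta> by (simp add: norm_eq_1 algebra_simps)
  also have "c\<^sup>2 * (4 * (rb * rb) * (q + 2 * (rb * rb) * (y * y)) + 12 * (rb * rb) * y * q + 3 * q * q)
     = c\<^sup>2 * (3 * b\<^sup>2 * (2 * y + y\<^sup>2)\<^sup>2 - 4 * (a * (a + b)) * (2 * y + y\<^sup>2))"
    unfolding rb q_def by (simp add: power2_eq_square algebra_simps)
  also have "\<dots> = 3 * s\<^sup>2 + 4 * s"
  proof -
    have "c\<^sup>2 * (4 * (a * (a + b)) * (2 * y + y\<^sup>2)) = 4 * c * (c * (a * (a + b))) * (2 * y + y\<^sup>2)"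
      by (simp add: power2_eq_square algebra_simps)
    then have e1: "c\<^sup>2 * (4 * (a * (a + b)) * (2 * y + y\<^sup>2)) = 4 * c * b * (2 * y + y\<^sup>2)"
      unfolding cb .
    have s2: "s\<^sup>2 = c\<^sup>2 * b\<^sup>2 * (2 * y + y\<^sup>2)\<^sup>2" unfolding s by (simp add: power_mult_distrib)
    show ?thesis unfolding right_diff_distrib e1 s2 unfolding s by simp
  qed
  finally show "(\<integral>w. (spike_dev a b \<nu> \<theta> \<tau> w)\<^sup>2 \<partial>usphere) = (3 * s\<^sup>2 + 4 * s) / (p * (p + 2))" .
qed

text \<open>The remainder vanishes at 0 and has derivative \<open>x^2 / (1 - x)\<close>, which is at
  most \<open>2 x^2\<close> for \<open>\<bar>x\<bar> \<le> 1 / 2\<close>; the mean value inequality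
  supplies the third power.\<close>

lemma ln_one_minus_cubic_bound:
  fixes x :: real
  assumes "\<bar>x\<bar> \<le> 1 / 2"
  shows "\<bar>- ln (1 - x) - x - x\<^sup>2 / 2\<bar> \<le> 2 * \<bar>x\<bar> ^ 3"
proof -
  let ?f = "\<lambda>x :: real. - ln (1 - x) - x - x\<^sup>2 / 2" and ?f' = "\<lambda>x :: real. x\<^sup>2 / (1 - x)"
  have "norm (?f x - ?f 0) \<le> (2 * \<bar>x\<bar>\<^sup>2) * norm (x - 0)"
  proof (rule field_differentiable_bound[of "closed_segment 0 x" ?f ?f'])
    fix z assume "z \<in> closed_segment 0 x"
    then have z: "\<bar>z\<bar> \<le> \<bar>x\<bar>" by (auto simp: closed_segment_eq_real_ivl split: if_splits)
    then have z1: "1 - z \<ge> 1 / 2" using assms by linarith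
    then have "z \<noteq> 1" "1 - z > 0" by auto
    then show "(?f has_field_derivative ?f' z) (at z within closed_segment 0 x)"
      by (auto intro!: derivative_eq_intros simp: field_simps power2_eq_square)
    have "z\<^sup>2 / (1 - z) \<le> \<bar>x\<bar>\<^sup>2 / (1 / 2)"
      using z z1 by (intro frac_le) (auto simp: abs_le_square_iff[symmetric])
    then show "norm (?f' z) \<le> 2 * \<bar>x\<bar>\<^sup>2" using \<open>1 - z > 0\<close> by simp
  qed auto
  then show ?thesis by (simp add: power3_eq_cube power2_eq_square)
qed

text \<open>Splitting \<open>- r * ln (1 - X)\<close> into \<open>r X\<close>,
  \<open>r / 2 X^2\<close> and a cubic remainder, every term is separated into its mean and a
  centred part. The means make up the drift \<open>C\<close>. The centred parts, after
  \<open>l\<close> has replaced the linear one, are bounded by \<open>o(1 / sqrt n)\<close> and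
  vanish by Hoeffding. For \<open>K\<close> of order \<open>1 / sqrt n\<close> the conditions on
  \<open>K\<close> hold.\<close>

lemma lan_expansion:
  fixes M :: "nat \<Rightarrow> 'a measure" and T :: "nat \<Rightarrow> 'a \<Rightarrow> real^'n" and X l :: "nat \<Rightarrow> real^'n \<Rightarrow> real" and r :: real
  assumes M: "\<And>n. n > 0 \<Longrightarrow> prob_space (M n)" and T: "\<And>n. n > 0 \<Longrightarrow> T n \<in> M n \<rightarrow>\<^sub>M borel"
    and distr: "\<And>n. n > 0 \<Longrightarrow> distr (M n) borel (T n) = usphere"
    and X [measurable]: "\<And>n. X n \<in> borel_measurable borel" and l [measurable]: "\<And>n. l n \<in> borel_measurable borel"
    and K: "\<And>n w. n > 0 \<Longrightarrow> norm w = 1 \<Longrightarrow> \<bar>X n w\<bar> \<le> K n"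
    and D: "\<And>n w. n > 0 \<Longrightarrow> norm w = 1 \<Longrightarrow> \<bar>r * (X n w - (\<integral>v. X n v \<partial>usphere)) - l n w\<bar> \<le> D n"
    and l0: "\<And>n. n > 0 \<Longrightarrow> (\<integral>v. l n v \<partial>usphere) = 0"
    and K0: "K \<longlonglongrightarrow> 0" "(\<lambda>n. sqrt (real n) * (K n)\<^sup>2) \<longlonglongrightarrow> 0" "(\<lambda>n. real n * K n ^ 3) \<longlonglongrightarrow> 0"
    and D0: "(\<lambda>n. sqrt (real n) * D n) \<longlonglongrightarrow> 0"
    and C: "(\<lambda>n. real n * (r * (\<integral>v. X n v \<partial>usphere) + r / 2 * (\<integral>v. (X n v)\<^sup>2 \<partial>usphere)) - C n) \<longlonglongrightarrow> 0"
    and "\<epsilon> > 0"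
  shows "(\<lambda>n. measure (PiM {..<n} (\<lambda>_. M n)) {\<omega> \<in> space (PiM {..<n} (\<lambda>_. M n)).
      \<bar>(\<Sum>i<n. - r * ln (1 - X n (T n (\<omega> i)))) - ((\<Sum>i<n. l n (T n (\<omega> i))) + C n)\<bar> > \<epsilon>}) \<longlonglongrightarrow> 0"
proof -
  interpret U: prob_space "usphere :: (real^'n) measure" by (rule prob_space_usphere)
  from order_tendstoD(2)[OF K0(1), of "1/2"] obtain N0 where N0: "\<And>n. n \<ge> N0 \<Longrightarrow> K n < 1 / 2"
    by (auto simp: eventually_sequentially)
  \<comment> \<open>The successor also ensures \<open>n > 0\<close>, where the hypotheses on the
    rows apply.\<close>
  define N where "N = Suc N0"
  have N: "K n \<le> 1 / 2" "n > 0" if "n \<ge> N" for n using that N0[of n] by (auto simp: N_def)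
  define m1 where "m1 n = (\<integral>v. X n v \<partial>usphere)" for n
  define m2 where "m2 n = (\<integral>v. (X n v)\<^sup>2 \<partial>usphere)" for n
  define \<rho> where "\<rho> n w = - ln (1 - X n w) - X n w - (X n w)\<^sup>2 / 2" for n w
  define E\<rho> where "E\<rho> n = (\<integral>v. \<rho> n v \<partial>usphere)" for n
  \<comment> \<open>The random part of the error, centred term by term: replacement of the linear
    term by \<open>l\<close>, quadratic term, cubic remainder.\<close>
  define G where "G n w = r * (X n w - m1 n) - l n w + r / 2 * ((X n w)\<^sup>2 - m2 n) + r * (\<rho> n w - E\<rho> n)" for n w
  have \<rho>_meas [measurable]: "\<rho> n \<in> borel_measurable borel" for n unfolding \<rho>_def by measurable
  have G_meas [measurable]: "G n \<in> borel_measurable borel" for n unfolding G_def by measurable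
  have X2: "\<bar>(X n w)\<^sup>2\<bar> \<le> (K n)\<^sup>2" if "n \<ge> N" "norm w = 1" for n w
    using K[OF N(2)[OF that(1)] that(2)] by (simp add: abs_le_square_iff[symmetric])
  have \<rho>b: "\<bar>\<rho> n w\<bar> \<le> 2 * K n ^ 3" if n: "n \<ge> N" "norm w = 1" for n w
  proof -
    have "\<bar>\<rho> n w\<bar> \<le> 2 * \<bar>X n w\<bar> ^ 3"
      unfolding \<rho>_def using K[OF N(2)[OF n(1)] n(2)] N(1)[OF n(1)] by (intro ln_one_minus_cubic_bound) linarith
    also have "\<dots> \<le> 2 * K n ^ 3" using K[OF N(2)[OF n(1)] n(2)] by (simp add: power_mono)
    finally show ?thesis .
  qed
  have E_bound: "\<bar>\<integral>v. f v \<partial>usphere\<bar> \<le> B" if "f \<in> borel_measurable borel" "\<And>w. norm w = 1 \<Longrightarrow> \<bar>f w\<bar> \<le> B" for f :: "real^'n \<Rightarrow> real" and B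
  proof -
    have int: "integrable usphere f" by (rule integrable_usphere[OF that])
    have "\<bar>\<integral>v. f v \<partial>usphere\<bar> \<le> (\<integral>v. \<bar>f v\<bar> \<partial>usphere)" by (rule integral_abs_bound)
    also have "\<dots> \<le> (\<integral>v. B \<partial>(usphere :: (real^'n) measure))"
      using int AE_usphere_norm that(2) by (intro integral_mono_AE) (auto elim!: eventually_mono)
    finally show ?thesis using U.prob_space by simp
  qed
  have iX: "integrable usphere (X n)" and iX2: "integrable usphere (\<lambda>w. (X n w)\<^sup>2)" and i\<rho>: "integrable usphere (\<rho> n)"
    if "n \<ge> N" for n
    using K[OF N(2)[OF that]] X2[OF that] \<rho>b[OF that] by (auto intro!: integrable_usphere)
  have il: "integrable usphere (l n)" if "n \<ge> N" for n
  proof (rule integrable_usphere)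
    fix w :: "real^'n" assume w: "norm w = 1"
    have "\<bar>l n w\<bar> \<le> D n + \<bar>r * (X n w - m1 n)\<bar>" using D[OF N(2)[OF that] w] unfolding m1_def by linarith
    also have "\<bar>r * (X n w - m1 n)\<bar> \<le> \<bar>r\<bar> * (K n + K n)"
      unfolding abs_mult m1_def using K[OF N(2)[OF that] w] E_bound[of "X n" "K n", OF X K[OF N(2)[OF that]]]
      by (intro mult_left_mono) auto
    finally show "\<bar>l n w\<bar> \<le> D n + \<bar>r\<bar> * (K n + K n)" by simp
  qed simp
  define k where "k n = D n + \<bar>r\<bar> * (K n)\<^sup>2 + 4 * \<bar>r\<bar> * K n ^ 3" for n
  have Gb: "\<bar>G n w\<bar> \<le> k n" if n: "n \<ge> N" and w: "norm w = 1" for n w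
  proof -
    have "\<bar>(X n w)\<^sup>2 - m2 n\<bar> \<le> (K n)\<^sup>2 + (K n)\<^sup>2"
    proof -
      have "\<bar>m2 n\<bar> \<le> (K n)\<^sup>2" unfolding m2_def by (rule E_bound) (auto intro: X2[OF n, unfolded abs_power2])
      then show ?thesis using X2[OF n w] by linarith
    qed
    then have "\<bar>r / 2 * ((X n w)\<^sup>2 - m2 n)\<bar> \<le> \<bar>r / 2\<bar> * ((K n)\<^sup>2 + (K n)\<^sup>2)"
      unfolding abs_mult by (intro mult_left_mono) auto
    moreover have "\<bar>\<rho> n w - E\<rho> n\<bar> \<le> 2 * K n ^ 3 + 2 * K n ^ 3"
    proof -
      have "\<bar>E\<rho> n\<bar> \<le> 2 * K n ^ 3" unfolding E\<rho>_def by (rule E_bound) (auto intro: \<rho>b[OF n])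
      then show ?thesis using \<rho>b[OF n w] by linarith
    qed
    then have "\<bar>r * (\<rho> n w - E\<rho> n)\<bar> \<le> \<bar>r\<bar> * (2 * K n ^ 3 + 2 * K n ^ 3)"
      unfolding abs_mult by (intro mult_left_mono) auto
    moreover have "\<bar>r * (X n w - m1 n) - l n w\<bar> \<le> D n" using D[OF N(2)[OF n] w] by (simp add: m1_def)
    moreover have "\<bar>G n w\<bar> \<le> \<bar>r * (X n w - m1 n) - l n w\<bar> + \<bar>r / 2 * ((X n w)\<^sup>2 - m2 n)\<bar> + \<bar>r * (\<rho> n w - E\<rho> n)\<bar>"
      unfolding G_def by linarith
    ultimately have "\<bar>G n w\<bar> \<le> D n + \<bar>r / 2\<bar> * ((K n)\<^sup>2 + (K n)\<^sup>2) + \<bar>r\<bar> * (2 * K n ^ 3 + 2 * K n ^ 3)"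
      by linarith
    then show ?thesis by (simp add: k_def)
  qed
  have G0: "(\<integral>w. G n w \<partial>usphere) = 0" if n: "n \<ge> N" for n
    unfolding G_def using iX[OF n] iX2[OF n] i\<rho>[OF n] il[OF n] l0[OF N(2)[OF n]] U.prob_space
    by (simp add: m1_def m2_def E\<rho>_def)
  have k0: "(\<lambda>n. sqrt (real n) * k n) \<longlonglongrightarrow> 0"
  proof -
    have "(\<lambda>n. sqrt (real n) * D n + \<bar>r\<bar> * (sqrt (real n) * (K n)\<^sup>2) + 4 * \<bar>r\<bar> * ((sqrt (real n) * (K n)\<^sup>2) * K n))
       \<longlonglongrightarrow> 0 + \<bar>r\<bar> * 0 + 4 * \<bar>r\<bar> * (0 * 0)"
      by (intro tendsto_intros D0 K0)
    then show ?thesis by (simp add: k_def algebra_simps power2_eq_square power3_eq_cube)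
  qed
  define C' where "C' n = real n * (r * m1 n + r / 2 * m2 n + r * E\<rho> n) - C n" for n
  have C'0: "C' \<longlonglongrightarrow> 0"
  proof -
    have "(\<lambda>n. real n * (r * E\<rho> n)) \<longlonglongrightarrow> 0"
    proof (rule Lim_null_comparison)
      show "(\<lambda>n. 2 * \<bar>r\<bar> * (real n * K n ^ 3)) \<longlonglongrightarrow> 0" by (rule tendsto_mult_right_zero[OF K0(3)])
      show "\<forall>\<^sub>F n in sequentially. norm (real n * (r * E\<rho> n)) \<le> 2 * \<bar>r\<bar> * (real n * K n ^ 3)"
        using eventually_ge_at_top[of N]
      proof eventually_elim
        fix n assume n: "N \<le> n"
        have "\<bar>E\<rho> n\<bar> \<le> 2 * K n ^ 3" unfolding E\<rho>_def by (rule E_bound) (auto intro: \<rho>b[OF n])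
        then have "real n * \<bar>r\<bar> * \<bar>E\<rho> n\<bar> \<le> real n * \<bar>r\<bar> * (2 * K n ^ 3)" by (intro mult_left_mono) auto
        then show "norm (real n * (r * E\<rho> n)) \<le> 2 * \<bar>r\<bar> * (real n * K n ^ 3)" by (simp add: abs_mult mult_ac)
      qed
    qed
    from tendsto_add[OF C this] show ?thesis by (simp add: C'_def[abs_def] m1_def m2_def algebra_simps)
  qed
  \<comment> \<open>Rows below \<open>N\<close>, where the logarithm is not controlled, are set to
    zero, so that the bound \<open>k\<close> holds for every \<open>n > 0\<close> without affecting
    the limit.\<close>
  define f where "f n x = (if n \<ge> N then G n (T n x) else 0)" for n x
  have push: "(\<integral>x. G n (T n x) \<partial>M n) = (\<integral>w. G n w \<partial>usphere)" if "n > 0" for n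
    using integral_distr[OF T[OF that], of "G n"] distr[OF that] by simp
  have lim: "(\<lambda>n. measure (PiM {..<n} (\<lambda>_. M n)) {\<omega> \<in> space (PiM {..<n} (\<lambda>_. M n)). \<bar>\<Sum>i<n. f n (\<omega> i)\<bar> \<ge> \<epsilon> / 2}) \<longlonglongrightarrow> 0"
  proof (rule PiM_sum_tendsto_zero[OF M])
    show "f n \<in> borel_measurable (M n)" if "n > 0" for n
      using measurable_compose[OF T[OF that] G_meas] by (simp add: f_def[abs_def])
    show "AE x in M n. \<bar>f n x\<bar> \<le> \<bar>k n\<bar>" if n: "n > 0" for n
    proof (cases "n \<ge> N")
      case True
      have "AE w in distr (M n) borel (T n). norm w = 1" unfolding distr[OF n] by (rule AE_usphere_norm)
      then have "AE x in M n. norm (T n x) = 1" by (rule AE_distrD[OF T[OF n]])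
      then show ?thesis
      proof eventually_elim
        fix x assume "norm (T n x) = 1"
        from Gb[OF True this] show "\<bar>f n x\<bar> \<le> \<bar>k n\<bar>" using True by (simp add: f_def)
      qed
    qed (simp add: f_def)
    show "(\<integral>x. f n x \<partial>M n) = 0" if "n > 0" for n
      using push[OF that] G0[of n] by (cases "n \<ge> N") (simp_all add: f_def)
    show "(\<lambda>n. sqrt (real n) * \<bar>k n\<bar>) \<longlonglongrightarrow> 0" using tendsto_rabs_zero[OF k0] by (simp add: abs_mult)
  qed (use \<open>\<epsilon> > 0\<close> in auto)
  show ?thesis
  proof (rule Lim_null_comparison[OF _ lim])
    have "\<forall>\<^sub>F n in sequentially. \<bar>C' n\<bar> < \<epsilon> / 2"
      using C'0 \<open>\<epsilon> > 0\<close> by (auto simp: tendsto_iff dist_real_def dest!: spec[of _ "\<epsilon> / 2"])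
    then show "\<forall>\<^sub>F n in sequentially. norm (measure (PiM {..<n} (\<lambda>_. M n)) {\<omega> \<in> space (PiM {..<n} (\<lambda>_. M n)).
        \<bar>(\<Sum>i<n. - r * ln (1 - X n (T n (\<omega> i)))) - ((\<Sum>i<n. l n (T n (\<omega> i))) + C n)\<bar> > \<epsilon>})
      \<le> measure (PiM {..<n} (\<lambda>_. M n)) {\<omega> \<in> space (PiM {..<n} (\<lambda>_. M n)). \<bar>\<Sum>i<n. f n (\<omega> i)\<bar> \<ge> \<epsilon> / 2}"
      using eventually_ge_at_top[of N]
    proof eventually_elim
      fix n assume C': "\<bar>C' n\<bar> < \<epsilon> / 2" and n: "N \<le> n"
      interpret Pn: prob_space "PiM {..<n} (\<lambda>_. M n)" by (rule prob_space_PiM) (use M N(2)[OF n] in auto)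
      have fm: "f n \<in> borel_measurable (M n)"
        using measurable_compose[OF T[OF N(2)[OF n]] G_meas] by (simp add: f_def[abs_def])
      have eq: "(\<Sum>i<n. - r * ln (1 - X n (T n (\<omega> i)))) - ((\<Sum>i<n. l n (T n (\<omega> i))) + C n)
          = (\<Sum>i<n. f n (\<omega> i)) + C' n" for \<omega>
      proof -
        have "(\<Sum>i<n. f n (\<omega> i)) = (\<Sum>i<n. - r * ln (1 - X n (T n (\<omega> i))) - l n (T n (\<omega> i)) - (r * m1 n + r / 2 * m2 n + r * E\<rho> n))"
          using n by (intro sum.cong refl) (simp add: f_def G_def \<rho>_def algebra_simps)
        then show ?thesis by (simp add: sum_subtractf C'_def)
      qed
      \<comment> \<open>The deterministic part is below \<open>\<epsilon> / 2\<close>, so a total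
        beyond \<open>\<epsilon>\<close> forces the centred sum beyond
        \<open>\<epsilon> / 2\<close>.\<close>
      have "{\<omega> \<in> space (PiM {..<n} (\<lambda>_. M n)).
        \<bar>(\<Sum>i<n. - r * ln (1 - X n (T n (\<omega> i)))) - ((\<Sum>i<n. l n (T n (\<omega> i))) + C n)\<bar> > \<epsilon>}
        \<subseteq> {\<omega> \<in> space (PiM {..<n} (\<lambda>_. M n)). \<bar>\<Sum>i<n. f n (\<omega> i)\<bar> \<ge> \<epsilon> / 2}"
        unfolding eq using C' by auto
      moreover have "{\<omega> \<in> space (PiM {..<n} (\<lambda>_. M n)). \<bar>\<Sum>i<n. f n (\<omega> i)\<bar> \<ge> \<epsilon> / 2} \<in> sets (PiM {..<n} (\<lambda>_. M n))"
        using fm by measurable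
      ultimately show "norm (measure (PiM {..<n} (\<lambda>_. M n)) {\<omega> \<in> space (PiM {..<n} (\<lambda>_. M n)).
        \<bar>(\<Sum>i<n. - r * ln (1 - X n (T n (\<omega> i)))) - ((\<Sum>i<n. l n (T n (\<omega> i))) + C n)\<bar> > \<epsilon>})
      \<le> measure (PiM {..<n} (\<lambda>_. M n)) {\<omega> \<in> space (PiM {..<n} (\<lambda>_. M n)). \<bar>\<Sum>i<n. f n (\<omega> i)\<bar> \<ge> \<epsilon> / 2}"
        by (simp only: real_norm_def abs_of_nonneg[OF measure_nonneg]) (rule Pn.finite_measure_mono)
    qed
  qed
qed

text \<open>The abstract expansion with \<open>r = p / 2\<close>; the almost sure formula exchanges
  the sum of logarithms for \<open>log_lr\<close> inside the probabilities. Measurability of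
  \<open>Y n\<close> is asked for every \<open>n\<close>, as \<open>o_P1\<close> requires, the
  explicit form only for \<open>n > 0\<close>.\<close>

lemma spike_log_lr_o_P1:
  fixes \<theta> :: "real^'n" and \<tau> :: "nat \<Rightarrow> real^'n" and l :: "nat \<Rightarrow> real^'n \<Rightarrow> real"
  defines "p \<equiv> real CARD('n)"
  assumes \<theta>: "norm \<theta> = 1" and a: "\<And>n. n > 0 \<Longrightarrow> a n > 0" and b: "\<And>n. n > 0 \<Longrightarrow> b n > 0"
    and \<theta>': "\<And>n. n > 0 \<Longrightarrow> norm (\<theta> + \<nu> n *\<^sub>R \<tau> n) = 1"
    and Y: "\<And>n. Y n \<in> borel_measurable (sample_law n (spike (a n) (b n) \<theta>))"
    and Y_eq: "\<And>n \<omega>. n > 0 \<Longrightarrow> Y n \<omega> = (\<Sum>i<n. l n (sgn (spike_isqrt (a n) (b n) \<theta> *v \<omega> i))) + C n"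
    and l: "\<And>n. l n \<in> borel_measurable borel"
    and K: "\<And>n w. n > 0 \<Longrightarrow> norm w = 1 \<Longrightarrow> \<bar>spike_dev (a n) (b n) (\<nu> n) \<theta> (\<tau> n) w\<bar> \<le> K n"
    and D: "\<And>n w. n > 0 \<Longrightarrow> norm w = 1 \<Longrightarrow>
      \<bar>p / 2 * (spike_dev (a n) (b n) (\<nu> n) \<theta> (\<tau> n) w - (\<integral>v. spike_dev (a n) (b n) (\<nu> n) \<theta> (\<tau> n) v \<partial>usphere)) - l n w\<bar> \<le> D n"
    and l0: "\<And>n. n > 0 \<Longrightarrow> (\<integral>v. l n v \<partial>usphere) = 0"
    and K0: "K \<longlonglongrightarrow> 0" "(\<lambda>n. sqrt (real n) * (K n)\<^sup>2) \<longlonglongrightarrow> 0" "(\<lambda>n. real n * K n ^ 3) \<longlonglongrightarrow> 0"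
    and D0: "(\<lambda>n. sqrt (real n) * D n) \<longlonglongrightarrow> 0"
    and C: "(\<lambda>n. real n * (p / 2 * (\<integral>v. spike_dev (a n) (b n) (\<nu> n) \<theta> (\<tau> n) v \<partial>usphere)
      + p / 2 / 2 * (\<integral>v. (spike_dev (a n) (b n) (\<nu> n) \<theta> (\<tau> n) v)\<^sup>2 \<partial>usphere)) - C n) \<longlonglongrightarrow> 0"
  shows "o_P1 (\<lambda>n. sample_law n (spike (a n) (b n) \<theta>))
    (\<lambda>n \<omega>. log_lr n (spike (a n) (b n) \<theta>) (spike (a n) (b n) (\<theta> + \<nu> n *\<^sub>R \<tau> n)) \<omega> - Y n \<omega>)"
  unfolding o_P1_def
proof (intro conjI allI impI)
  let ?V = "\<lambda>n. spike (a n) (b n) \<theta>" and ?V' = "\<lambda>n. spike (a n) (b n) (\<theta> + \<nu> n *\<^sub>R \<tau> n)"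
  let ?T = "\<lambda>n u. sgn (spike_isqrt (a n) (b n) \<theta> *v u)"
  let ?X = "\<lambda>n. spike_dev (a n) (b n) (\<nu> n) \<theta> (\<tau> n)"
  have LR: "log_lr n (?V n) (?V' n) \<in> borel_measurable (sample_law n (?V n))" for n
    unfolding log_lr_def by measurable
  show m: "(\<lambda>\<omega>. log_lr n (?V n) (?V' n) \<omega> - Y n \<omega>) \<in> borel_measurable (sample_law n (?V n))" for n
    using LR Y by measurable
  have ab: "a n + b n > 0" if "n > 0" for n using a[OF that] b[OF that] by simp
  note M = prob_space_angular_gaussian_spike[OF a ab \<theta>]
  fix \<epsilon> :: real assume \<epsilon>: "\<epsilon> > 0"
  have "(\<lambda>n. measure (PiM {..<n} (\<lambda>_. angular_gaussian (?V n))) {\<omega> \<in> space (PiM {..<n} (\<lambda>_. angular_gaussian (?V n))).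
      \<bar>(\<Sum>i<n. - (p / 2) * ln (1 - ?X n (?T n (\<omega> i)))) - ((\<Sum>i<n. l n (?T n (\<omega> i))) + C n)\<bar> > \<epsilon>}) \<longlonglongrightarrow> 0"
    by (rule lan_expansion[where T = ?T and K = K and D = D]; (rule M K D l0 K0 D0 C \<epsilon> l distr_angular_gaussian_spike[OF a ab \<theta>] borel_measurable_spike_dev; assumption?)?)
       (simp_all add: measurable_cong_sets[OF sets_angular_gaussian refl])
  then show "(\<lambda>n. measure (sample_law n (?V n)) {\<omega> \<in> space (sample_law n (?V n)).
      \<bar>log_lr n (?V n) (?V' n) \<omega> - Y n \<omega>\<bar> > \<epsilon>}) \<longlonglongrightarrow> 0"
  proof (rule Lim_transform_eventually)
    show "\<forall>\<^sub>F n in sequentially. measure (PiM {..<n} (\<lambda>_. angular_gaussian (?V n))) {\<omega> \<in> space (PiM {..<n} (\<lambda>_. angular_gaussian (?V n))).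
        \<bar>(\<Sum>i<n. - (p / 2) * ln (1 - ?X n (?T n (\<omega> i)))) - ((\<Sum>i<n. l n (?T n (\<omega> i))) + C n)\<bar> > \<epsilon>}
      = measure (sample_law n (?V n)) {\<omega> \<in> space (sample_law n (?V n)). \<bar>log_lr n (?V n) (?V' n) \<omega> - Y n \<omega>\<bar> > \<epsilon>}"
      using eventually_gt_at_top[of 0]
    proof eventually_elim
      fix n :: nat assume n: "n > 0"
      let ?S = "\<lambda>\<omega>. (\<Sum>i<n. - (p / 2) * ln (1 - ?X n (?T n (\<omega> i)))) - ((\<Sum>i<n. l n (?T n (\<omega> i))) + C n)"
      interpret P: prob_space "sample_law n (?V n)"
        unfolding sample_law_def by (rule prob_space_PiM) (rule M[OF n n])
      have S: "?S \<in> borel_measurable (sample_law n (?V n))"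
        unfolding sample_law_def using l by measurable
      show "measure (PiM {..<n} (\<lambda>_. angular_gaussian (?V n))) {\<omega> \<in> space (PiM {..<n} (\<lambda>_. angular_gaussian (?V n))). \<bar>?S \<omega>\<bar> > \<epsilon>}
        = measure (sample_law n (?V n)) {\<omega> \<in> space (sample_law n (?V n)). \<bar>log_lr n (?V n) (?V' n) \<omega> - Y n \<omega>\<bar> > \<epsilon>}"
        unfolding sample_law_def[symmetric]
      proof (rule P.finite_measure_eq_AE)
        show "AE \<omega> in sample_law n (?V n). (\<omega> \<in> {\<omega> \<in> space (sample_law n (?V n)). \<bar>?S \<omega>\<bar> > \<epsilon>})
            = (\<omega> \<in> {\<omega> \<in> space (sample_law n (?V n)). \<bar>log_lr n (?V n) (?V' n) \<omega> - Y n \<omega>\<bar> > \<epsilon>})"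
          using AE_log_lr_spike[OF a[OF n] ab[OF n] \<theta> \<theta>'[OF n], of n]
          by eventually_elim (simp add: Y_eq[OF n] p_def)
      qed (use S m in measurable)
    qed
  qed
qed

text \<open>The largest singular value \<open>sqrt (a + b)\<close> of the root cancels the
  denominator \<open>a + b\<close> and leaves the order \<open>b * \<nu> / a\<close>.\<close>

lemma spike_dev_bound_seq:
  fixes \<theta> \<tau> w :: "real^'n"
  assumes a: "a > 0" and b: "b > 0" and \<theta>: "norm \<theta> = 1" and w: "norm w = 1" and \<nu>: "\<nu> > 0" and B: "norm \<tau> \<le> B"
  shows "norm (spike_sqrt a b \<theta> *v \<tau>) \<le> sqrt (a + b) * B"
    and "\<bar>spike_dev a b \<nu> \<theta> \<tau> w\<bar> \<le> b * \<nu> / a * (2 * B + \<nu> * B\<^sup>2)"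
proof -
  have ab: "a + b > 0" using a b by simp
  have B0: "B \<ge> 0" using B norm_ge_zero[of \<tau>] by linarith
  have "(\<theta> \<bullet> \<tau>)\<^sup>2 \<le> (norm \<tau>)\<^sup>2"
    using Cauchy_Schwarz_ineq[of \<theta> \<tau>] \<theta> by (simp add: power2_norm_eq_inner norm_eq_1)
  then have "(norm (spike_sqrt a b \<theta> *v \<tau>))\<^sup>2 \<le> a * (norm \<tau>)\<^sup>2 + b * (norm \<tau>)\<^sup>2"
    unfolding norm_spike_sqrt[OF a ab \<theta>] using b by (simp add: mult_left_mono)
  also have "\<dots> \<le> (a + b) * B\<^sup>2"
    using B ab by (simp add: distrib_right[symmetric] mult_left_mono power_mono)
  also have "\<dots> = (sqrt (a + b) * B)\<^sup>2" using ab by (simp add: power_mult_distrib)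
  finally show U: "norm (spike_sqrt a b \<theta> *v \<tau>) \<le> sqrt (a + b) * B"
    using B0 ab by (meson mult_nonneg_nonneg power2_le_imp_le real_sqrt_ge_zero less_imp_le)
  have "\<bar>spike_dev a b \<nu> \<theta> \<tau> w\<bar> \<le> b / (a * (a + b)) * (2 * \<nu> * sqrt (a + b) * (sqrt (a + b) * B) + \<nu>\<^sup>2 * (sqrt (a + b) * B)\<^sup>2)"
    by (rule spike_dev_bound[OF a b \<theta> w \<nu> U])
  also have "2 * \<nu> * sqrt (a + b) * (sqrt (a + b) * B) = (a + b) * (2 * \<nu> * B)"
    using ab by (simp add: mult_ac flip: mult.assoc[of "sqrt (a + b)" "sqrt (a + b)"])
  also have "\<nu>\<^sup>2 * (sqrt (a + b) * B)\<^sup>2 = (a + b) * (\<nu>\<^sup>2 * B\<^sup>2)" using ab by (simp add: power_mult_distrib)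
  also have "b / (a * (a + b)) * ((a + b) * (2 * \<nu> * B) + (a + b) * (\<nu>\<^sup>2 * B\<^sup>2)) = b * \<nu> / a * (2 * B + \<nu> * B\<^sup>2)"
  proof -
    have "(a + b) * (2 * \<nu> * B) + (a + b) * (\<nu>\<^sup>2 * B\<^sup>2) = (a + b) * (\<nu> * (2 * B + \<nu> * B\<^sup>2))"
      by (simp add: power2_eq_square algebra_simps)
    then show ?thesis using ab by simp
  qed
  finally show "\<bar>spike_dev a b \<nu> \<theta> \<tau> w\<bar> \<le> b * \<nu> / a * (2 * B + \<nu> * B\<^sup>2)" .
qed

text \<open>The terms linear in \<open>\<rho>\<close> combine through
  \<open>- 1 / 2 + 1 / (p + 2) = - p / (2 * (p + 2))\<close>; the \<open>s^2\<close> in the second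
  moment leaves the last term.\<close>

lemma lan_drift:
  fixes n p s \<rho> :: real
  assumes "p > 0" "n > 0" "\<rho> = n * s"
  shows "n * (p / 2 * (- s / p) + p / 2 / 2 * ((3 * s\<^sup>2 + 4 * s) / (p * (p + 2))))
    = - (p / (2 * (p + 2)) * \<rho>) + 3 * \<rho> * s / (4 * (p + 2))"
proof -
  have "p + 2 \<noteq> 0" using assms by simp
  then show ?thesis unfolding assms(3) using assms(1,2)
    by (simp add: divide_simps) (simp add: power2_eq_square algebra_simps)
qed

text \<open>Common core of regimes (i) to (iii). The limit of \<open>\<nu>\<close> is arbitrary, so
  fixed and vanishing \<open>b\<close> are treated alike. What remains for each regime is a
  linearisation \<open>L\<close> with uniform error \<open>o(1 / sqrt n)\<close> and the matching
  constant \<open>C\<close>.\<close>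

lemma spike_local_expansion:
  fixes \<theta> :: "real^'n" and \<tau> :: "nat \<Rightarrow> real^'n" and L :: "nat \<Rightarrow> real^'n \<Rightarrow> real"
  defines "p \<equiv> real CARD('n)"
  assumes \<theta>: "norm \<theta> = 1" and a: "\<And>n. n > 0 \<Longrightarrow> a n > 0" and b: "\<And>n. n > 0 \<Longrightarrow> b n > 0"
    and \<nu>: "\<And>n. n > 0 \<Longrightarrow> \<nu> n = (a n + b n) / (sqrt (real n) * b n)"
    and \<theta>': "\<And>n. n > 0 \<Longrightarrow> norm (\<theta> + \<nu> n *\<^sub>R \<tau> n) = 1"
    and B: "\<And>n. n > 0 \<Longrightarrow> norm (\<tau> n) \<le> B"
    and lim: "a \<longlonglongrightarrow> a'" "(\<lambda>n. a n + b n) \<longlonglongrightarrow> c'" "\<nu> \<longlonglongrightarrow> \<nu>'" "a' > 0"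
    and Y: "\<And>n. Y n \<in> borel_measurable (sample_law n (spike (a n) (b n) \<theta>))"
    and Y_eq: "\<And>n \<omega>. n > 0 \<Longrightarrow> Y n \<omega> = (\<Sum>i<n. L n (sgn (spike_isqrt (a n) (b n) \<theta> *v \<omega> i)) - \<mu> n) + C n"
    and L [measurable]: "\<And>n. L n \<in> borel_measurable borel" and L\<mu>: "\<And>n. n > 0 \<Longrightarrow> (\<integral>v. L n v \<partial>usphere) = \<mu> n"
    and d: "\<And>n w. n > 0 \<Longrightarrow> norm w = 1 \<Longrightarrow> \<bar>p / 2 * spike_dev (a n) (b n) (\<nu> n) \<theta> (\<tau> n) w - L n w\<bar> \<le> d n / sqrt (real n)"
    and d0: "d \<longlonglongrightarrow> 0"
    and C: "(\<lambda>n. C n + p / (2 * (p + 2)) * ((a n + b n) / a n * ((norm (\<tau> n))\<^sup>2 - (\<theta> \<bullet> \<tau> n)\<^sup>2))) \<longlonglongrightarrow> 0"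
  shows "o_P1 (\<lambda>n. sample_law n (spike (a n) (b n) \<theta>))
    (\<lambda>n \<omega>. log_lr n (spike (a n) (b n) \<theta>) (spike (a n) (b n) (\<theta> + \<nu> n *\<^sub>R \<tau> n)) \<omega> - Y n \<omega>)"
proof -
  interpret U: prob_space "usphere :: (real^'n) measure" by (rule prob_space_usphere)
  let ?X = "\<lambda>n. spike_dev (a n) (b n) (\<nu> n) \<theta> (\<tau> n)"
  define \<kappa> where "\<kappa> n = (a n + b n) / a n * (2 * B + \<nu> n * B\<^sup>2)" for n
  define K where "K n = \<kappa> n / sqrt (real n)" for n
  have p: "p > 0" by (simp add: p_def)
  have ab: "a n + b n > 0" if "n > 0" for n using a[OF that] b[OF that] by simp
  have \<nu>_pos: "\<nu> n > 0" if "n > 0" for n using \<nu>[OF that] a[OF that] b[OF that] that by simp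
  \<comment> \<open>The factor \<open>b\<close> cancels: this keeps the deviation of order
    \<open>1 / sqrt n\<close> however small \<open>b\<close> is.\<close>
  have b\<nu>: "b n * \<nu> n = (a n + b n) / sqrt (real n)" if "n > 0" for n using \<nu>[OF that] b[OF that] by simp
  have K: "\<bar>?X n w\<bar> \<le> K n" if "n > 0" "norm w = 1" for n w
  proof -
    have "\<bar>?X n w\<bar> \<le> b n * \<nu> n / a n * (2 * B + \<nu> n * B\<^sup>2)"
      by (rule spike_dev_bound_seq(2)) (use that a b \<theta> \<nu>_pos B in auto)
    also have "\<dots> = K n" unfolding b\<nu>[OF that(1)] K_def \<kappa>_def by simp
    finally show ?thesis .
  qed
  have Xint: "integrable usphere (?X n)" if "n > 0" for n
    by (rule integrable_usphere[OF _ K[OF that]]) measurable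
  have Lint: "integrable usphere (L n)" if "n > 0" for n
  proof (rule integrable_usphere)
    fix w :: "real^'n" assume w: "norm w = 1"
    have "\<bar>p / 2 * ?X n w\<bar> \<le> p / 2 * K n" unfolding abs_mult using K[OF that w] p by simp
    then show "\<bar>L n w\<bar> \<le> d n / sqrt (real n) + p / 2 * K n" using d[OF that w] by linarith
  qed measurable
  have inv0: "(\<lambda>n. 1 / sqrt (real n)) \<longlonglongrightarrow> 0" by real_asymp
  have \<kappa>: "\<kappa> \<longlonglongrightarrow> c' / a' * (2 * B + \<nu>' * B\<^sup>2)"
    unfolding \<kappa>_def using lim by (intro tendsto_intros) auto
  have K0: "K \<longlonglongrightarrow> 0"
    using tendsto_mult[OF \<kappa> inv0] by (simp add: K_def[abs_def])
  define s where "s n = (b n)\<^sup>2 * (\<nu> n)\<^sup>2 / (a n * (a n + b n)) * ((norm (\<tau> n))\<^sup>2 - (\<theta> \<bullet> \<tau> n)\<^sup>2)" for n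
  \<comment> \<open>This is \<open>n * s n\<close> with \<open>n\<close> cancelled. It stays bounded
    along the sequence, so \<open>s\<close> is of order \<open>1 / n\<close> and the product
    \<open>\<rho> * s\<close> in the drift vanishes.\<close>
  define \<rho> where "\<rho> n = (a n + b n) / a n * ((norm (\<tau> n))\<^sup>2 - (\<theta> \<bullet> \<tau> n)\<^sup>2)" for n
  have \<rho>s: "\<rho> n = real n * s n" if "n > 0" for n
  proof -
    have "(b n)\<^sup>2 * (\<nu> n)\<^sup>2 = (a n + b n)\<^sup>2 / real n"
      using b\<nu>[OF that] that by (simp add: power_divide flip: power_mult_distrib)
    then have "(b n)\<^sup>2 * (\<nu> n)\<^sup>2 / (a n * (a n + b n)) = (a n + b n) / (a n * real n)"
      using a[OF that] ab[OF that] that by (simp add: power2_eq_square)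
    then show ?thesis unfolding s_def \<rho>_def using that by simp
  qed
  have \<rho>b: "\<bar>\<rho> n\<bar> \<le> (a n + b n) / a n * B\<^sup>2" if "n > 0" for n
  proof -
    have "(\<theta> \<bullet> \<tau> n)\<^sup>2 \<le> (norm (\<tau> n))\<^sup>2"
      using Cauchy_Schwarz_ineq[of \<theta> "\<tau> n"] \<theta> by (simp add: power2_norm_eq_inner norm_eq_1)
    moreover have "(norm (\<tau> n))\<^sup>2 \<le> B\<^sup>2" using B[OF that] by (simp add: power_mono)
    ultimately have "\<bar>(norm (\<tau> n))\<^sup>2 - (\<theta> \<bullet> \<tau> n)\<^sup>2\<bar> \<le> B\<^sup>2" by (simp add: abs_le_iff) (smt (verit) zero_le_power2)
    then show ?thesis
      unfolding \<rho>_def abs_mult using a[OF that] ab[OF that] by (intro mult_mono) auto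
  qed
  have \<rho>2: "(\<lambda>n. 3 * \<rho> n * s n / (4 * (p + 2))) \<longlonglongrightarrow> 0"
  proof (rule Lim_null_comparison)
    show "\<forall>\<^sub>F n in sequentially. norm (3 * \<rho> n * s n / (4 * (p + 2))) \<le> 3 * ((a n + b n) / a n * B\<^sup>2)\<^sup>2 / (4 * (p + 2)) * (1 / real n)"
      using eventually_gt_at_top[of 0]
    proof eventually_elim
      fix n :: nat assume n: "n > 0"
      have "s n = \<rho> n / real n" using \<rho>s[OF n] n by simp
      then have "3 * \<rho> n * s n / (4 * (p + 2)) = 3 * (\<bar>\<rho> n\<bar>\<^sup>2) / (4 * (p + 2)) * (1 / real n)"
        unfolding power2_abs by (simp add: power2_eq_square mult.assoc)
      then have "norm (3 * \<rho> n * s n / (4 * (p + 2))) = 3 * (\<bar>\<rho> n\<bar>\<^sup>2) / (4 * (p + 2)) * (1 / real n)"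
        using p n by simp
      also have "\<dots> \<le> 3 * ((a n + b n) / a n * B\<^sup>2)\<^sup>2 / (4 * (p + 2)) * (1 / real n)"
        using p n power_mono[OF \<rho>b[OF n], of 2] by (intro mult_right_mono divide_right_mono mult_left_mono) auto
      finally show "norm (3 * \<rho> n * s n / (4 * (p + 2))) \<le> 3 * ((a n + b n) / a n * B\<^sup>2)\<^sup>2 / (4 * (p + 2)) * (1 / real n)" .
    qed
    have "(\<lambda>n. 3 * ((a n + b n) / a n * B\<^sup>2)\<^sup>2 / (4 * (p + 2)) * (1 / real n)) \<longlonglongrightarrow> 3 * (c' / a' * B\<^sup>2)\<^sup>2 / (4 * (p + 2)) * 0"
      using lim p by (intro tendsto_intros lim_1_over_n) auto
    then show "(\<lambda>n. 3 * ((a n + b n) / a n * B\<^sup>2)\<^sup>2 / (4 * (p + 2)) * (1 / real n)) \<longlonglongrightarrow> 0" by simp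
  qed
  show ?thesis
  \<comment> \<open>The factor 2 in \<open>D\<close> arises because centring adds the mean of the
    approximation error to the error itself.\<close>
  proof (rule spike_log_lr_o_P1[where l = "\<lambda>n w. L n w - \<mu> n" and K = K and D = "\<lambda>n. 2 * d n / sqrt (real n)", OF \<theta> a b \<theta>' Y])
    show "Y n \<omega> = (\<Sum>i<n. L n (sgn (spike_isqrt (a n) (b n) \<theta> *v \<omega> i)) - \<mu> n) + C n" if "n > 0" for n \<omega>
      by (rule Y_eq[OF that])
    show "(\<lambda>w. L n w - \<mu> n) \<in> borel_measurable borel" for n by measurable
    show "\<bar>?X n w\<bar> \<le> K n" if "n > 0" "norm w = 1" for n w by (rule K[OF that])
    show "(\<integral>v. L n v - \<mu> n \<partial>usphere) = 0" if "n > 0" for n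
      using Lint[OF that] L\<mu>[OF that] U.prob_space by simp
    show "K \<longlonglongrightarrow> 0" by (rule K0)
    have "(\<lambda>n. (\<kappa> n)\<^sup>2 * (1 / sqrt (real n))) \<longlonglongrightarrow> (c' / a' * (2 * B + \<nu>' * B\<^sup>2))\<^sup>2 * 0"
      by (intro tendsto_intros \<kappa> inv0)
    moreover have "(\<kappa> n)\<^sup>2 * (1 / sqrt (real n)) = sqrt (real n) * (K n)\<^sup>2" for n
      by (cases "n = 0") (simp_all add: K_def power_divide real_div_sqrt field_simps)
    ultimately show "(\<lambda>n. sqrt (real n) * (K n)\<^sup>2) \<longlonglongrightarrow> 0" by simp
    have "(\<lambda>n. \<kappa> n ^ 3 * (1 / sqrt (real n))) \<longlonglongrightarrow> (c' / a' * (2 * B + \<nu>' * B\<^sup>2)) ^ 3 * 0"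
      by (intro tendsto_intros \<kappa> inv0)
    moreover have "\<kappa> n ^ 3 * (1 / sqrt (real n)) = real n * K n ^ 3" for n
    proof (cases "n = 0")
      case False
      have "sqrt (real n) ^ 3 = real n * sqrt (real n)" by (simp add: power3_eq_cube)
      then show ?thesis using False by (simp add: K_def power_divide)
    qed (simp add: K_def)
    ultimately show "(\<lambda>n. real n * K n ^ 3) \<longlonglongrightarrow> 0" by simp
    show "(\<lambda>n. sqrt (real n) * (2 * d n / sqrt (real n))) \<longlonglongrightarrow> 0"
    proof (rule Lim_transform_eventually)
      show "(\<lambda>n. 2 * d n) \<longlonglongrightarrow> 0" using tendsto_mult_right_zero[OF d0] by blast
      show "\<forall>\<^sub>F n in sequentially. 2 * d n = sqrt (real n) * (2 * d n / sqrt (real n))"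
        using eventually_gt_at_top[of 0] by eventually_elim simp
    qed
    show "\<bar>real CARD('n) / 2 * (?X n w - (\<integral>v. ?X n v \<partial>usphere)) - (L n w - \<mu> n)\<bar> \<le> 2 * d n / sqrt (real n)"
      if n: "n > 0" and w: "norm w = 1" for n w
    proof -
      have "(\<integral>v. p / 2 * ?X n v - L n v \<partial>usphere) = p / 2 * (\<integral>v. ?X n v \<partial>usphere) - \<mu> n"
        using Xint[OF n] Lint[OF n] L\<mu>[OF n] by simp
      moreover have "\<bar>\<integral>v. p / 2 * ?X n v - L n v \<partial>usphere\<bar> \<le> d n / sqrt (real n)"
      proof -
        have "\<bar>\<integral>v. p / 2 * ?X n v - L n v \<partial>usphere\<bar> \<le> (\<integral>v. \<bar>p / 2 * ?X n v - L n v\<bar> \<partial>usphere)"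
          by (rule integral_abs_bound)
        also have "\<dots> \<le> (\<integral>v. d n / sqrt (real n) \<partial>(usphere :: (real^'n) measure))"
          using Xint[OF n] Lint[OF n] AE_usphere_norm d[OF n]
          by (intro integral_mono_AE) (auto elim!: eventually_mono)
        finally show ?thesis using U.prob_space by simp
      qed
      moreover note d[OF n w]
      ultimately show ?thesis by (simp add: p_def right_diff_distrib)
    qed
    show "(\<lambda>n. real n * (real CARD('n) / 2 * (\<integral>v. ?X n v \<partial>usphere) + real CARD('n) / 2 / 2 * (\<integral>v. (?X n v)\<^sup>2 \<partial>usphere)) - C n) \<longlonglongrightarrow> 0"
    proof (rule Lim_transform_eventually)
      show "(\<lambda>n. 3 * \<rho> n * s n / (4 * (p + 2)) - (C n + p / (2 * (p + 2)) * \<rho> n)) \<longlonglongrightarrow> 0"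
        using tendsto_diff[OF \<rho>2 C] by (simp add: \<rho>_def)
      show "\<forall>\<^sub>F n in sequentially. 3 * \<rho> n * s n / (4 * (p + 2)) - (C n + p / (2 * (p + 2)) * \<rho> n) =
        real n * (real CARD('n) / 2 * (\<integral>v. ?X n v \<partial>usphere) + real CARD('n) / 2 / 2 * (\<integral>v. (?X n v)\<^sup>2 \<partial>usphere)) - C n"
        using eventually_gt_at_top[of 0]
      proof eventually_elim
        fix n :: nat assume n: "n > 0"
        show "3 * \<rho> n * s n / (4 * (p + 2)) - (C n + p / (2 * (p + 2)) * \<rho> n) =
          real n * (real CARD('n) / 2 * (\<integral>v. ?X n v \<partial>usphere) + real CARD('n) / 2 / 2 * (\<integral>v. (?X n v)\<^sup>2 \<partial>usphere)) - C n"
          unfolding usphere_spike_dev[OF a[OF n] ab[OF n] \<theta> \<theta>'[OF n]] usphere_spike_dev_sq[OF a[OF n] ab[OF n] \<theta> \<theta>'[OF n]]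
            s_def[symmetric] p_def[symmetric]
          using lan_drift[OF p, of "real n" "\<rho> n" "s n"] n \<rho>s[OF n] by simp
      qed
    qed
  qed
qed

section \<open>Local alternatives\<close>

lemma outer_sgn: "(1 / (norm x)\<^sup>2) *\<^sub>R outer x x = outer (sgn x) (sgn x)"
  by (simp add: outer_def sgn_div_norm vec_eq_iff power2_eq_square divide_inverse mult_ac)

lemma S_stat_sgn:
  "S_stat n V \<omega> = (1 / real n) *\<^sub>R (\<Sum>i<n. outer (sgn (inv_sqrt_mat V *v \<omega> i)) (sgn (inv_sqrt_mat V *v \<omega> i)))"
  by (simp add: S_stat_def outer_sgn)

lemma matrix_vector_mult_sum_left: "(\<Sum>i\<in>I. A i) *v x = (\<Sum>i\<in>I. A i *v (x :: real^'n))"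
  by (induction I rule: infinite_finite_induct) (simp_all add: matrix_vector_mult_add_rdistrib)

lemma S_stat_inner:
  "x \<bullet> ((S_stat n V \<omega> - c *\<^sub>R mat 1) *v y)
    = (1 / real n) * (\<Sum>i<n. (x \<bullet> sgn (inv_sqrt_mat V *v \<omega> i)) * (y \<bullet> sgn (inv_sqrt_mat V *v \<omega> i))) - c * (x \<bullet> y)"
proof -
  have "(S_stat n V \<omega> - c *\<^sub>R mat 1) *v y
    = (1 / real n) *\<^sub>R (\<Sum>i<n. (sgn (inv_sqrt_mat V *v \<omega> i) \<bullet> y) *\<^sub>R sgn (inv_sqrt_mat V *v \<omega> i)) - c *\<^sub>R y"
    by (simp add: S_stat_sgn matrix_vector_mult_diff_rdistrib scaleR_matrix_vector_assoc[symmetric]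
        matrix_vector_mult_sum_left outer_mult)
  then show ?thesis
    by (simp add: inner_diff_right inner_sum_right inner_commute mult_ac)
qed

lemma S_stat_inner_sum:
  assumes "n > 0"
  shows "sqrt (real n) * (x \<bullet> ((S_stat n V \<omega> - c *\<^sub>R mat 1) *v y))
    = (\<Sum>i<n. ((x \<bullet> sgn (inv_sqrt_mat V *v \<omega> i)) * (y \<bullet> sgn (inv_sqrt_mat V *v \<omega> i)) - c * (x \<bullet> y)) / sqrt (real n))"
proof -
  have h: "r * (1 / (r * r) * S - k) = (S - (r * r) * k) / r" if "r > 0" for r S k :: real
    using that by (simp add: field_simps)
  have r: "sqrt (real n) > 0" "real n = sqrt (real n) * sqrt (real n)" using assms by simp_all
  have "sqrt (real n) * (1 / real n * S - k) = (S - real n * k) / sqrt (real n)" for S k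
    using h[OF r(1), of S k] by simp
  then show ?thesis
    unfolding S_stat_inner by (simp add: sum_divide_distrib[symmetric] sum_subtractf)
qed

lemma borel_measurable_S_stat_inner [measurable]:
  "(\<lambda>\<omega>. x \<bullet> ((S_stat n V \<omega> - c *\<^sub>R mat 1) *v y)) \<in> borel_measurable (sample_law n V')"
  unfolding S_stat_inner sample_law_def by measurable

text \<open>\<open>spike 1 (-1) \<theta>\<close> is the orthogonal projection along
  \<open>\<theta>\<close>, written as a spike to reuse the matrix calculus above.\<close>

lemma spike_proj:
  fixes \<theta> :: "real^'n"
  assumes "norm \<theta> = 1"
  shows "spike 1 (-1) \<theta> *v \<theta> = 0" "(norm (spike 1 (-1) \<theta> *v x))\<^sup>2 = (norm x)\<^sup>2 - (\<theta> \<bullet> x)\<^sup>2"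
    "x \<bullet> (spike 1 (-1) \<theta> *v x) = (norm (spike 1 (-1) \<theta> *v x))\<^sup>2" "norm (spike 1 (-1) \<theta> *v x) \<le> norm x"
    "\<theta> \<bullet> (spike 1 (-1) \<theta> *v x) = 0"
proof -
  have 1: "\<theta> \<bullet> \<theta> = 1" using assms by (simp add: norm_eq_1)
  show "spike 1 (-1) \<theta> *v \<theta> = 0" "\<theta> \<bullet> (spike 1 (-1) \<theta> *v x) = 0"
    by (simp_all add: spike_mult_vec inner_simps 1)
  show 2: "(norm (spike 1 (-1) \<theta> *v x))\<^sup>2 = (norm x)\<^sup>2 - (\<theta> \<bullet> x)\<^sup>2"
    unfolding power2_norm_eq_inner by (simp add: spike_mult_vec inner_simps 1 inner_commute power2_eq_square)
  show "x \<bullet> (spike 1 (-1) \<theta> *v x) = (norm (spike 1 (-1) \<theta> *v x))\<^sup>2"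
    unfolding 2 spike_inner by (simp add: power2_norm_eq_inner power2_eq_square[of "\<theta> \<bullet> x"])
  have "(norm (spike 1 (-1) \<theta> *v x))\<^sup>2 \<le> (norm x)\<^sup>2" unfolding 2 by simp
  then show "norm (spike 1 (-1) \<theta> *v x) \<le> norm x" by (rule power2_le_imp_le) simp
qed

text \<open>Expand the squared length. The vector \<open>\<tau>\<close> is tangent at
  \<open>\<theta>\<close> only up to an error of order \<open>\<nu>\<close>, negligible if
  \<open>\<nu>\<close> tends to 0 and visible in the limit otherwise.\<close>

lemma tangent_inner:
  assumes "norm (\<theta> + \<nu> *\<^sub>R \<tau>) = 1" "norm \<theta> = 1" "\<nu> > 0"
  shows "\<theta> \<bullet> \<tau> = - \<nu> * (norm \<tau>)\<^sup>2 / 2"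
proof -
  have "(norm (\<theta> + \<nu> *\<^sub>R \<tau>))\<^sup>2 = (norm \<theta>)\<^sup>2 + \<nu> * (2 * (\<theta> \<bullet> \<tau>) + \<nu> * (norm \<tau>)\<^sup>2)"
    unfolding power2_norm_eq_inner by (simp add: inner_simps inner_commute power2_eq_square algebra_simps)
  then have "2 * (\<theta> \<bullet> \<tau>) + \<nu> * (norm \<tau>)\<^sup>2 = 0" using assms by simp
  then show ?thesis by simp
qed

text \<open>Isolates the factor \<open>1 / sqrt n\<close> by means of
  \<open>b * \<nu> / (a * (a + b)) = 1 / (a * sqrt n)\<close>, leaving coefficients without division
  by \<open>b\<close>.\<close>

lemma spike_dev_local:
  fixes \<theta> \<tau> w :: "real^'n"
  assumes a: "a > 0" and b: "b > 0" and n: "n > 0" and \<nu>: "\<nu> = (a + b) / (sqrt n * b)"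
  shows "spike_dev a b \<nu> \<theta> \<tau> w = 2 / sqrt n * (sqrt (a + b) / a * (\<theta> \<bullet> w) * ((spike_sqrt a b \<theta> *v \<tau>) \<bullet> w)
      + \<nu> / (2 * a) * ((spike_sqrt a b \<theta> *v \<tau>) \<bullet> w)\<^sup>2)"
proof -
  let ?u = "(spike_sqrt a b \<theta> *v \<tau>) \<bullet> w"
  have 1: "b / (a * (a + b)) * \<nu> = 1 / (a * sqrt n)" using a b n by (simp add: \<nu>)
  have 2: "spike_dev a b \<nu> \<theta> \<tau> w = (b / (a * (a + b)) * \<nu>) * (2 * sqrt (a + b) * (\<theta> \<bullet> w) * ?u + \<nu> * ?u\<^sup>2)"
    by (simp add: spike_dev_def power2_eq_square algebra_simps)
  show ?thesis unfolding 2 1 using a n by (simp add: field_simps)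
qed

text \<open>Regimes (i) and (ii), where \<open>\<nu>\<close> tends to 0. Both the radial part of
  \<open>\<tau>\<close> and the quadratic term of the deviation are then of relative order
  \<open>\<nu>\<close>, so only the product of the tangential part with
  \<open>\<theta> \<bullet> w\<close> remains. The constant \<open>\<gamma>\<close> is the limiting
  ratio of the eigenvalues of the null shape, and is 1 in regime (ii).\<close>

theorem spike_lan_normal:
  fixes \<theta> :: "real^'n" and \<tau> :: "nat \<Rightarrow> real^'n"
  defines "p \<equiv> real CARD('n)" and "Pr \<equiv> mat 1 - outer \<theta> \<theta>"
  assumes \<theta>: "norm \<theta> = 1" and a: "\<And>n. n > 0 \<Longrightarrow> a n > 0" and b: "\<And>n. n > 0 \<Longrightarrow> b n > 0"
    and \<nu>: "\<And>n. n > 0 \<Longrightarrow> \<nu> n = (a n + b n) / (sqrt (real n) * b n)"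
    and \<theta>': "\<And>n. n > 0 \<Longrightarrow> norm (\<theta> + \<nu> n *\<^sub>R \<tau> n) = 1"
    and B: "\<And>n. n > 0 \<Longrightarrow> norm (\<tau> n) \<le> B"
    and lim: "a \<longlonglongrightarrow> a'" "(\<lambda>n. a n + b n) \<longlonglongrightarrow> c'" "\<nu> \<longlonglongrightarrow> 0" "a' > 0"
    and \<gamma>: "\<gamma> = c' / a'"
  defines "\<Delta> \<equiv> \<lambda>n \<omega>. (p * sqrt \<gamma>) *\<^sub>R
      ((Pr ** (sqrt (real n) *\<^sub>R (S_stat n (spike (a n) (b n) \<theta>) \<omega> - (1 / p) *\<^sub>R mat 1))) *v \<theta>)"
    and "\<Gamma> \<equiv> (p * \<gamma> / (p + 2)) *\<^sub>R Pr"
  shows "o_P1 (\<lambda>n. sample_law n (spike (a n) (b n) \<theta>))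
      (\<lambda>n \<omega>. log_lr n (spike (a n) (b n) \<theta>) (spike (a n) (b n) (\<theta> + \<nu> n *\<^sub>R \<tau> n)) \<omega>
        - (\<tau> n \<bullet> \<Delta> n \<omega> - 1 / 2 * (\<tau> n \<bullet> (\<Gamma> *v \<tau> n))))"
    and "asymp_normal (\<lambda>n. sample_law n (spike (a n) (b n) \<theta>)) \<Delta> (\<lambda>t. t \<bullet> (\<Gamma> *v t))"
proof -
  let ?V = "\<lambda>n. spike (a n) (b n) \<theta>"
  let ?T = "\<lambda>n u. sgn (spike_isqrt (a n) (b n) \<theta> *v u)"
  have p: "p > 0" by (simp add: p_def)
  have ab: "a n + b n > 0" if "n > 0" for n using a[OF that] b[OF that] by simp
  have \<nu>_pos: "\<nu> n > 0" if "n > 0" for n using \<nu>[OF that] a[OF that] b[OF that] that by simp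
  have B0: "B \<ge> 0" using B[of 1] norm_ge_zero[of "\<tau> 1"] by linarith
  have Pr: "Pr = spike 1 (-1) \<theta>" by (simp add: Pr_def spike_def)
  have symP: "x \<bullet> (Pr *v y) = (Pr *v x) \<bullet> y" for x y
    unfolding Pr by (intro symmetric_matrix_inner transpose_spike)
  have quadP: "t \<bullet> (\<Gamma> *v t) = p * \<gamma> / (p + 2) * (norm (Pr *v t))\<^sup>2" for t
    by (simp add: \<Gamma>_def scaleR_matrix_vector_assoc[symmetric] spike_proj[OF \<theta>] Pr)
  have c': "c' \<ge> 0"
    by (rule LIMSEQ_le_const[OF lim(2)]) (use ab in \<open>auto intro!: exI[of _ 1] less_imp_le\<close>)
  have \<gamma>0: "\<gamma> \<ge> 0" using c' lim(4) by (simp add: \<gamma>)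
  have \<Delta>_inner: "t \<bullet> \<Delta> n \<omega> = p * sqrt \<gamma> * (sqrt (real n) * ((Pr *v t) \<bullet> ((S_stat n (?V n) \<omega> - (1 / p) *\<^sub>R mat 1) *v \<theta>)))" for t n \<omega>
    by (simp add: \<Delta>_def matrix_vector_mul_assoc[symmetric] symP scaleR_matrix_vector_assoc[symmetric])
  have \<Delta>_sum: "t \<bullet> \<Delta> n \<omega> = (\<Sum>i<n. p * sqrt \<gamma> / sqrt (real n) * ((Pr *v t) \<bullet> ?T n (\<omega> i)) * (\<theta> \<bullet> ?T n (\<omega> i)))"
    if n: "n > 0" for t n \<omega>
  proof -
    \<comment> \<open>Orthogonality makes the centring by \<open>1 / p\<close> times the identity
      disappear from the sum.\<close>
    have "(Pr *v t) \<bullet> \<theta> = 0" by (simp add: Pr inner_commute[of _ \<theta>] spike_proj[OF \<theta>])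
    then show ?thesis
      unfolding \<Delta>_inner S_stat_inner_sum[OF n] inv_sqrt_mat_spike[OF a[OF n] ab[OF n] \<theta>]
      by (simp add: sum_distrib_left mult_ac)
  qed
  have \<Delta>_meas: "(\<lambda>\<omega>. t \<bullet> \<Delta> n \<omega>) \<in> borel_measurable (sample_law n (?V n))" for t n
    unfolding \<Delta>_inner by measurable
  show "o_P1 (\<lambda>n. sample_law n (?V n))
      (\<lambda>n \<omega>. log_lr n (?V n) (spike (a n) (b n) (\<theta> + \<nu> n *\<^sub>R \<tau> n)) \<omega>
        - (\<tau> n \<bullet> \<Delta> n \<omega> - 1 / 2 * (\<tau> n \<bullet> (\<Gamma> *v \<tau> n))))"
  proof (rule spike_local_expansion[OF \<theta> a b \<nu> \<theta>' B lim])
    define L where "L n w = p * sqrt \<gamma> / sqrt (real n) * ((Pr *v \<tau> n) \<bullet> w) * (\<theta> \<bullet> w)" for n :: nat and w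
    \<comment> \<open>The first term pays for replacing the eigenvalue ratio by its limit. The
      second is shared equally by the radial part of \<open>\<tau>\<close> and by the quadratic
      term.\<close>
    define d where "d n = p * (\<bar>sqrt ((a n + b n) / a n) - sqrt \<gamma>\<bar> * B + (a n + b n) / a n * \<nu> n * B\<^sup>2)" for n
    show "(\<lambda>\<omega>. \<tau> n \<bullet> \<Delta> n \<omega> - 1 / 2 * (\<tau> n \<bullet> (\<Gamma> *v \<tau> n))) \<in> borel_measurable (sample_law n (?V n))" for n
      using \<Delta>_meas by measurable
    show "\<tau> n \<bullet> \<Delta> n \<omega> - 1 / 2 * (\<tau> n \<bullet> (\<Gamma> *v \<tau> n)) = (\<Sum>i<n. L n (?T n (\<omega> i)) - 0) + - (1 / 2 * (\<tau> n \<bullet> (\<Gamma> *v \<tau> n)))"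
      if "n > 0" for n \<omega>
      unfolding \<Delta>_sum[OF that] L_def by simp
    show "L n \<in> borel_measurable borel" for n unfolding L_def by measurable
    have "(\<lambda>w. p * sqrt \<gamma> / sqrt (real n) * (((Pr *v \<tau> n) \<bullet> w) * (\<theta> \<bullet> w))) = L n" for n
      by (simp add: L_def fun_eq_iff)
    moreover have "(\<integral>w. p * sqrt \<gamma> / sqrt (real n) * (((Pr *v \<tau> n) \<bullet> w) * (\<theta> \<bullet> w)) \<partial>usphere) = 0" for n
      by (simp add: usphere_inner2 Pr inner_commute[of _ \<theta>] spike_proj[OF \<theta>])
    ultimately show "(\<integral>v. L n v \<partial>usphere) = 0" if "n > 0" for n by simp
    show "\<bar>real CARD('n) / 2 * spike_dev (a n) (b n) (\<nu> n) \<theta> (\<tau> n) w - L n w\<bar> \<le> d n / sqrt (real n)"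
      if n: "n > 0" and w: "norm w = 1" for n w
    proof -
      let ?u = "spike_sqrt (a n) (b n) \<theta> *v \<tau> n" and ?l = "sqrt ((a n + b n) / a n)" and ?t = "\<theta> \<bullet> \<tau> n"
      have an: "a n > 0" and abn: "a n + b n > 0" by (rule a[OF n], rule ab[OF n])
      \<comment> \<open>Eigenvalue splitting of the root: \<open>sqrt a\<close> on the tangential
        part, \<open>sqrt (a + b)\<close> on the radial part, whose coefficient
        \<open>\<theta> \<bullet> \<tau> n\<close> is of order \<open>\<nu>\<close>.\<close>
      have u_eq: "?u \<bullet> w = sqrt (a n) * ((Pr *v \<tau> n) \<bullet> w) + sqrt (a n + b n) * ?t * (\<theta> \<bullet> w)"
        by (simp add: spike_sqrt_def Pr spike_mult_vec inner_simps algebra_simps)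
      have l1: "sqrt (a n + b n) / a n * sqrt (a n) = ?l"
        using an by (simp add: real_sqrt_divide real_div_sqrt field_simps)
      have l2: "sqrt (a n + b n) / a n * sqrt (a n + b n) = (a n + b n) / a n" using abn by simp
      have "real CARD('n) / 2 * spike_dev (a n) (b n) (\<nu> n) \<theta> (\<tau> n) w
          = p / sqrt (real n) * (sqrt (a n + b n) / a n * (\<theta> \<bullet> w) * (?u \<bullet> w) + \<nu> n / (2 * a n) * (?u \<bullet> w)\<^sup>2)"
      proof -
        have "real n > 0" using n by simp
        have h: "c / 2 * (2 / r * q) = c / r * q" for c r q :: real by simp
        show ?thesis unfolding spike_dev_local[OF an b[OF n] \<open>real n > 0\<close> \<nu>[OF n]] p_def h ..
      qed
      also have "sqrt (a n + b n) / a n * (\<theta> \<bullet> w) * (?u \<bullet> w)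
          = (sqrt (a n + b n) / a n * sqrt (a n)) * ((Pr *v \<tau> n) \<bullet> w) * (\<theta> \<bullet> w)
            + (sqrt (a n + b n) / a n * sqrt (a n + b n)) * ?t * (\<theta> \<bullet> w)\<^sup>2"
        unfolding u_eq by (simp add: power2_eq_square distrib_left mult_ac)
      finally have eq: "real CARD('n) / 2 * spike_dev (a n) (b n) (\<nu> n) \<theta> (\<tau> n) w - L n w
          = p / sqrt (real n) * ((?l - sqrt \<gamma>) * (((Pr *v \<tau> n) \<bullet> w) * (\<theta> \<bullet> w))
             + ((a n + b n) / a n * (?t * (\<theta> \<bullet> w)\<^sup>2) + \<nu> n / (2 * a n) * (?u \<bullet> w)\<^sup>2))"
        unfolding l1 l2 L_def by (simp add: algebra_simps)
      have tw: "\<bar>\<theta> \<bullet> w\<bar> \<le> 1" using abs_inner_le_unit[OF w, of \<theta>] \<theta> by simp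
      then have tw2: "(\<theta> \<bullet> w)\<^sup>2 \<le> 1" by (simp add: abs_square_le_1)
      have "\<bar>(Pr *v \<tau> n) \<bullet> w\<bar> \<le> B"
        using abs_inner_le_unit[OF w, of "Pr *v \<tau> n"] spike_proj(4)[OF \<theta>, of "\<tau> n"] B[OF n] by (simp add: Pr)
      then have "\<bar>((Pr *v \<tau> n) \<bullet> w) * (\<theta> \<bullet> w)\<bar> \<le> B * 1"
        unfolding abs_mult using tw B0 by (intro mult_mono) auto
      then have 1: "\<bar>(?l - sqrt \<gamma>) * (((Pr *v \<tau> n) \<bullet> w) * (\<theta> \<bullet> w))\<bar> \<le> \<bar>?l - sqrt \<gamma>\<bar> * B"
        unfolding abs_mult[of "?l - sqrt \<gamma>"] by (intro mult_left_mono) auto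
      have "\<bar>?t\<bar> \<le> \<nu> n * B\<^sup>2 / 2"
        unfolding tangent_inner[OF \<theta>'[OF n] \<theta> \<nu>_pos[OF n]] using \<nu>_pos[OF n] power_mono[OF B[OF n], of 2]
        by (simp add: abs_mult)
      then have "\<bar>?t * (\<theta> \<bullet> w)\<^sup>2\<bar> \<le> \<nu> n * B\<^sup>2 / 2 * 1"
        unfolding abs_mult using tw2 \<nu>_pos[OF n] by (intro mult_mono) auto
      then have 2: "\<bar>(a n + b n) / a n * (?t * (\<theta> \<bullet> w)\<^sup>2)\<bar> \<le> (a n + b n) / a n * (\<nu> n * B\<^sup>2 / 2)"
        unfolding abs_mult[of "(a n + b n) / a n"] using an abn by (intro mult_mono) auto
      have "\<bar>?u \<bullet> w\<bar> \<le> sqrt (a n + b n) * B"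
        using abs_inner_le_unit[OF w, of ?u] spike_dev_bound_seq(1)[OF an b[OF n] \<theta> w \<nu>_pos[OF n] B[OF n]] by linarith
      then have "(?u \<bullet> w)\<^sup>2 \<le> (sqrt (a n + b n) * B)\<^sup>2"
        using power_mono[of "\<bar>?u \<bullet> w\<bar>" "sqrt (a n + b n) * B" 2] by simp
      also have "\<dots> = (a n + b n) * B\<^sup>2" using abn by (simp add: power_mult_distrib)
      finally have "\<nu> n / (2 * a n) * (?u \<bullet> w)\<^sup>2 \<le> \<nu> n / (2 * a n) * ((a n + b n) * B\<^sup>2)"
        using \<nu>_pos[OF n] an by (intro mult_left_mono) auto
      then have 3: "\<bar>\<nu> n / (2 * a n) * (?u \<bullet> w)\<^sup>2\<bar> \<le> (a n + b n) / a n * (\<nu> n * B\<^sup>2 / 2)"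
        using \<nu>_pos[OF n] an by (simp add: mult_ac)
      have "\<bar>(?l - sqrt \<gamma>) * (((Pr *v \<tau> n) \<bullet> w) * (\<theta> \<bullet> w))
             + ((a n + b n) / a n * (?t * (\<theta> \<bullet> w)\<^sup>2) + \<nu> n / (2 * a n) * (?u \<bullet> w)\<^sup>2)\<bar>
          \<le> \<bar>?l - sqrt \<gamma>\<bar> * B + (a n + b n) / a n * \<nu> n * B\<^sup>2"
      proof -
        have "\<bar>x + (y + z)\<bar> \<le> X + (Y + Y)" if "\<bar>x\<bar> \<le> X" "\<bar>y\<bar> \<le> Y" "\<bar>z\<bar> \<le> Y" for x y z X Y :: real
          using that by linarith
        note this[OF 1 2 3]
        also have "(a n + b n) / a n * (\<nu> n * B\<^sup>2 / 2) + (a n + b n) / a n * (\<nu> n * B\<^sup>2 / 2) = (a n + b n) / a n * \<nu> n * B\<^sup>2"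
          by simp
        finally show ?thesis .
      qed
      then have "p / sqrt (real n) * \<bar>(?l - sqrt \<gamma>) * (((Pr *v \<tau> n) \<bullet> w) * (\<theta> \<bullet> w))
             + ((a n + b n) / a n * (?t * (\<theta> \<bullet> w)\<^sup>2) + \<nu> n / (2 * a n) * (?u \<bullet> w)\<^sup>2)\<bar>
          \<le> p / sqrt (real n) * (\<bar>?l - sqrt \<gamma>\<bar> * B + (a n + b n) / a n * \<nu> n * B\<^sup>2)"
        using p by (intro mult_left_mono) auto
      then show ?thesis unfolding eq abs_mult[of "p / sqrt (real n)"] d_def using p by simp
    qed
    have "d \<longlonglongrightarrow> p * (\<bar>sqrt (c' / a') - sqrt \<gamma>\<bar> * B + c' / a' * 0 * B\<^sup>2)"
      unfolding d_def using lim by (intro tendsto_intros) auto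
    then show "d \<longlonglongrightarrow> 0" by (simp add: \<gamma>)
    \<comment> \<open>The drift contains the eigenvalue ratio at stage \<open>n\<close>, whereas
      \<open>\<Gamma>\<close> contains its limit; boundedness of \<open>\<tau>\<close> absorbs the
      difference.\<close>
    have lim0: "(\<lambda>n. p / (2 * (p + 2)) * (((a n + b n) / a n - \<gamma>) * (norm (Pr *v \<tau> n))\<^sup>2)) \<longlonglongrightarrow> 0"
    proof (rule tendsto_mult_right_zero, rule Lim_null_comparison)
      have "(\<lambda>n. \<bar>(a n + b n) / a n - \<gamma>\<bar> * B\<^sup>2) \<longlonglongrightarrow> \<bar>c' / a' - \<gamma>\<bar> * B\<^sup>2"
        using lim by (intro tendsto_intros) auto
      then show "(\<lambda>n. \<bar>(a n + b n) / a n - \<gamma>\<bar> * B\<^sup>2) \<longlonglongrightarrow> 0" by (simp add: \<gamma>)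
      show "\<forall>\<^sub>F n in sequentially. norm (((a n + b n) / a n - \<gamma>) * (norm (Pr *v \<tau> n))\<^sup>2) \<le> \<bar>(a n + b n) / a n - \<gamma>\<bar> * B\<^sup>2"
        using eventually_gt_at_top[of 0]
      proof eventually_elim
        fix n :: nat assume n: "n > 0"
        have "norm (Pr *v \<tau> n) \<le> B" using spike_proj(4)[OF \<theta>, of "\<tau> n"] B[OF n] by (simp add: Pr)
        then have "(norm (Pr *v \<tau> n))\<^sup>2 \<le> B\<^sup>2" by (simp add: power_mono)
        then show "norm (((a n + b n) / a n - \<gamma>) * (norm (Pr *v \<tau> n))\<^sup>2) \<le> \<bar>(a n + b n) / a n - \<gamma>\<bar> * B\<^sup>2"
          by (simp add: abs_mult mult_left_mono)
      qed
    qed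
    have "- (1 / 2 * (\<tau> n \<bullet> (\<Gamma> *v \<tau> n))) + real CARD('n) / (2 * (real CARD('n) + 2)) * ((a n + b n) / a n * ((norm (\<tau> n))\<^sup>2 - (\<theta> \<bullet> \<tau> n)\<^sup>2))
        = p / (2 * (p + 2)) * (((a n + b n) / a n - \<gamma>) * (norm (Pr *v \<tau> n))\<^sup>2)" for n
    proof -
      have h: "1 / 2 * (p * \<gamma> / (p + 2) * x) = p / (2 * (p + 2)) * (\<gamma> * x)" for x using p by simp
      show ?thesis
        unfolding quadP spike_proj(2)[OF \<theta>, symmetric] Pr[symmetric] p_def[symmetric] h
        by (simp only: left_diff_distrib right_diff_distrib)
    qed
    then show "(\<lambda>n. - (1 / 2 * (\<tau> n \<bullet> (\<Gamma> *v \<tau> n))) + real CARD('n) / (2 * (real CARD('n) + 2)) * ((a n + b n) / a n * ((norm (\<tau> n))\<^sup>2 - (\<theta> \<bullet> \<tau> n)\<^sup>2))) \<longlonglongrightarrow> 0"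
      using lim0 by simp
  qed
  show "asymp_normal (\<lambda>n. sample_law n (?V n)) \<Delta> (\<lambda>t. t \<bullet> (\<Gamma> *v t))"
    unfolding sample_law_def
  \<comment> \<open>The witness \<open>L\<close> is a multiple of the projection because
    \<open>\<Gamma>\<close> is; the bound \<open>K\<close> uses that
    \<open>\<theta> \<bullet> w\<close> and \<open>Pr *v w\<close> have size at most one.\<close>
  proof (rule asymp_normal_iid[where T = ?T and N = usphere and K = "p * sqrt \<gamma>"
        and Y = "\<lambda>w. (p * sqrt \<gamma> * (\<theta> \<bullet> w)) *\<^sub>R (Pr *v w)" and L = "\<lambda>t. sqrt (p * \<gamma> / (p + 2)) *\<^sub>R (Pr *v t)"])
    show "prob_space (angular_gaussian (?V n))" if "n > 0" for n
      by (rule prob_space_angular_gaussian_spike[OF a[OF that] ab[OF that] \<theta>])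
    show "?T n \<in> angular_gaussian (?V n) \<rightarrow>\<^sub>M usphere" for n by measurable
    show "distr (angular_gaussian (?V n)) usphere (?T n) = usphere" if "n > 0" for n
      using distr_angular_gaussian_spike[OF a[OF that] ab[OF that] \<theta>] by (simp cong: distr_cong)
    show "prob_space (usphere :: (real^'n) measure)" by (rule prob_space_usphere)
    show "(\<lambda>w. (p * sqrt \<gamma> * (\<theta> \<bullet> w)) *\<^sub>R (Pr *v w)) \<in> borel_measurable usphere" by measurable
    show "AE w in usphere. norm ((p * sqrt \<gamma> * (\<theta> \<bullet> w)) *\<^sub>R (Pr *v w)) \<le> p * sqrt \<gamma>"
      using AE_usphere_norm
    proof eventually_elim
      fix w :: "real^'n" assume w: "norm w = 1"
      have "\<bar>\<theta> \<bullet> w\<bar> * norm (Pr *v w) \<le> 1 * 1"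
        using abs_inner_le_unit[OF w, of \<theta>] \<theta> spike_proj(4)[OF \<theta>, of w] w by (intro mult_mono) (auto simp: Pr)
      then show "norm ((p * sqrt \<gamma> * (\<theta> \<bullet> w)) *\<^sub>R (Pr *v w)) \<le> p * sqrt \<gamma>"
        using p \<gamma>0 by (simp add: abs_mult mult.assoc mult_left_le)
    qed
    have tY: "t \<bullet> ((p * sqrt \<gamma> * (\<theta> \<bullet> w)) *\<^sub>R (Pr *v w)) = p * sqrt \<gamma> * ((\<theta> \<bullet> w) * ((Pr *v t) \<bullet> w))" for t w
      by (simp add: symP)
    show "(\<integral>w. t \<bullet> ((p * sqrt \<gamma> * (\<theta> \<bullet> w)) *\<^sub>R (Pr *v w)) \<partial>usphere) = 0" for t
      unfolding tY by (simp add: usphere_inner2 Pr spike_proj[OF \<theta>])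
    show "\<Delta> n \<in> borel_measurable (PiM {..<n} (\<lambda>_. angular_gaussian (?V n)))" for n
      unfolding sample_law_def[symmetric]
      by (subst borel_measurable_euclidean_space) (use \<Delta>_meas in \<open>simp add: inner_commute\<close>)
    show "\<Delta> n \<omega> = (1 / sqrt (real n)) *\<^sub>R (\<Sum>i<n. (p * sqrt \<gamma> * (\<theta> \<bullet> ?T n (\<omega> i))) *\<^sub>R (Pr *v ?T n (\<omega> i)))"
      if n: "n > 0" for n \<omega>
    proof (rule vector_eq_ldot[THEN iffD1], rule allI)
      fix t
      show "t \<bullet> \<Delta> n \<omega> = t \<bullet> ((1 / sqrt (real n)) *\<^sub>R (\<Sum>i<n. (p * sqrt \<gamma> * (\<theta> \<bullet> ?T n (\<omega> i))) *\<^sub>R (Pr *v ?T n (\<omega> i))))"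
        unfolding \<Delta>_sum[OF n] inner_scaleR_right inner_sum_right tY sum_distrib_left
        by (intro sum.cong refl) (simp add: symP)
    qed
    show "t \<bullet> (\<Gamma> *v t) = (\<integral>w. (t \<bullet> ((p * sqrt \<gamma> * (\<theta> \<bullet> w)) *\<^sub>R (Pr *v w)))\<^sup>2 \<partial>usphere)" for t
    proof -
      have "(t \<bullet> ((p * sqrt \<gamma> * (\<theta> \<bullet> w)) *\<^sub>R (Pr *v w)))\<^sup>2
          = p\<^sup>2 * \<gamma> * ((\<theta> \<bullet> w) * (\<theta> \<bullet> w) * ((Pr *v t) \<bullet> w) * ((Pr *v t) \<bullet> w))" for w
        unfolding tY using \<gamma>0 by (simp add: power_mult_distrib power2_eq_square[of "_ \<bullet> w"] mult_ac)
      then have "(\<integral>w. (t \<bullet> ((p * sqrt \<gamma> * (\<theta> \<bullet> w)) *\<^sub>R (Pr *v w)))\<^sup>2 \<partial>usphere)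
         = p\<^sup>2 * \<gamma> * ((norm (Pr *v t))\<^sup>2 / (p * (p + 2)))"
        using \<theta> by (simp add: usphere_inner4 Pr spike_proj[OF \<theta>] norm_eq_1 p_def power2_norm_eq_inner)
      then show ?thesis unfolding quadP using p by (simp add: power2_eq_square)
    qed
    show "linear (\<lambda>t. sqrt (p * \<gamma> / (p + 2)) *\<^sub>R (Pr *v t))"
      by (intro linear_compose_scale_right matrix_vector_mul_linear)
    show "t \<bullet> (\<Gamma> *v t) = (norm (sqrt (p * \<gamma> / (p + 2)) *\<^sub>R (Pr *v t)))\<^sup>2" for t
      unfolding quadP using p \<gamma>0 by (simp add: power_mult_distrib)
  qed
qed

text \<open>Regime (iii): the null shape tends to the identity, but \<open>\<nu>\<close> tends to
  \<open>1 / \<xi>\<close>, so the quadratic term of the deviation has the same order as the linear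
  one. It yields the form in \<open>\<tau> n\<close> on both sides, and the radial part of
  \<open>\<tau> n\<close> yields the fourth power in the drift.\<close>

lemma spike_lan_contiguous:
  fixes \<theta> :: "real^'n" and \<tau> :: "nat \<Rightarrow> real^'n"
  defines "p \<equiv> real CARD('n)"
  assumes \<theta>: "norm \<theta> = 1" and a: "\<And>n. n > 0 \<Longrightarrow> a n > 0" and b: "\<And>n. n > 0 \<Longrightarrow> b n > 0"
    and \<nu>: "\<And>n. n > 0 \<Longrightarrow> \<nu> n = (a n + b n) / (sqrt (real n) * b n)"
    and \<theta>': "\<And>n. n > 0 \<Longrightarrow> norm (\<theta> + \<nu> n *\<^sub>R \<tau> n) = 1"
    and B: "\<And>n. n > 0 \<Longrightarrow> norm (\<tau> n) \<le> B"
    and lim: "a \<longlonglongrightarrow> 1" "(\<lambda>n. a n + b n) \<longlonglongrightarrow> 1" "\<nu> \<longlonglongrightarrow> 1 / \<xi>" and \<xi>: "\<xi> > 0"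
  defines "\<Upsilon> \<equiv> \<lambda>n \<omega>. (p * sqrt (real n)) *\<^sub>R (S_stat n (spike (a n) (b n) \<theta>) \<omega> - (1 / p) *\<^sub>R mat 1)"
  shows "o_P1 (\<lambda>n. sample_law n (spike (a n) (b n) \<theta>))
      (\<lambda>n \<omega>. log_lr n (spike (a n) (b n) \<theta>) (spike (a n) (b n) (\<theta> + \<nu> n *\<^sub>R \<tau> n)) \<omega>
        - (\<tau> n \<bullet> (\<Upsilon> n \<omega> *v \<theta>) + 1 / (2 * \<xi>) * (\<tau> n \<bullet> (\<Upsilon> n \<omega> *v \<tau> n))
           - p / (2 * (p + 2)) * ((norm (\<tau> n))\<^sup>2 - 1 / (4 * \<xi>\<^sup>2) * (norm (\<tau> n)) ^ 4)))"
proof -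
  let ?V = "\<lambda>n. spike (a n) (b n) \<theta>"
  let ?T = "\<lambda>n u. sgn (spike_isqrt (a n) (b n) \<theta> *v u)"
  have p: "p > 0" by (simp add: p_def)
  have ab: "a n + b n > 0" if "n > 0" for n using a[OF that] b[OF that] by simp
  have \<nu>_pos: "\<nu> n > 0" if "n > 0" for n using \<nu>[OF that] a[OF that] b[OF that] that by simp
  have B0: "B \<ge> 0" using B[of 1] norm_ge_zero[of "\<tau> 1"] by linarith
  have \<Upsilon>_inner: "x \<bullet> (\<Upsilon> n \<omega> *v y) = p * (sqrt (real n) * (x \<bullet> ((S_stat n (?V n) \<omega> - (1 / p) *\<^sub>R mat 1) *v y)))" for x y n \<omega>
    by (simp add: \<Upsilon>_def scaleR_matrix_vector_assoc[symmetric])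
  define L where "L n w = p / sqrt (real n) * ((\<tau> n \<bullet> w) * (\<theta> \<bullet> w)) + p / (sqrt (real n) * (2 * \<xi>)) * ((\<tau> n \<bullet> w) * (\<tau> n \<bullet> w))" for n :: nat and w
  \<comment> \<open>The mean of \<open>L n\<close>, by second moments of the uniform law; it is
    exactly what the centring of \<open>\<Upsilon>\<close> subtracts per observation.\<close>
  define \<mu> where "\<mu> n = p / sqrt (real n) * ((\<tau> n \<bullet> \<theta>) / p) + p / (sqrt (real n) * (2 * \<xi>)) * ((\<tau> n \<bullet> \<tau> n) / p)" for n :: nat
  define C where "C n = - (p / (2 * (p + 2)) * ((norm (\<tau> n))\<^sup>2 - 1 / (4 * \<xi>\<^sup>2) * (norm (\<tau> n)) ^ 4))" for n
  \<comment> \<open>Bounds the effect of the root of the null shape on \<open>\<tau> n\<close>; it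
    vanishes because that root tends to the identity.\<close>
  define \<epsilon> where "\<epsilon> n = \<bar>sqrt (a n) - 1\<bar> * B + \<bar>sqrt (a n + b n) - sqrt (a n)\<bar> * B" for n
  define d where "d n = p * (\<bar>sqrt (a n + b n) / a n - 1\<bar> * (sqrt (a n + b n) * B) + \<epsilon> n
      + (\<bar>\<nu> n / (2 * a n) - 1 / (2 * \<xi>)\<bar> * ((a n + b n) * B\<^sup>2) + 1 / (2 * \<xi>) * (\<epsilon> n * (sqrt (a n + b n) * B + B))))" for n
  show ?thesis
  proof (rule spike_local_expansion[OF \<theta> a b \<nu> \<theta>' B lim, where L = L and \<mu> = \<mu> and C = C and d = d])
    show "(\<lambda>\<omega>. \<tau> n \<bullet> (\<Upsilon> n \<omega> *v \<theta>) + 1 / (2 * \<xi>) * (\<tau> n \<bullet> (\<Upsilon> n \<omega> *v \<tau> n))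
           - p / (2 * (p + 2)) * ((norm (\<tau> n))\<^sup>2 - 1 / (4 * \<xi>\<^sup>2) * (norm (\<tau> n)) ^ 4)) \<in> borel_measurable (sample_law n (?V n))" for n
      unfolding \<Upsilon>_inner by measurable
    show "\<tau> n \<bullet> (\<Upsilon> n \<omega> *v \<theta>) + 1 / (2 * \<xi>) * (\<tau> n \<bullet> (\<Upsilon> n \<omega> *v \<tau> n))
           - p / (2 * (p + 2)) * ((norm (\<tau> n))\<^sup>2 - 1 / (4 * \<xi>\<^sup>2) * (norm (\<tau> n)) ^ 4)
        = (\<Sum>i<n. L n (?T n (\<omega> i)) - \<mu> n) + C n" if n: "n > 0" for n \<omega>
    proof -
      have "\<tau> n \<bullet> (\<Upsilon> n \<omega> *v \<theta>) + 1 / (2 * \<xi>) * (\<tau> n \<bullet> (\<Upsilon> n \<omega> *v \<tau> n)) = (\<Sum>i<n. L n (?T n (\<omega> i)) - \<mu> n)"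
        unfolding \<Upsilon>_inner S_stat_inner_sum[OF n] inv_sqrt_mat_spike[OF a[OF n] ab[OF n] \<theta>] sum_distrib_left sum.distrib[symmetric]
        using p n \<xi> by (intro sum.cong refl) (simp add: L_def \<mu>_def field_simps)
      then show ?thesis by (simp add: C_def)
    qed
    show "L n \<in> borel_measurable borel" for n unfolding L_def by measurable
    show "(\<integral>v. L n v \<partial>usphere) = \<mu> n" for n
      unfolding L_def \<mu>_def by (subst Bochner_Integration.integral_add) (simp_all add: usphere_inner2 p_def)
    show "\<bar>real CARD('n) / 2 * spike_dev (a n) (b n) (\<nu> n) \<theta> (\<tau> n) w - L n w\<bar> \<le> d n / sqrt (real n)"
      if n: "n > 0" and w: "norm w = 1" for n w
    proof -
      let ?u = "spike_sqrt (a n) (b n) \<theta> *v \<tau> n" and ?c = "sqrt (a n + b n) / a n"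
      have an: "a n > 0" and abn: "a n + b n > 0" by (rule a[OF n], rule ab[OF n])
      have rn: "real n > 0" using n by simp
      have h: "c / 2 * (2 / r * q) = c / r * q" for c r q :: real by simp
      have dev: "real CARD('n) / 2 * spike_dev (a n) (b n) (\<nu> n) \<theta> (\<tau> n) w
          = p / sqrt (real n) * (?c * (\<theta> \<bullet> w) * (?u \<bullet> w) + \<nu> n / (2 * a n) * (?u \<bullet> w)\<^sup>2)"
        unfolding spike_dev_local[OF an b[OF n] rn \<nu>[OF n]] p_def h ..
      have L: "L n w = p / sqrt (real n) * ((\<tau> n \<bullet> w) * (\<theta> \<bullet> w) + 1 / (2 * \<xi>) * (\<tau> n \<bullet> w)\<^sup>2)"
        by (simp add: L_def distrib_left power2_eq_square)
      have eq: "real CARD('n) / 2 * spike_dev (a n) (b n) (\<nu> n) \<theta> (\<tau> n) w - L n w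
          = p / sqrt (real n) * ((?c * (?u \<bullet> w) - \<tau> n \<bullet> w) * (\<theta> \<bullet> w)
            + (\<nu> n / (2 * a n) * (?u \<bullet> w)\<^sup>2 - 1 / (2 * \<xi>) * (\<tau> n \<bullet> w)\<^sup>2))"
        unfolding dev L right_diff_distrib[symmetric] by (rule arg_cong2[where f = "(*)", OF refl]) (simp add: algebra_simps)
      have tw: "\<bar>\<theta> \<bullet> w\<bar> \<le> 1" using abs_inner_le_unit[OF w, of \<theta>] \<theta> by simp
      have t\<tau>: "\<bar>\<tau> n \<bullet> w\<bar> \<le> B" using abs_inner_le_unit[OF w, of "\<tau> n"] B[OF n] by linarith
      have t: "\<bar>\<theta> \<bullet> \<tau> n\<bar> \<le> B"
        using Cauchy_Schwarz_ineq2[of \<theta> "\<tau> n"] \<theta> B[OF n] by simp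
      have uw: "\<bar>?u \<bullet> w\<bar> \<le> sqrt (a n + b n) * B"
        using abs_inner_le_unit[OF w, of ?u] spike_dev_bound_seq(1)[OF an b[OF n] \<theta> w \<nu>_pos[OF n] B[OF n]] by linarith
      have "?u \<bullet> w - \<tau> n \<bullet> w = (sqrt (a n) - 1) * (\<tau> n \<bullet> w) + (sqrt (a n + b n) - sqrt (a n)) * ((\<theta> \<bullet> \<tau> n) * (\<theta> \<bullet> w))"
        by (simp add: spike_sqrt_def spike_mult_vec inner_simps algebra_simps)
      moreover have "\<bar>(sqrt (a n) - 1) * (\<tau> n \<bullet> w)\<bar> \<le> \<bar>sqrt (a n) - 1\<bar> * B"
        unfolding abs_mult using t\<tau> by (intro mult_left_mono) auto
      moreover have "\<bar>(\<theta> \<bullet> \<tau> n) * (\<theta> \<bullet> w)\<bar> \<le> B * 1" unfolding abs_mult using t tw B0 by (intro mult_mono) auto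
      then have "\<bar>(sqrt (a n + b n) - sqrt (a n)) * ((\<theta> \<bullet> \<tau> n) * (\<theta> \<bullet> w))\<bar> \<le> \<bar>sqrt (a n + b n) - sqrt (a n)\<bar> * B"
        unfolding abs_mult[of "sqrt (a n + b n) - sqrt (a n)"] by (intro mult_left_mono) auto
      ultimately have ut: "\<bar>?u \<bullet> w - \<tau> n \<bullet> w\<bar> \<le> \<epsilon> n" unfolding \<epsilon>_def by linarith
      have "\<bar>(?c - 1) * (?u \<bullet> w)\<bar> \<le> \<bar>?c - 1\<bar> * (sqrt (a n + b n) * B)"
        unfolding abs_mult using uw by (intro mult_left_mono) auto
      moreover have "?c * (?u \<bullet> w) - \<tau> n \<bullet> w = (?c - 1) * (?u \<bullet> w) + (?u \<bullet> w - \<tau> n \<bullet> w)" by (simp add: left_diff_distrib)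
      ultimately have "\<bar>?c * (?u \<bullet> w) - \<tau> n \<bullet> w\<bar> \<le> \<bar>?c - 1\<bar> * (sqrt (a n + b n) * B) + \<epsilon> n" using ut by linarith
      then have "\<bar>(?c * (?u \<bullet> w) - \<tau> n \<bullet> w) * (\<theta> \<bullet> w)\<bar> \<le> (\<bar>?c - 1\<bar> * (sqrt (a n + b n) * B) + \<epsilon> n) * 1"
        unfolding abs_mult[of "?c * (?u \<bullet> w) - \<tau> n \<bullet> w"] using tw by (intro mult_mono) auto
      then have 1: "\<bar>(?c * (?u \<bullet> w) - \<tau> n \<bullet> w) * (\<theta> \<bullet> w)\<bar> \<le> \<bar>?c - 1\<bar> * (sqrt (a n + b n) * B) + \<epsilon> n" by simp
      have "(?u \<bullet> w)\<^sup>2 \<le> (sqrt (a n + b n) * B)\<^sup>2"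
        using power_mono[OF uw, of 2] by simp
      also have "\<dots> = (a n + b n) * B\<^sup>2" using abn by (simp add: power_mult_distrib)
      finally have 2: "\<bar>(\<nu> n / (2 * a n) - 1 / (2 * \<xi>)) * (?u \<bullet> w)\<^sup>2\<bar> \<le> \<bar>\<nu> n / (2 * a n) - 1 / (2 * \<xi>)\<bar> * ((a n + b n) * B\<^sup>2)"
        unfolding abs_mult by (intro mult_left_mono) auto
      have "\<bar>(?u \<bullet> w - \<tau> n \<bullet> w) * (?u \<bullet> w + \<tau> n \<bullet> w)\<bar> \<le> \<epsilon> n * (sqrt (a n + b n) * B + B)"
        unfolding abs_mult using ut uw t\<tau> by (intro mult_mono) auto
      then have 3: "\<bar>1 / (2 * \<xi>) * ((?u \<bullet> w - \<tau> n \<bullet> w) * (?u \<bullet> w + \<tau> n \<bullet> w))\<bar> \<le> 1 / (2 * \<xi>) * (\<epsilon> n * (sqrt (a n + b n) * B + B))"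
        unfolding abs_mult[of "1 / (2 * \<xi>)"] using \<xi> by (intro mult_mono) auto
      have sp: "\<nu> n / (2 * a n) * (?u \<bullet> w)\<^sup>2 - 1 / (2 * \<xi>) * (\<tau> n \<bullet> w)\<^sup>2
         = (\<nu> n / (2 * a n) - 1 / (2 * \<xi>)) * (?u \<bullet> w)\<^sup>2 + 1 / (2 * \<xi>) * ((?u \<bullet> w - \<tau> n \<bullet> w) * (?u \<bullet> w + \<tau> n \<bullet> w))"
        by (simp add: power2_eq_square algebra_simps)
      have "\<bar>(?c * (?u \<bullet> w) - \<tau> n \<bullet> w) * (\<theta> \<bullet> w) + (\<nu> n / (2 * a n) * (?u \<bullet> w)\<^sup>2 - 1 / (2 * \<xi>) * (\<tau> n \<bullet> w)\<^sup>2)\<bar>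
         \<le> \<bar>?c - 1\<bar> * (sqrt (a n + b n) * B) + \<epsilon> n
            + (\<bar>\<nu> n / (2 * a n) - 1 / (2 * \<xi>)\<bar> * ((a n + b n) * B\<^sup>2) + 1 / (2 * \<xi>) * (\<epsilon> n * (sqrt (a n + b n) * B + B)))"
        unfolding sp using 1 2 3 by linarith
      then have "p / sqrt (real n) * \<bar>(?c * (?u \<bullet> w) - \<tau> n \<bullet> w) * (\<theta> \<bullet> w) + (\<nu> n / (2 * a n) * (?u \<bullet> w)\<^sup>2 - 1 / (2 * \<xi>) * (\<tau> n \<bullet> w)\<^sup>2)\<bar>
         \<le> p / sqrt (real n) * (\<bar>?c - 1\<bar> * (sqrt (a n + b n) * B) + \<epsilon> n
            + (\<bar>\<nu> n / (2 * a n) - 1 / (2 * \<xi>)\<bar> * ((a n + b n) * B\<^sup>2) + 1 / (2 * \<xi>) * (\<epsilon> n * (sqrt (a n + b n) * B + B))))"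
        using p by (intro mult_left_mono) auto
      then show ?thesis unfolding eq abs_mult[of "p / sqrt (real n)"] d_def using p by simp
    qed
    have "\<epsilon> \<longlonglongrightarrow> \<bar>sqrt 1 - 1\<bar> * B + \<bar>sqrt 1 - sqrt 1\<bar> * B"
      unfolding \<epsilon>_def using lim by (intro tendsto_intros)
    then have \<epsilon>0: "\<epsilon> \<longlonglongrightarrow> 0" by simp
    have "d \<longlonglongrightarrow> p * (\<bar>sqrt 1 / 1 - 1\<bar> * (sqrt 1 * B) + 0
      + (\<bar>1 / \<xi> / (2 * 1) - 1 / (2 * \<xi>)\<bar> * (1 * B\<^sup>2) + 1 / (2 * \<xi>) * (0 * (sqrt 1 * B + B))))"
      unfolding d_def using lim \<epsilon>0 by (intro tendsto_intros) auto
    then show "d \<longlonglongrightarrow> 0" by simp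
    show "(\<lambda>n. C n + real CARD('n) / (2 * (real CARD('n) + 2)) * ((a n + b n) / a n * ((norm (\<tau> n))\<^sup>2 - (\<theta> \<bullet> \<tau> n)\<^sup>2))) \<longlonglongrightarrow> 0"
    proof (rule Lim_null_comparison)
      let ?g = "\<lambda>n. (a n + b n) / a n"
      show "\<forall>\<^sub>F n in sequentially. norm (C n + real CARD('n) / (2 * (real CARD('n) + 2)) * (?g n * ((norm (\<tau> n))\<^sup>2 - (\<theta> \<bullet> \<tau> n)\<^sup>2)))
         \<le> p / (2 * (p + 2)) * (\<bar>?g n - 1\<bar> * B\<^sup>2 + \<bar>1 / (4 * \<xi>\<^sup>2) - ?g n * (\<nu> n)\<^sup>2 / 4\<bar> * B ^ 4)"
        using eventually_gt_at_top[of 0]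
      proof eventually_elim
        fix n :: nat assume n: "n > 0"
        \<comment> \<open>The origin of the quartic term: with \<open>\<nu>\<close> tending to
          \<open>1 / \<xi>\<close> this tends to
          \<open>norm (\<tau> n) ^ 4 / (4 * \<xi>\<^sup>2)\<close> up to a vanishing error.\<close>
        have t: "(\<theta> \<bullet> \<tau> n)\<^sup>2 = (\<nu> n)\<^sup>2 / 4 * norm (\<tau> n) ^ 4"
          unfolding tangent_inner[OF \<theta>'[OF n] \<theta> \<nu>_pos[OF n]] by (simp add: power_divide power_mult_distrib)
        have "C n + real CARD('n) / (2 * (real CARD('n) + 2)) * (?g n * ((norm (\<tau> n))\<^sup>2 - (\<theta> \<bullet> \<tau> n)\<^sup>2))
          = p / (2 * (p + 2)) * ((?g n - 1) * (norm (\<tau> n))\<^sup>2 + (1 / (4 * \<xi>\<^sup>2) - ?g n * (\<nu> n)\<^sup>2 / 4) * norm (\<tau> n) ^ 4)"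
          unfolding t C_def p_def[symmetric] minus_mult_right distrib_left[symmetric]
          by (rule arg_cong2[where f = "(*)", OF refl]) (simp add: left_diff_distrib right_diff_distrib)
        moreover have "\<bar>(?g n - 1) * (norm (\<tau> n))\<^sup>2\<bar> \<le> \<bar>?g n - 1\<bar> * B\<^sup>2"
          unfolding abs_mult using power_mono[OF B[OF n], of 2] by (intro mult_left_mono) auto
        moreover have "\<bar>(1 / (4 * \<xi>\<^sup>2) - ?g n * (\<nu> n)\<^sup>2 / 4) * norm (\<tau> n) ^ 4\<bar> \<le> \<bar>1 / (4 * \<xi>\<^sup>2) - ?g n * (\<nu> n)\<^sup>2 / 4\<bar> * B ^ 4"
          unfolding abs_mult using power_mono[OF B[OF n], of 4] by (intro mult_left_mono) auto
        ultimately show "norm (C n + real CARD('n) / (2 * (real CARD('n) + 2)) * (?g n * ((norm (\<tau> n))\<^sup>2 - (\<theta> \<bullet> \<tau> n)\<^sup>2)))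
           \<le> p / (2 * (p + 2)) * (\<bar>?g n - 1\<bar> * B\<^sup>2 + \<bar>1 / (4 * \<xi>\<^sup>2) - ?g n * (\<nu> n)\<^sup>2 / 4\<bar> * B ^ 4)"
          using p by (simp only: real_norm_def abs_mult[of "p / (2 * (p + 2))"]) (intro mult_mono; linarith?; simp)
      qed
      have "(\<lambda>n. p / (2 * (p + 2)) * (\<bar>?g n - 1\<bar> * B\<^sup>2 + \<bar>1 / (4 * \<xi>\<^sup>2) - ?g n * (\<nu> n)\<^sup>2 / 4\<bar> * B ^ 4))
         \<longlonglongrightarrow> p / (2 * (p + 2)) * (\<bar>1 / 1 - 1\<bar> * B\<^sup>2 + \<bar>1 / (4 * \<xi>\<^sup>2) - 1 / 1 * (1 / \<xi>)\<^sup>2 / 4\<bar> * B ^ 4)"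
        using lim by (intro tendsto_intros) auto
      then show "(\<lambda>n. p / (2 * (p + 2)) * (\<bar>?g n - 1\<bar> * B\<^sup>2 + \<bar>1 / (4 * \<xi>\<^sup>2) - ?g n * (\<nu> n)\<^sup>2 / 4\<bar> * B ^ 4)) \<longlonglongrightarrow> 0"
        by (simp add: power_divide)
    qed
  qed simp_all
qed

text \<open>For constant \<open>\<nu>\<close> the deviation is uniformly of order
  \<open>b = o(1 / sqrt n)\<close>, so even its first-order sum is negligible. The drift is governed
  by \<open>n * s\<close>, of order \<open>n * b^2\<close>, which vanishes too.\<close>

lemma spike_lan_degenerate:
  fixes \<theta> :: "real^'n" and \<tau> :: "nat \<Rightarrow> real^'n" and \<nu> :: "nat \<Rightarrow> real" and c :: real
  assumes \<theta>: "norm \<theta> = 1" and a: "\<And>n. n > 0 \<Longrightarrow> a n > 0" and b: "\<And>n. n > 0 \<Longrightarrow> b n > 0"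
    and \<nu>: "\<And>n. n > 0 \<Longrightarrow> \<nu> n = c" and c: "c > 0"
    and \<theta>': "\<And>n. n > 0 \<Longrightarrow> norm (\<theta> + \<nu> n *\<^sub>R \<tau> n) = 1"
    and B: "\<And>n. n > 0 \<Longrightarrow> norm (\<tau> n) \<le> B"
    and lim: "a \<longlonglongrightarrow> 1" "(\<lambda>n. sqrt (real n) * b n) \<longlonglongrightarrow> 0"
  shows "o_P1 (\<lambda>n. sample_law n (spike (a n) (b n) \<theta>))
      (\<lambda>n. log_lr n (spike (a n) (b n) \<theta>) (spike (a n) (b n) (\<theta> + \<nu> n *\<^sub>R \<tau> n)))"
proof -
  interpret U: prob_space "usphere :: (real^'n) measure" by (rule prob_space_usphere)
  let ?X = "\<lambda>n. spike_dev (a n) (b n) (\<nu> n) \<theta> (\<tau> n)"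
  define p where "p = real CARD('n)"
  define k where "k = c * (2 * B + c * B\<^sup>2)"
  define K where "K n = k * (b n / a n)" for n
  define s where "s n = (b n)\<^sup>2 * c\<^sup>2 / (a n * (a n + b n)) * ((norm (\<tau> n))\<^sup>2 - (\<theta> \<bullet> \<tau> n)\<^sup>2)" for n
  have p: "p > 0" by (simp add: p_def)
  have ab: "a n + b n > 0" if "n > 0" for n using a[OF that] b[OF that] by simp
  have b0: "b \<longlonglongrightarrow> 0"
  proof (rule Lim_null_comparison[OF _ lim(2)])
    show "\<forall>\<^sub>F n in sequentially. norm (b n) \<le> sqrt (real n) * b n"
      using eventually_gt_at_top[of 0]
    proof eventually_elim
      fix n :: nat assume "n > 0"
      then have "1 * b n \<le> sqrt (real n) * b n" using b[of n] by (intro mult_right_mono) auto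
      then show "norm (b n) \<le> sqrt (real n) * b n" using b[OF \<open>n > 0\<close>] by simp
    qed
  qed
  have K: "\<bar>?X n w\<bar> \<le> K n" if "n > 0" "norm w = 1" for n w
    using spike_dev_bound_seq(2)[OF a[OF that(1)] b[OF that(1)] \<theta> that(2) c B[OF that(1)]]
    by (simp add: K_def k_def \<nu>[OF that(1)] mult_ac)
  have EX: "\<bar>\<integral>v. ?X n v \<partial>usphere\<bar> \<le> K n" if n: "n > 0" for n
  proof -
    have int: "integrable usphere (?X n)"
      by (rule integrable_usphere[OF borel_measurable_spike_dev K[OF n]])
    have "AE w in usphere. ?X n w \<le> K n" "AE w in usphere. - K n \<le> ?X n w"
      using AE_usphere_norm by (eventually_elim; use K[OF n] in fastforce)+
    from U.integral_le_const[OF int this(1)] U.integral_ge_const[OF int this(2)] show ?thesis by linarith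
  qed
  have K1: "(\<lambda>n. sqrt (real n) * K n) \<longlonglongrightarrow> 0"
  proof -
    have "(\<lambda>n. k * ((sqrt (real n) * b n) / a n)) \<longlonglongrightarrow> k * (0 / 1)"
      using lim by (intro tendsto_intros) auto
    then show ?thesis by (simp add: K_def mult_ac)
  qed
  have "K \<longlonglongrightarrow> k * (0 / 1)" unfolding K_def using lim(1) b0 by (intro tendsto_intros) auto
  then have K0: "K \<longlonglongrightarrow> 0" by simp
  have s_bound: "0 \<le> s n" "s n \<le> (b n)\<^sup>2 * c\<^sup>2 / (a n * (a n + b n)) * B\<^sup>2" if n: "n > 0" for n
  proof -
    have 1: "(\<theta> \<bullet> \<tau> n)\<^sup>2 \<le> (norm (\<tau> n))\<^sup>2"
      using Cauchy_Schwarz_ineq[of \<theta> "\<tau> n"] \<theta> by (simp add: power2_norm_eq_inner norm_eq_1)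
    have 2: "(norm (\<tau> n))\<^sup>2 \<le> B\<^sup>2" using power_mono[OF B[OF n], of 2] by simp
    have q: "(b n)\<^sup>2 * c\<^sup>2 / (a n * (a n + b n)) \<ge> 0" using a[OF n] ab[OF n] by simp
    show "0 \<le> s n" unfolding s_def using 1 by (intro mult_nonneg_nonneg q) simp
    have "(norm (\<tau> n))\<^sup>2 - (\<theta> \<bullet> \<tau> n)\<^sup>2 \<le> B\<^sup>2" using 2 zero_le_power2[of "\<theta> \<bullet> \<tau> n"] by linarith
    then show "s n \<le> (b n)\<^sup>2 * c\<^sup>2 / (a n * (a n + b n)) * B\<^sup>2"
      unfolding s_def by (rule mult_left_mono[OF _ q])
  qed
  have ns0: "(\<lambda>n. real n * s n) \<longlonglongrightarrow> 0"
  proof (rule Lim_null_comparison)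
    show "\<forall>\<^sub>F n in sequentially. norm (real n * s n) \<le> (sqrt (real n) * b n)\<^sup>2 * c\<^sup>2 / (a n * (a n + b n)) * B\<^sup>2"
      using eventually_gt_at_top[of 0]
    proof eventually_elim
      fix n :: nat assume n: "n > 0"
      have "real n * s n \<le> real n * ((b n)\<^sup>2 * c\<^sup>2 / (a n * (a n + b n)) * B\<^sup>2)"
        using s_bound(2)[OF n] by (intro mult_left_mono) auto
      then show "norm (real n * s n) \<le> (sqrt (real n) * b n)\<^sup>2 * c\<^sup>2 / (a n * (a n + b n)) * B\<^sup>2"
        using s_bound(1)[OF n] by (simp add: power_mult_distrib mult.assoc)
    qed
    have "(\<lambda>n. (sqrt (real n) * b n)\<^sup>2 * c\<^sup>2 / (a n * (a n + b n)) * B\<^sup>2) \<longlonglongrightarrow> 0\<^sup>2 * c\<^sup>2 / (1 * (1 + 0)) * B\<^sup>2"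
      using lim b0 by (intro tendsto_intros) auto
    then show "(\<lambda>n. (sqrt (real n) * b n)\<^sup>2 * c\<^sup>2 / (a n * (a n + b n)) * B\<^sup>2) \<longlonglongrightarrow> 0" by simp
  qed
  have s0: "s \<longlonglongrightarrow> 0"
  proof (rule Lim_null_comparison[OF _ ns0])
    show "\<forall>\<^sub>F n in sequentially. norm (s n) \<le> real n * s n"
      using eventually_gt_at_top[of 0]
    proof eventually_elim
      fix n :: nat assume n: "n > 0"
      then have "1 * s n \<le> real n * s n" using s_bound(1)[OF n] by (intro mult_right_mono) auto
      then show "norm (s n) \<le> real n * s n" using s_bound(1)[OF n] by simp
    qed
  qed
  have "o_P1 (\<lambda>n. sample_law n (spike (a n) (b n) \<theta>))
      (\<lambda>n \<omega>. log_lr n (spike (a n) (b n) \<theta>) (spike (a n) (b n) (\<theta> + \<nu> n *\<^sub>R \<tau> n)) \<omega> - 0)"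
  \<comment> \<open>Nothing is kept: linear term and drift are zero. \<open>D\<close> is
    \<open>p * K\<close>, namely \<open>p / 2\<close> times the bound \<open>2 * K\<close> for the
    centred deviation.\<close>
  proof (rule spike_log_lr_o_P1[OF \<theta> a b \<theta>', where l = "\<lambda>_ _. 0" and C = "\<lambda>_. 0" and K = K and D = "\<lambda>n. p * K n" and Y = "\<lambda>_ _. 0"])
    show "\<bar>?X n w\<bar> \<le> K n" if "n > 0" "norm w = 1" for n w by (rule K[OF that])
    show "\<bar>real CARD('n) / 2 * (?X n w - (\<integral>v. ?X n v \<partial>usphere)) - 0\<bar> \<le> p * K n" if n: "n > 0" and w: "norm w = 1" for n w
    proof -
      have "\<bar>?X n w - (\<integral>v. ?X n v \<partial>usphere)\<bar> \<le> 2 * K n" using K[OF n w] EX[OF n] by linarith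
      then have "p / 2 * \<bar>?X n w - (\<integral>v. ?X n v \<partial>usphere)\<bar> \<le> p / 2 * (2 * K n)" using p by (intro mult_left_mono) auto
      then show ?thesis using p by (simp add: p_def abs_mult)
    qed
    show "K \<longlonglongrightarrow> 0" by (rule K0)
    have "(\<lambda>n. (sqrt (real n) * K n) * K n) \<longlonglongrightarrow> 0 * 0" by (intro tendsto_mult K1 K0)
    then show "(\<lambda>n. sqrt (real n) * (K n)\<^sup>2) \<longlonglongrightarrow> 0" by (simp add: power2_eq_square mult.assoc)
    have "(\<lambda>n. (sqrt (real n) * K n)\<^sup>2 * K n) \<longlonglongrightarrow> 0\<^sup>2 * 0" by (intro tendsto_mult tendsto_power K1 K0)
    moreover have "(sqrt (real n) * K n)\<^sup>2 * K n = real n * K n ^ 3" for n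
      by (simp add: power_mult_distrib) (simp add: power2_eq_square power3_eq_cube)
    ultimately show "(\<lambda>n. real n * K n ^ 3) \<longlonglongrightarrow> 0" by simp
    have "(\<lambda>n. p * (sqrt (real n) * K n)) \<longlonglongrightarrow> p * 0" by (intro tendsto_mult tendsto_const K1)
    then show "(\<lambda>n. sqrt (real n) * (p * K n)) \<longlonglongrightarrow> 0" by (simp add: mult_ac)
    have "(\<lambda>n. - (p / (2 * (p + 2)) * (real n * s n)) + 3 * (real n * s n) * s n / (4 * (p + 2)))
        \<longlonglongrightarrow> - (p / (2 * (p + 2)) * 0) + 3 * 0 * 0 / (4 * (p + 2))"
      using p by (intro tendsto_intros ns0 s0) auto
    then have "(\<lambda>n. - (p / (2 * (p + 2)) * (real n * s n)) + 3 * (real n * s n) * s n / (4 * (p + 2))) \<longlonglongrightarrow> 0" by simp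
    then show "(\<lambda>n. real n * (real CARD('n) / 2 * (\<integral>v. ?X n v \<partial>usphere)
      + real CARD('n) / 2 / 2 * (\<integral>v. (?X n v)\<^sup>2 \<partial>usphere)) - 0) \<longlonglongrightarrow> 0"
    proof (rule Lim_transform_eventually)
      show "\<forall>\<^sub>F n in sequentially. - (p / (2 * (p + 2)) * (real n * s n)) + 3 * (real n * s n) * s n / (4 * (p + 2))
        = real n * (real CARD('n) / 2 * (\<integral>v. ?X n v \<partial>usphere) + real CARD('n) / 2 / 2 * (\<integral>v. (?X n v)\<^sup>2 \<partial>usphere)) - 0"
        using eventually_gt_at_top[of 0]
      proof eventually_elim
        fix n :: nat assume n: "n > 0"
        have "real n > 0" using n by simp
        then show "- (p / (2 * (p + 2)) * (real n * s n)) + 3 * (real n * s n) * s n / (4 * (p + 2))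
          = real n * (real CARD('n) / 2 * (\<integral>v. ?X n v \<partial>usphere) + real CARD('n) / 2 / 2 * (\<integral>v. (?X n v)\<^sup>2 \<partial>usphere)) - 0"
          unfolding usphere_spike_dev[OF a[OF n] ab[OF n] \<theta> \<theta>'[OF n]] usphere_spike_dev_sq[OF a[OF n] ab[OF n] \<theta> \<theta>'[OF n]]
          unfolding \<nu>[OF n] p_def[symmetric] s_def[symmetric] diff_0_right by (rule lan_drift[OF p _ refl, symmetric])
      qed
    qed
  qed simp_all
  then show ?thesis by simp
qed

section \<open>Asymptotic normality of the sign covariance matrix\<close>

lemma matrix_entry_inner: "A $ i $ j = axis i 1 \<bullet> (A *v axis j (1::real))"
  by (simp add: inner_axis' matrix_vector_mult_basis column_def)

lemma borel_measurable_vecI: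
  fixes f :: "'a \<Rightarrow> real^'n"
  assumes "\<And>i. (\<lambda>x. f x $ i) \<in> borel_measurable M"
  shows "f \<in> borel_measurable M"
proof (subst borel_measurable_euclidean_space, intro ballI)
  fix b :: "real^'n" assume "b \<in> Basis"
  then obtain k where "b = axis k 1" by (auto simp: Basis_vec_def)
  then show "(\<lambda>x. f x \<bullet> b) \<in> borel_measurable M" using assms[of k] by (simp add: inner_axis)
qed

lemma inner_vec_prod: "x \<bullet> y = (\<Sum>i\<in>UNIV. \<Sum>j\<in>UNIV. x $ (i, j) * y $ (i, j))" for x y :: "real^('n::finite\<times>'m::finite)"
  by (simp add: inner_vec_def sum.cartesian_product)

text \<open>Inverse of \<open>vecm\<close>; the swapped indices undo the stacking by columns. Linear
  forms in \<open>vecm X\<close> thereby become traces against a matrix, and quadratic forms on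
  \<open>outer w w\<close>.\<close>

definition unvec :: "real^('n\<times>'n) \<Rightarrow> real^'n^'n" where
  "unvec t = (\<chi> i j. t $ (j, i))"

lemma inner_vecm: "t \<bullet> vecm X = (\<Sum>i\<in>UNIV. \<Sum>j\<in>UNIV. unvec t $ i $ j * X $ i $ j)"
  unfolding inner_vec_prod vecm_def unvec_def by (subst sum.swap) simp

lemma inner_vecm_outer: "t \<bullet> vecm (outer w w) = w \<bullet> (unvec t *v w)"
  unfolding inner_vecm by (simp add: inner_vec_def matrix_vector_mult_def outer_def sum_distrib_left mult_ac)

lemma inner_vecm_mat: "t \<bullet> vecm (mat 1) = trace (unvec t)"
  unfolding inner_vecm by (simp add: trace_def mat_def if_distrib cong: if_cong)

text \<open>In each entry only one summand of the double sum survives, which leaves the permutation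
  matrix of the index swap, that is, transposition on vectorised matrices.\<close>

lemma commutation_matrix_nth:
  "commutation_matrix $ x $ y = (if y = (snd x, fst x) then 1 else 0)"
proof -
  have "commutation_matrix $ x $ y = (\<Sum>i\<in>UNIV. \<Sum>j\<in>UNIV.
      if i = fst x then if j = fst y then if j = snd x \<and> i = snd y then 1 else 0 else 0 else 0)"
    unfolding commutation_matrix_def sum_component
    by (intro sum.cong refl) (auto simp: kron_def outer_def axis_def)
  also have "\<dots> = (\<Sum>i\<in>UNIV. if i = fst x then (if fst y = snd x \<and> i = snd y then 1 else 0) else 0)"
    by (intro sum.cong refl) auto
  also have "\<dots> = (if y = (snd x, fst x) then 1 else 0)"
    by (cases y) auto
  finally show ?thesis .
qed

lemma commutation_matrix_mult_nth: "(commutation_matrix *v t) $ (i, j) = t $ (j, i)"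
  by (simp add: matrix_vector_mult_def commutation_matrix_nth if_distrib[of "\<lambda>c. c * _"] cong: if_cong)

lemma commutation_matrix_inner:
  "(commutation_matrix *v t) \<bullet> (commutation_matrix *v t) = t \<bullet> t"
  "(commutation_matrix *v t) \<bullet> vecm (mat 1) = t \<bullet> vecm (mat 1)"
  "t \<bullet> (commutation_matrix *v t) = (\<Sum>i\<in>UNIV. \<Sum>k\<in>UNIV. unvec t $ i $ k * unvec t $ k $ i)"
  "t \<bullet> t = (\<Sum>i\<in>UNIV. \<Sum>k\<in>UNIV. (unvec t $ i $ k)\<^sup>2)"
proof -
  show "(commutation_matrix *v t) \<bullet> (commutation_matrix *v t) = t \<bullet> t"
    unfolding inner_vec_prod commutation_matrix_mult_nth by (rule sum.swap)
  show "(commutation_matrix *v t) \<bullet> vecm (mat 1) = t \<bullet> vecm (mat 1)"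
    unfolding inner_vecm trace_def by (simp add: unvec_def commutation_matrix_mult_nth mat_def if_distrib cong: if_cong)
  show "t \<bullet> (commutation_matrix *v t) = (\<Sum>i\<in>UNIV. \<Sum>k\<in>UNIV. unvec t $ i $ k * unvec t $ k $ i)"
    unfolding inner_vec_prod commutation_matrix_mult_nth by (simp add: unvec_def mult.commute)
  show "t \<bullet> t = (\<Sum>i\<in>UNIV. \<Sum>k\<in>UNIV. (unvec t $ i $ k)\<^sup>2)"
    unfolding inner_vec_prod by (subst sum.swap) (simp add: unvec_def power2_eq_square)
qed

lemma vecm_mat_inner: "vecm (mat 1) \<bullet> (vecm (mat 1) :: real^('n::finite\<times>'n)) = real CARD('n)"
  unfolding inner_vecm_mat by (simp add: trace_def unvec_def vecm_def mat_def)

lemma limit_covariance: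
  fixes t :: "real^('n::finite\<times>'n)" and p :: real
  shows "t \<bullet> (((p / (p + 2)) *\<^sub>R (mat 1 + commutation_matrix + J_matrix) - J_matrix) *v t)
    = p / (p + 2) * (t \<bullet> t + t \<bullet> (commutation_matrix *v t) + (t \<bullet> vecm (mat 1))\<^sup>2) - (t \<bullet> vecm (mat 1))\<^sup>2"
  by (simp add: J_matrix_def matrix_vector_mult_diff_rdistrib matrix_vector_mult_add_rdistrib
      scaleR_matrix_vector_assoc[symmetric] outer_mult inner_simps inner_commute power2_eq_square)

text \<open>Each summand is \<open>p\<close> times a centred quadratic form in a uniform direction,
  so the covariance is read off from the fourth moments: the three pairings give the identity, the
  commutation matrix and \<open>J_matrix\<close>, and the squared mean is the
  \<open>J_matrix\<close> subtracted.\<close>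

lemma spike_vecm_normal:
  fixes \<theta> :: "real^'n"
  defines "p \<equiv> real CARD('n)"
  assumes \<theta>: "norm \<theta> = 1" and a: "\<And>n. n > 0 \<Longrightarrow> a n > 0" and ab: "\<And>n. n > 0 \<Longrightarrow> a n + b n > 0"
  defines "\<Upsilon> \<equiv> \<lambda>n \<omega>. (p * sqrt (real n)) *\<^sub>R (S_stat n (spike (a n) (b n) \<theta>) \<omega> - (1 / p) *\<^sub>R mat 1)"
  shows "asymp_normal (\<lambda>n. sample_law n (spike (a n) (b n) \<theta>)) (\<lambda>n \<omega>. vecm (\<Upsilon> n \<omega>))
    (\<lambda>t. t \<bullet> (((p / (p + 2)) *\<^sub>R (mat 1 + commutation_matrix + J_matrix) - J_matrix) *v t))"
proof -
  interpret U: prob_space "usphere :: (real^'n) measure" by (rule prob_space_usphere)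
  let ?V = "\<lambda>n. spike (a n) (b n) \<theta>"
  let ?T = "\<lambda>n u. sgn (spike_isqrt (a n) (b n) \<theta> *v u)"
  let ?J = "vecm (mat 1) :: real^('n\<times>'n)"
  define Y :: "real^'n \<Rightarrow> real^('n\<times>'n)" where "Y w = p *\<^sub>R (vecm (outer w w) - (1 / p) *\<^sub>R ?J)" for w
  \<comment> \<open>The orthogonal projection onto vectorised symmetric matrices of trace zero,
    scaled. The summands lie in this subspace, since \<open>outer w w\<close> is symmetric with
    trace 1 for unit \<open>w\<close>, and the covariance is \<open>2 * p / (p + 2)\<close> times
    the projection.\<close>
  define L :: "real^('n\<times>'n) \<Rightarrow> real^('n\<times>'n)"
    where "L t = sqrt (2 * p / (p + 2)) *\<^sub>R ((1 / 2) *\<^sub>R (t + commutation_matrix *v t) - ((t \<bullet> ?J) / p) *\<^sub>R ?J)" for t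
  have p: "p > 0" by (simp add: p_def)
  have U1: "U.prob UNIV = 1" using U.prob_space by simp
  have Y_nth: "Y w $ x = p * ((axis (snd x) 1 \<bullet> w) * (axis (fst x) 1 \<bullet> w) - 1 / p * (axis (snd x) 1 \<bullet> (axis (fst x) 1 :: real^'n)))" for w x
    unfolding inner_axis_axis by (auto simp: Y_def vecm_def outer_def inner_axis' mat_def)
  have \<Upsilon>_nth: "vecm (\<Upsilon> n \<omega>) $ x = p * (sqrt (real n) * (axis (snd x) 1 \<bullet> ((S_stat n (?V n) \<omega> - (1 / p) *\<^sub>R mat 1) *v axis (fst x) 1)))" for n \<omega> x
    unfolding matrix_entry_inner[symmetric] by (simp add: vecm_def \<Upsilon>_def)
  have tY: "t \<bullet> Y w = p * (w \<bullet> (unvec t *v w) - (t \<bullet> ?J) / p)" for t w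
    by (simp add: Y_def inner_diff_right inner_vecm_outer)
  have q1 [simp]: "integrable usphere (\<lambda>w. w \<bullet> (A *v w))" for A :: "real^'n^'n"
    unfolding quadratic_form_expand by (rule Bochner_Integration.integrable_sum) simp
  have q2 [simp]: "integrable usphere (\<lambda>w. (w \<bullet> (A *v w))\<^sup>2)" for A :: "real^'n^'n"
    unfolding quadratic_form_expand power2_eq_square sum_product
    by (intro Bochner_Integration.integrable_sum) (simp add: mult.assoc[symmetric])
  have pn: "p \<noteq> 0" "p + 2 \<noteq> 0" using p by auto
  show ?thesis
    unfolding sample_law_def
  proof (rule asymp_normal_iid[where T = ?T and N = usphere and Y = Y and L = L and K = "real CARD('n\<times>'n) * (p + 1)"])
    show "prob_space (angular_gaussian (?V n))" if "n > 0" for n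
      by (rule prob_space_angular_gaussian_spike[OF a[OF that] ab[OF that] \<theta>])
    show "?T n \<in> angular_gaussian (?V n) \<rightarrow>\<^sub>M usphere" for n by measurable
    show "distr (angular_gaussian (?V n)) usphere (?T n) = usphere" if "n > 0" for n
      using distr_angular_gaussian_spike[OF a[OF that] ab[OF that] \<theta>] by (simp cong: distr_cong)
    show "prob_space (usphere :: (real^'n) measure)" by (rule prob_space_usphere)
    show "Y \<in> borel_measurable usphere"
      by (rule borel_measurable_vecI) (unfold Y_nth, measurable)
    show "AE w in usphere. norm (Y w) \<le> real CARD('n\<times>'n) * (p + 1)"
      using AE_usphere_norm
    proof eventually_elim
      fix w :: "real^'n" assume w: "norm w = 1"
      have "\<bar>Y w $ x\<bar> \<le> p + 1" for x
      proof -
        have "\<bar>w $ i\<bar> \<le> 1" for i using component_le_norm_cart[of w i] w by simp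
        then have "\<bar>w $ snd x * w $ fst x\<bar> \<le> 1 * 1" unfolding abs_mult by (intro mult_mono) auto
        then have "\<bar>p * (w $ snd x * w $ fst x)\<bar> \<le> p * 1" using p by (simp add: abs_mult mult_left_le)
        moreover have "Y w $ x = p * (w $ snd x * w $ fst x) - (if fst x = snd x then 1 else 0)"
          using p by (simp add: Y_def vecm_def outer_def mat_def right_diff_distrib)
        ultimately show ?thesis by (simp split: if_splits)
      qed
      then have "(\<Sum>x\<in>UNIV. \<bar>Y w $ x\<bar>) \<le> (\<Sum>x::'n\<times>'n\<in>UNIV. p + 1)" by (intro sum_mono)
      also have "\<dots> = real CARD('n\<times>'n) * (p + 1)" by (simp only: sum_constant)
      finally show "norm (Y w) \<le> real CARD('n\<times>'n) * (p + 1)" by (rule order_trans[OF norm_le_l1_cart])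
    qed
    show "(\<integral>w. t \<bullet> Y w \<partial>usphere) = 0" for t
      unfolding tY inner_vecm_mat by (simp add: usphere_quadratic_form p_def U1)
    show "(\<lambda>\<omega>. vecm (\<Upsilon> n \<omega>)) \<in> borel_measurable (PiM {..<n} (\<lambda>_. angular_gaussian (?V n)))" for n
      unfolding sample_law_def[symmetric] by (rule borel_measurable_vecI) (unfold \<Upsilon>_nth, measurable)
    show "vecm (\<Upsilon> n \<omega>) = (1 / sqrt (real n)) *\<^sub>R (\<Sum>i<n. Y (?T n (\<omega> i)))" if n: "n > 0" for n \<omega>
      unfolding vec_eq_iff \<Upsilon>_nth S_stat_inner_sum[OF n] inv_sqrt_mat_spike[OF a[OF n] ab[OF n] \<theta>]
      by (simp add: Y_nth sum_component sum_distrib_left sum_divide_distrib)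
    show "t \<bullet> (((p / (p + 2)) *\<^sub>R (mat 1 + commutation_matrix + J_matrix) - J_matrix) *v t) = (\<integral>w. (t \<bullet> Y w)\<^sup>2 \<partial>usphere)" for t
    proof -
      let ?q = "\<lambda>w. w \<bullet> (unvec t *v w)" and ?r = "t \<bullet> ?J"
      have "(\<integral>w. (t \<bullet> Y w)\<^sup>2 \<partial>usphere) = (\<integral>w. p\<^sup>2 * (?q w)\<^sup>2 - 2 * p * ?r * ?q w + ?r\<^sup>2 \<partial>usphere)"
        unfolding tY by (rule Bochner_Integration.integral_cong[OF refl]) (use pn in \<open>simp add: power2_eq_square field_simps\<close>)
      also have "\<dots> = p\<^sup>2 * (\<integral>w. (?q w)\<^sup>2 \<partial>usphere) - 2 * p * ?r * (\<integral>w. ?q w \<partial>usphere) + ?r\<^sup>2"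
        by (simp add: U1)
      also have "\<dots> = p\<^sup>2 * ((?r\<^sup>2 + t \<bullet> t + t \<bullet> (commutation_matrix *v t)) / (p * (p + 2))) - 2 * p * ?r * (?r / p) + ?r\<^sup>2"
        unfolding usphere_quadratic_form usphere_quadratic_form_sq p_def[symmetric] commutation_matrix_inner inner_vecm_mat ..
      also have "\<dots> = p / (p + 2) * (t \<bullet> t + t \<bullet> (commutation_matrix *v t) + ?r\<^sup>2) - ?r\<^sup>2"
        using pn by (simp add: power2_eq_square add_ac)
      finally show ?thesis unfolding limit_covariance ..
    qed
    show "linear L"
    proof (rule linearI)
      show "L (x + y) = L x + L y" for x y
        unfolding L_def matrix_vector_right_distrib inner_add_left add_divide_distrib
        by (simp add: scaleR_right_distrib scaleR_left_distrib scaleR_right_diff_distrib)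
      show "L (c *\<^sub>R x) = c *\<^sub>R L x" for c x
        by (simp add: L_def matrix_vector_mult_scaleR scaleR_right_distrib scaleR_right_diff_distrib mult_ac)
    qed
    show "t \<bullet> (((p / (p + 2)) *\<^sub>R (mat 1 + commutation_matrix + J_matrix) - J_matrix) *v t) = (norm (L t))\<^sup>2" for t
    proof -
      let ?K = "commutation_matrix *v t" and ?r = "t \<bullet> ?J"
      have "(norm (L t))\<^sup>2 = 2 * p / (p + 2) * (norm ((1 / 2) *\<^sub>R (t + ?K) - (?r / p) *\<^sub>R ?J))\<^sup>2"
        using p by (simp add: L_def power_mult_distrib)
      also have "(norm ((1 / 2) *\<^sub>R (t + ?K) - (?r / p) *\<^sub>R ?J))\<^sup>2
         = 1 / 4 * (t \<bullet> t + 2 * (t \<bullet> ?K) + ?K \<bullet> ?K) - ?r / p * (t \<bullet> ?J + ?K \<bullet> ?J) + (?r / p)\<^sup>2 * (?J \<bullet> ?J)"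
        unfolding power2_norm_eq_inner
        by (simp add: inner_simps inner_commute[of ?K t] inner_commute[of ?J t] inner_commute[of ?J ?K] power2_eq_square algebra_simps)
      also have "\<dots> = 1 / 2 * (t \<bullet> t + t \<bullet> ?K) - ?r\<^sup>2 / p"
        unfolding commutation_matrix_inner(1,2) vecm_mat_inner p_def[symmetric]
        using pn by (simp add: power2_eq_square)
      also have "2 * p / (p + 2) * \<dots> = p / (p + 2) * (t \<bullet> t + t \<bullet> ?K + ?r\<^sup>2) - ?r\<^sup>2"
      proof -
        have "2 * p / m * (1 / 2 * x - r / p) = p / m * (x + r) - r" if "m \<noteq> 0" "m = p + 2" for m x r
        proof -
          have "2 * p / m * (1 / 2 * x - r / p) = (p * x - 2 * r) / m" "p / m * (x + r) - r = (p * (x + r) - m * r) / m"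
            using pn that(1) by (simp_all add: field_simps)
          then show ?thesis unfolding that(2) by (simp add: algebra_simps)
        qed
        from this[OF pn(2) refl] show ?thesis .
      qed
      finally show ?thesis unfolding limit_covariance ..
    qed
  qed
qed

theorem theorem1:
  fixes \<theta>0 :: "real^'p" and \<xi> :: real
    and \<delta> \<nu> :: "nat \<Rightarrow> real" and \<tau> :: "nat \<Rightarrow> real^'p"
  defines "p \<equiv> real CARD('p)"
  defines "V0 \<equiv> \<lambda>n. spiked_shape (\<delta> n) \<xi> \<theta>0"
  defines "V1 \<equiv> \<lambda>n. spiked_shape (\<delta> n) \<xi> (\<theta>0 + \<nu> n *\<^sub>R \<tau> n)"
  defines "\<Lambda> \<equiv> \<lambda>n. log_lr n (V0 n) (V1 n)"
  defines "\<gamma> \<equiv> \<lambda>n. p * \<delta> n * \<xi> / (p + (p - 1) * \<delta> n * \<xi>)"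
  defines "P0 \<equiv> \<lambda>n. sample_law n (V0 n)"
  defines "\<Upsilon> \<equiv> \<lambda>n \<omega>. (p * sqrt (real n)) *\<^sub>R (S_stat n (V0 n) \<omega> - (1 / p) *\<^sub>R mat 1)"
  defines "Pr \<equiv> mat 1 - outer \<theta>0 \<theta>0"
  assumes p2: "CARD('p) \<ge> 2"
    and \<theta>0: "\<theta>0 \<in> sphere 0 1"
    and \<xi>: "\<xi> > 0"
    and \<delta>_pos: "\<forall>n\<ge>1. \<delta> n > 0"
    and \<delta>_bdd: "bounded (range \<delta>)"
    and V0_pd: "\<forall>n\<ge>1. posdef (V0 n)"
    and \<nu>_pos: "\<forall>n\<ge>1. \<nu> n > 0"
    and \<tau>_bdd: "bounded (range \<tau>)"
    and on_sphere: "\<forall>n\<ge>1. \<theta>0 + \<nu> n *\<^sub>R \<tau> n \<in> sphere 0 1"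
  shows
  \<comment> \<open>(i)\<close>
  "((\<forall>n\<ge>1. \<delta> n = 1) \<and> (\<forall>n\<ge>1. \<nu> n = 1 / (sqrt (real n) * \<gamma> n)) \<longrightarrow>
     (let \<Gamma> = (p * (p + (p - 1) * \<xi>) / ((p + 2) * (p - \<xi>))) *\<^sub>R Pr;
          \<Delta> = (\<lambda>n \<omega>. (p * sqrt (p + (p - 1) * \<xi>) / sqrt (p - \<xi>)) *\<^sub>R
                 ((Pr ** (sqrt (real n) *\<^sub>R (S_stat n (V0 n) \<omega> - (1 / p) *\<^sub>R mat 1))) *v \<theta>0))
      in o_P1 P0 (\<lambda>n \<omega>. \<Lambda> n \<omega> - (\<tau> n \<bullet> \<Delta> n \<omega> - 1 / 2 * (\<tau> n \<bullet> (\<Gamma> *v \<tau> n))))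
         \<and> asymp_normal P0 \<Delta> (\<lambda>t. t \<bullet> (\<Gamma> *v t))))
   \<and>
  \<comment> \<open>(ii)\<close>
  ((\<delta> \<longlonglongrightarrow> 0) \<and> filterlim (\<lambda>n. sqrt (real n) * \<delta> n) at_top sequentially
     \<and> (\<forall>n\<ge>1. \<nu> n = 1 / (sqrt (real n) * \<gamma> n)) \<longrightarrow>
     (let \<Gamma> = (p / (p + 2)) *\<^sub>R Pr;
          \<Delta> = (\<lambda>n \<omega>. p *\<^sub>R
                 ((Pr ** (sqrt (real n) *\<^sub>R (S_stat n (V0 n) \<omega> - (1 / p) *\<^sub>R mat 1))) *v \<theta>0))
      in o_P1 P0 (\<lambda>n \<omega>. \<Lambda> n \<omega> - (\<tau> n \<bullet> \<Delta> n \<omega> - 1 / 2 * (\<tau> n \<bullet> (\<Gamma> *v \<tau> n))))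
         \<and> asymp_normal P0 \<Delta> (\<lambda>t. t \<bullet> (\<Gamma> *v t))))
   \<and>
  \<comment> \<open>(iii)\<close>
  ((\<forall>n\<ge>1. \<delta> n = 1 / sqrt (real n)) \<and> (\<forall>n\<ge>1. \<nu> n = 1 / (sqrt (real n) * \<gamma> n)) \<longrightarrow>
     o_P1 P0 (\<lambda>n \<omega>. \<Lambda> n \<omega> -
        (\<tau> n \<bullet> (\<Upsilon> n \<omega> *v \<theta>0) + 1 / (2 * \<xi>) * (\<tau> n \<bullet> (\<Upsilon> n \<omega> *v \<tau> n))
         - p / (2 * (p + 2)) * ((norm (\<tau> n))\<^sup>2 - 1 / (4 * \<xi>\<^sup>2) * (norm (\<tau> n)) ^ 4)))
     \<and> asymp_normal P0 (\<lambda>n \<omega>. vecm (\<Upsilon> n \<omega>))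
         (\<lambda>t. t \<bullet> (((p / (p + 2)) *\<^sub>R (mat 1 + commutation_matrix + J_matrix) - J_matrix) *v t)))
   \<and>
  \<comment> \<open>(iv)\<close>
  (((\<lambda>n. sqrt (real n) * \<delta> n) \<longlonglongrightarrow> 0) \<and> (\<forall>n\<ge>1. \<nu> n = 1 / \<xi>) \<longrightarrow> o_P1 P0 \<Lambda>)"
proof -
  \<comment> \<open>The shapes are passed to the spike calculus: \<open>a\<close> is the eigenvalue
    across \<open>\<theta>0\<close> and \<open>a + b\<close> the one along it.\<close>
  define a where "a n = 1 - \<delta> n * \<xi> / p" for n
  define b where "b n = \<delta> n * \<xi>" for n
  obtain B where B: "norm (\<tau> n) \<le> B" for n using \<tau>_bdd by (auto simp: bounded_iff)
  have p: "p \<ge> 2" using p2 by (simp add: p_def)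
  have \<theta>: "norm \<theta>0 = 1" using \<theta>0 by simp
  have V0: "V0 = (\<lambda>n. spike (a n) (b n) \<theta>0)"
    by (simp add: fun_eq_iff V0_def a_def b_def spike_def spiked_shape_def p_def)
  have V1: "V1 = (\<lambda>n. spike (a n) (b n) (\<theta>0 + \<nu> n *\<^sub>R \<tau> n))"
    by (simp add: fun_eq_iff V1_def a_def b_def spike_def spiked_shape_def p_def)
  have a: "a n > 0" if "n > 0" for n
    using posdef_spikeD(1)[OF _ \<theta> p2, of "a n" "b n"] V0_pd that by (simp add: V0)
  have b: "b n > 0" if "n > 0" for n using \<delta>_pos \<xi> that by (simp add: b_def)
  have \<theta>': "norm (\<theta>0 + \<nu> n *\<^sub>R \<tau> n) = 1" if "n > 0" for n using on_sphere that by simp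
  have ab: "p * (a n + b n) = p + (p - 1) * \<delta> n * \<xi>" for n
    using p by (simp add: a_def b_def field_simps)
  \<comment> \<open>In eigenvalue terms \<open>\<gamma> n\<close> is
    \<open>b n / (a n + b n)\<close>, which puts the prescribed rate in the form required by the
    local expansion.\<close>
  have \<nu>: "\<nu> n = (a n + b n) / (sqrt (real n) * b n)" if "\<forall>n\<ge>1. \<nu> n = 1 / (sqrt (real n) * \<gamma> n)" "n > 0" for n
  proof -
    have "\<gamma> n = (p * b n) / (p * (a n + b n))" unfolding \<gamma>_def ab by (simp add: b_def mult.assoc)
    also have "\<dots> = b n / (a n + b n)" using p by simp
    finally show ?thesis using that by simp
  qed
  have lim_a: "a \<longlonglongrightarrow> 1 - d * \<xi> / p" and lim_ab: "(\<lambda>n. a n + b n) \<longlonglongrightarrow> 1 - d * \<xi> / p + d * \<xi>"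
    if "\<delta> \<longlonglongrightarrow> d" for d
    unfolding a_def b_def using that p by (auto intro!: tendsto_intros)
  \<comment> \<open>Here \<open>\<nu> n\<close> is \<open>a n + b n\<close> over
    \<open>\<xi> * (sqrt n * \<delta> n)\<close>, so it vanishes when
    \<open>sqrt n * \<delta> n\<close> diverges; this covers both fixed and slowly vanishing
    \<open>\<delta>\<close>.\<close>
  have lim_\<nu>: "\<nu> \<longlonglongrightarrow> 0"
    if "filterlim (\<lambda>n. sqrt (real n) * \<delta> n) at_top sequentially" "\<delta> \<longlonglongrightarrow> d" "\<forall>n\<ge>1. \<nu> n = 1 / (sqrt (real n) * \<gamma> n)" for d
  proof -
    have "filterlim (\<lambda>n. \<xi> * (sqrt (real n) * \<delta> n)) at_top sequentially"
      by (rule filterlim_tendsto_pos_mult_at_top[OF tendsto_const \<xi> that(1)])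
    then have "(\<lambda>n. inverse (\<xi> * (sqrt (real n) * \<delta> n))) \<longlonglongrightarrow> 0" by (rule tendsto_inverse_0_at_top)
    from tendsto_mult[OF lim_ab[OF that(2)] this]
    have "(\<lambda>n. (a n + b n) * inverse (\<xi> * (sqrt (real n) * \<delta> n))) \<longlonglongrightarrow> 0" by simp
    then show ?thesis
    proof (rule Lim_transform_eventually)
      show "\<forall>\<^sub>F n in sequentially. (a n + b n) * inverse (\<xi> * (sqrt (real n) * \<delta> n)) = \<nu> n"
        using eventually_gt_at_top[of 0]
        by eventually_elim (simp only: \<nu>[OF that(3)] divide_inverse b_def mult_ac)
    qed
  qed
  have sqrt_top: "filterlim (\<lambda>n. sqrt (real n)) at_top sequentially"
    by (rule filterlim_compose[OF sqrt_at_top filterlim_real_sequentially])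
  have 1: "let \<Gamma> = (p * (p + (p - 1) * \<xi>) / ((p + 2) * (p - \<xi>))) *\<^sub>R Pr;
          \<Delta> = (\<lambda>n \<omega>. (p * sqrt (p + (p - 1) * \<xi>) / sqrt (p - \<xi>)) *\<^sub>R
                 ((Pr ** (sqrt (real n) *\<^sub>R (S_stat n (V0 n) \<omega> - (1 / p) *\<^sub>R mat 1))) *v \<theta>0))
      in o_P1 P0 (\<lambda>n \<omega>. \<Lambda> n \<omega> - (\<tau> n \<bullet> \<Delta> n \<omega> - 1 / 2 * (\<tau> n \<bullet> (\<Gamma> *v \<tau> n))))
         \<and> asymp_normal P0 \<Delta> (\<lambda>t. t \<bullet> (\<Gamma> *v t))"
    if \<delta>1: "\<forall>n\<ge>1. \<delta> n = 1" and \<nu>1: "\<forall>n\<ge>1. \<nu> n = 1 / (sqrt (real n) * \<gamma> n)"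
  proof -
    \<comment> \<open>The eigenvalue ratio of the constant null shape with \<open>p\<close> cleared
      from numerator and denominator; both constants of (i) are expressed through it.\<close>
    define g where "g = (p + (p - 1) * \<xi>) / (p - \<xi>)"
    have ev: "\<forall>\<^sub>F n in sequentially. \<delta> n = 1" using eventually_ge_at_top[of 1] by eventually_elim (use \<delta>1 in simp)
    then have \<delta>: "\<delta> \<longlonglongrightarrow> 1" by (rule tendsto_eventually)
    have "filterlim (\<lambda>n. sqrt (real n) * \<delta> n) at_top sequentially"
      using filterlim_cong[OF refl refl, of "\<lambda>n. sqrt (real n) * \<delta> n" "\<lambda>n. sqrt (real n)" sequentially at_top] ev sqrt_top
      by (simp add: eventually_mono)
    note \<nu>0 = lim_\<nu>[OF this \<delta> \<nu>1]
    have a': "1 - \<xi> / p > 0" using a[of 1] \<delta>1 by (simp add: a_def)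
    have g: "g = (1 - \<xi> / p + \<xi>) / (1 - \<xi> / p)"
    proof -
      have "g = (p * (1 - \<xi> / p + \<xi>)) / (p * (1 - \<xi> / p))"
        unfolding g_def using p by (simp add: algebra_simps)
      also have "\<dots> = (1 - \<xi> / p + \<xi>) / (1 - \<xi> / p)" using p by (intro mult_divide_mult_cancel_left) auto
      finally show ?thesis .
    qed
    have c1: "p * sqrt (p + (p - 1) * \<xi>) / sqrt (p - \<xi>) = p * sqrt g"
      by (simp add: g_def real_sqrt_divide)
    have c2: "p * (p + (p - 1) * \<xi>) / ((p + 2) * (p - \<xi>)) = p * g / (p + 2)"
      by (simp add: g_def mult.commute)
    note L = spike_lan_normal[OF \<theta> a b \<nu>[OF \<nu>1] \<theta>' B lim_a[OF \<delta>, unfolded mult_1] lim_ab[OF \<delta>, unfolded mult_1] \<nu>0 a' g]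
    show ?thesis
      unfolding Let_def c1 c2 unfolding P0_def \<Lambda>_def V0 V1 Pr_def p_def by (rule conjI[OF L])
  qed
  have 2: "let \<Gamma> = (p / (p + 2)) *\<^sub>R Pr;
          \<Delta> = (\<lambda>n \<omega>. p *\<^sub>R
                 ((Pr ** (sqrt (real n) *\<^sub>R (S_stat n (V0 n) \<omega> - (1 / p) *\<^sub>R mat 1))) *v \<theta>0))
      in o_P1 P0 (\<lambda>n \<omega>. \<Lambda> n \<omega> - (\<tau> n \<bullet> \<Delta> n \<omega> - 1 / 2 * (\<tau> n \<bullet> (\<Gamma> *v \<tau> n))))
         \<and> asymp_normal P0 \<Delta> (\<lambda>t. t \<bullet> (\<Gamma> *v t))"
    if \<delta>: "\<delta> \<longlonglongrightarrow> 0" and top: "filterlim (\<lambda>n. sqrt (real n) * \<delta> n) at_top sequentially"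
      and \<nu>1: "\<forall>n\<ge>1. \<nu> n = 1 / (sqrt (real n) * \<gamma> n)"
  proof -
    have l: "a \<longlonglongrightarrow> 1" "(\<lambda>n. a n + b n) \<longlonglongrightarrow> 1" using lim_a[OF \<delta>] lim_ab[OF \<delta>] by simp_all
    have g: "1 = 1 / (1 :: real)" by simp
    note L = spike_lan_normal[OF \<theta> a b \<nu>[OF \<nu>1] \<theta>' B l lim_\<nu>[OF top \<delta> \<nu>1] zero_less_one g,
        unfolded real_sqrt_one mult_1_right]
    show ?thesis
      unfolding Let_def P0_def \<Lambda>_def V0 V1 Pr_def p_def by (rule conjI[OF L])
  qed
  have 3: "o_P1 P0 (\<lambda>n \<omega>. \<Lambda> n \<omega> -
        (\<tau> n \<bullet> (\<Upsilon> n \<omega> *v \<theta>0) + 1 / (2 * \<xi>) * (\<tau> n \<bullet> (\<Upsilon> n \<omega> *v \<tau> n))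
         - p / (2 * (p + 2)) * ((norm (\<tau> n))\<^sup>2 - 1 / (4 * \<xi>\<^sup>2) * (norm (\<tau> n)) ^ 4)))
     \<and> asymp_normal P0 (\<lambda>n \<omega>. vecm (\<Upsilon> n \<omega>))
         (\<lambda>t. t \<bullet> (((p / (p + 2)) *\<^sub>R (mat 1 + commutation_matrix + J_matrix) - J_matrix) *v t))"
    if \<delta>1: "\<forall>n\<ge>1. \<delta> n = 1 / sqrt (real n)" and \<nu>1: "\<forall>n\<ge>1. \<nu> n = 1 / (sqrt (real n) * \<gamma> n)"
  proof -
    have \<delta>: "\<delta> \<longlonglongrightarrow> 0"
    proof (rule Lim_transform_eventually)
      show "(\<lambda>n. inverse (sqrt (real n))) \<longlonglongrightarrow> 0" by (rule tendsto_inverse_0_at_top[OF sqrt_top])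
      show "\<forall>\<^sub>F n in sequentially. inverse (sqrt (real n)) = \<delta> n"
        using eventually_ge_at_top[of 1] by eventually_elim (use \<delta>1 in \<open>simp add: inverse_eq_divide\<close>)
    qed
    have l: "a \<longlonglongrightarrow> 1" "(\<lambda>n. a n + b n) \<longlonglongrightarrow> 1" using lim_a[OF \<delta>] lim_ab[OF \<delta>] by simp_all
    \<comment> \<open>At this rate \<open>sqrt n * b n\<close> equals \<open>\<xi>\<close> exactly,
      so the rate \<open>\<nu> n\<close> is \<open>(a n + b n) / \<xi>\<close>.\<close>
    have \<nu>\<xi>: "\<nu> \<longlonglongrightarrow> 1 / \<xi>"
    proof (rule Lim_transform_eventually)
      show "(\<lambda>n. (a n + b n) / \<xi>) \<longlonglongrightarrow> 1 / \<xi>" using l(2) \<xi> by (intro tendsto_intros) auto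
      show "\<forall>\<^sub>F n in sequentially. (a n + b n) / \<xi> = \<nu> n"
        using eventually_ge_at_top[of 1]
      proof eventually_elim
        fix n :: nat assume n: "n \<ge> 1"
        then have "sqrt (real n) * b n = \<xi>" using \<delta>1 by (simp add: b_def)
        then show "(a n + b n) / \<xi> = \<nu> n" using \<nu>[OF \<nu>1, of n] n by simp
      qed
    qed
    have ab0: "a n + b n > 0" if "n > 0" for n using a[OF that] b[OF that] by simp
    show ?thesis
      unfolding P0_def \<Lambda>_def \<Upsilon>_def V0 V1 p_def
      by (rule conjI[OF spike_lan_contiguous[OF \<theta> a b \<nu>[OF \<nu>1] \<theta>' B l \<nu>\<xi> \<xi>] spike_vecm_normal[OF \<theta> a ab0]])
  qed
  have 4: "o_P1 P0 \<Lambda>" if \<delta>0: "(\<lambda>n. sqrt (real n) * \<delta> n) \<longlonglongrightarrow> 0" and \<nu>1: "\<forall>n\<ge>1. \<nu> n = 1 / \<xi>"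
  proof -
    \<comment> \<open>For \<open>n \<ge> 1\<close> the factor \<open>sqrt n\<close> is at least one,
      so \<open>\<delta>\<close> is dominated by the null sequence of the hypothesis.\<close>
    have \<delta>: "\<delta> \<longlonglongrightarrow> 0"
    proof (rule Lim_null_comparison[OF _ \<delta>0])
      show "\<forall>\<^sub>F n in sequentially. norm (\<delta> n) \<le> sqrt (real n) * \<delta> n"
        using eventually_ge_at_top[of 1]
      proof eventually_elim
        fix n :: nat assume n: "n \<ge> 1"
        then have "1 * \<delta> n \<le> sqrt (real n) * \<delta> n" using \<delta>_pos by (intro mult_right_mono) (auto simp: less_imp_le)
        then show "norm (\<delta> n) \<le> sqrt (real n) * \<delta> n" using \<delta>_pos n by (simp add: less_imp_le)
      qed
    qed
    have l: "a \<longlonglongrightarrow> 1" using lim_a[OF \<delta>] by simp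
    have "(\<lambda>n. \<xi> * (sqrt (real n) * \<delta> n)) \<longlonglongrightarrow> \<xi> * 0" by (intro tendsto_mult tendsto_const \<delta>0)
    then have l2: "(\<lambda>n. sqrt (real n) * b n) \<longlonglongrightarrow> 0" by (simp add: b_def mult_ac)
    have \<nu>c: "\<nu> n = 1 / \<xi>" if "n > 0" for n using \<nu>1 that by simp
    have \<xi>': "1 / \<xi> > 0" using \<xi> by simp
    show ?thesis
      unfolding P0_def \<Lambda>_def V0 V1 by (rule spike_lan_degenerate[OF \<theta> a b \<nu>c \<xi>' \<theta>' B l l2])
  qed
  show ?thesis
    using 1 2 3 4 by blast
qed

end
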